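(* Let $1<s<\infty$, $\beta>0$ and let $s'$ be the exponent conjugate to $s$. Let $c=\{c_k^j:k\ge0,\ 1\le j\le d_k\}$ be a double indexed sequence of complex numbers with associated harmonic function $g=g_c$. Then $c\in M_H(H^s,A^\infty_\beta)$ if and only if $$\sup_{0\le\rho<1}\ \sup_{y'\in\mathbb S}\ (1-\rho)^\beta\left(\int_{\mathbb S}|(g\ast P_{x'})(\rho y')|^{s'}\,dx'\right)^{1/s'}<\infty.$$
   Context: $\mathbb B=\{x\in\mathbb R^n:|x|<1\}$ ($n\ge2$), $\mathbb S=\partial\mathbb B$, $dx'$ is surface measure on $\mathbb S$, and $h(\mathbb B)$ is the space of harmonic functions on $\mathbb B$. Points of $\mathbb B$ are written $x=rx'$, $0\le r<1$, $x'\in\mathbb S$. For each $k\ge0$, $Y^{(k)}_j$, $1\le j\le d_k$, is a fixed real-valued orthonormal basis (in $L^2(\mathbb S)$) of the space of spherical harmonics of order $k$. Each $f\in h(\mathbb B)$ has an expansion $f(rx')=\sum_{k\ge0}r^k\sum_{j=1}^{d_k}b_k^j(f)Y^{(k)}_j(x')$. For a double indexed sequence $c$ set $(c\ast f)(rx')=\sum_{k\ge0}\sum_{j=1}^{d_k}r^kc_k^jb_k^j(f)Y^{(k)}_j(x')$ if the series converges in $\mathbb B$; for $f,g\in h(\mathbb B)$ set $(f\ast g)(rx')=\sum_{k\ge0}\sum_{j=1}^{d_k}r^kb_k^j(f)b_k^j(g)Y^{(k)}_j(x')$, which is harmonic in $\mathbb B$. To $c$ is associated the harmonic function $g_c(rx')=\sum_{k\ge0}r^k\sum_{j=1}^{d_k}c_k^jY^{(k)}_j(x')$.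 For subspaces $X,Y$ of $h(\mathbb B)$, $M_H(X,Y)$ is the space of all double indexed sequences $c$ such that $c\ast f\in Y$ for every $f\in X$. $P_{y'}(x)=c_n\frac{1-|x|^2}{|x-y'|^n}$, $x\in\mathbb B$, $y'\in\mathbb S$, is the Poisson kernel of $\mathbb B$ ($c_n$ the usual normalizing constant). $M_s(f,r)=(\int_{\mathbb S}|f(rx')|^s\,dx')^{1/s}$; $H^s=\{f\in h(\mathbb B):\sup_{0\le r<1}M_s(f,r)<\infty\}$; $A^\infty_\beta=\{f\in h(\mathbb B):\sup_{x\in\mathbb B}(1-|x|^2)^\beta|f(x)|<\infty\}$. *)

theory Defs
  imports "HOL-Analysis.Analysis"
begin

definition harmonic_on :: "'a::euclidean_space set \<Rightarrow> ('a \<Rightarrow> 'b::real_normed_vector) \<Rightarrow> bool" where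
  "harmonic_on U f \<longleftrightarrow>
     (\<exists>(f' :: 'a \<Rightarrow> 'a \<Rightarrow>\<^sub>L 'b) (f'' :: 'a \<Rightarrow> 'a \<Rightarrow>\<^sub>L 'a \<Rightarrow>\<^sub>L 'b).
        (\<forall>x\<in>U. (f has_derivative blinfun_apply (f' x)) (at x)) \<and>
        (\<forall>x\<in>U. (f' has_derivative blinfun_apply (f'' x)) (at x)) \<and>
        continuous_on U f'' \<and>
        (\<forall>x\<in>U. (\<Sum>i\<in>Basis. blinfun_apply (blinfun_apply (f'' x) i) i) = 0))"

text \<open>The elements of \<open>harmonic_ball\<close> are functions on the whole space; their values outside
  the unit ball are irrelevant to everything below.\<close>

definition harmonic_ball :: "('a::euclidean_space \<Rightarrow> complex) set" where
  "harmonic_ball = {f. harmonic_on (ball 0 1) f}"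

text \<open>Surface measure on the unit sphere, through polar coordinates: a Borel set \<open>A\<close> of the sphere
  gets \<open>n\<close> times the Lebesgue measure of the cone of all \<open>r *\<^sub>R x\<close> with \<open>0 < r < 1\<close> and \<open>x \<in> A\<close>.\<close>

definition surface_measure :: "'a::euclidean_space measure" where
  "surface_measure =
     scale_measure (of_nat DIM('a))
       (distr (restrict_space lborel (ball 0 1 - {0})) (restrict_space borel (sphere 0 1)) sgn)"

lemma sgn_measurable_sphere:
  "sgn \<in> restrict_space lborel (ball 0 1 - {0 :: 'a::euclidean_space})
     \<rightarrow>\<^sub>M restrict_space borel (sphere 0 1)"
proof (rule measurable_restrict_space2)
  show "sgn \<in> space (restrict_space lborel (ball 0 1 - {0 :: 'a})) \<rightarrow> sphere 0 1"
    by (auto simp: space_restrict_space norm_sgn)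
  have "continuous_on (ball 0 1 - {0 :: 'a}) sgn"
    by (intro continuous_on_sgn continuous_on_id) auto
  then have "sgn \<in> borel_measurable (restrict_space borel (ball 0 1 - {0 :: 'a}))"
    by (rule borel_measurable_continuous_on_restrict)
  then show "sgn \<in> borel_measurable (restrict_space lborel (ball 0 1 - {0 :: 'a}))"
    by (simp add: measurable_def space_restrict_space sets_restrict_space)
qed

lemma emeasure_surface_measure:
  fixes A :: "'a::euclidean_space set"
  assumes "A \<in> sets borel" "A \<subseteq> sphere 0 1"
  shows "emeasure surface_measure A =
    of_nat DIM('a) * emeasure lborel {r *\<^sub>R x |r x. 0 < r \<and> r < 1 \<and> x \<in> A}"
proof -
  let ?B = "ball 0 1 - {0 :: 'a}"
  have A: "A \<in> sets (restrict_space borel (sphere 0 1))"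
    using assms by (auto simp: sets_restrict_space_iff)
  have "sgn -` A \<inter> ?B = {r *\<^sub>R x |r x. 0 < r \<and> r < 1 \<and> x \<in> A}"
  proof (intro set_eqI iffI)
    fix y assume y: "y \<in> sgn -` A \<inter> ?B"
    then have "y = norm y *\<^sub>R sgn y" by (simp add: sgn_div_norm)
    moreover have "0 < norm y" "norm y < 1" "sgn y \<in> A" using y by auto
    ultimately show "y \<in> {r *\<^sub>R x |r x. 0 < r \<and> r < 1 \<and> x \<in> A}" by blast
  next
    fix y assume "y \<in> {r *\<^sub>R x |r x. 0 < r \<and> r < 1 \<and> x \<in> A}"
    then obtain r x where *: "y = r *\<^sub>R x" "0 < r" "r < 1" "x \<in> A" by blast
    then have "norm x = 1" using assms(2) by auto
    then show "y \<in> sgn -` A \<inter> ?B" using * by (auto simp: sgn_div_norm)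
  qed
  moreover have "emeasure (restrict_space lborel ?B) (sgn -` A \<inter> ?B) = emeasure lborel (sgn -` A \<inter> ?B)"
    by (rule emeasure_restrict_space) auto
  moreover have "space (restrict_space lborel ?B) = ?B" by (simp add: space_restrict_space)
  ultimately show ?thesis
    by (simp add: surface_measure_def emeasure_distr[OF sgn_measurable_sphere A])
qed

definition spherical_harmonics :: "nat \<Rightarrow> ('a::euclidean_space \<Rightarrow> complex) set" where
  "spherical_harmonics k =
     {u. \<exists>p. polynomial_function p \<and> (\<forall>t x. p (t *\<^sub>R x) = t ^ k *\<^sub>R p x) \<and>
             harmonic_on UNIV p \<and> (\<forall>x\<in>sphere 0 1. u x = p x)}"

definition spherical_harmonic_basis ::
    "(nat \<Rightarrow> nat) \<Rightarrow> (nat \<Rightarrow> nat \<Rightarrow> 'a::euclidean_space \<Rightarrow> real) \<Rightarrow> bool" where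
  "spherical_harmonic_basis d Y \<longleftrightarrow>
     (\<forall>k. (\<forall>j\<in>{1..d k}. (\<lambda>x. complex_of_real (Y k j x)) \<in> spherical_harmonics k) \<and>
          (\<forall>i\<in>{1..d k}. \<forall>j\<in>{1..d k}.
             (\<integral>x. Y k i x * Y k j x \<partial>surface_measure) = (if i = j then 1 else 0)) \<and>
          (\<forall>u\<in>spherical_harmonics k. \<exists>a. \<forall>x\<in>sphere 0 1.
             u x = (\<Sum>j=1..d k. a j * complex_of_real (Y k j x))))"

text \<open>Writing \<open>x = r *\<^sub>R x'\<close>, the direction \<open>x'\<close> at the origin is an arbitrary unit vector. The
  choice does not matter: at \<open>r = 0\<close> only the terms of order \<open>0\<close> survive, and spherical harmonics of
  order \<open>0\<close> are constant on the sphere.\<close>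

definition direction :: "'a::euclidean_space \<Rightarrow> 'a" where
  "direction x = (if x = 0 then (SOME u. norm u = 1) else sgn x)"

definition harmonic_term ::
    "(nat \<Rightarrow> nat) \<Rightarrow> (nat \<Rightarrow> nat \<Rightarrow> 'a::euclidean_space \<Rightarrow> real) \<Rightarrow> (nat \<Rightarrow> nat \<Rightarrow> complex) \<Rightarrow> 'a \<Rightarrow> nat
       \<Rightarrow> complex" where
  "harmonic_term d Y b x k =
     complex_of_real (norm x ^ k) * (\<Sum>j=1..d k. b k j * complex_of_real (Y k j (direction x)))"

definition series_converges ::
    "(nat \<Rightarrow> nat) \<Rightarrow> (nat \<Rightarrow> nat \<Rightarrow> 'a::euclidean_space \<Rightarrow> real) \<Rightarrow> (nat \<Rightarrow> nat \<Rightarrow> complex) \<Rightarrow> bool" where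
  "series_converges d Y b \<longleftrightarrow> (\<forall>x\<in>ball 0 1. summable (harmonic_term d Y b x))"

definition series_function ::
    "(nat \<Rightarrow> nat) \<Rightarrow> (nat \<Rightarrow> nat \<Rightarrow> 'a::euclidean_space \<Rightarrow> real) \<Rightarrow> (nat \<Rightarrow> nat \<Rightarrow> complex) \<Rightarrow> 'a
       \<Rightarrow> complex" where
  "series_function d Y b x = (\<Sum>k. harmonic_term d Y b x k)"

text \<open>Coefficients are indexed by \<open>1 \<le> j \<le> d k\<close>; setting them to \<open>0\<close> for the other \<open>j\<close> makes the
  expansion unique.\<close>

definition harmonic_coeff ::
    "(nat \<Rightarrow> nat) \<Rightarrow> (nat \<Rightarrow> nat \<Rightarrow> 'a::euclidean_space \<Rightarrow> real) \<Rightarrow> ('a \<Rightarrow> complex) \<Rightarrow> nat \<Rightarrow> nat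
       \<Rightarrow> complex" where
  "harmonic_coeff d Y f =
     (THE b. (\<forall>k j. j \<notin> {1..d k} \<longrightarrow> b k j = 0) \<and>
             (\<forall>x\<in>ball 0 1. harmonic_term d Y b x sums f x))"

definition harmonic_conv ::
    "(nat \<Rightarrow> nat) \<Rightarrow> (nat \<Rightarrow> nat \<Rightarrow> 'a::euclidean_space \<Rightarrow> real) \<Rightarrow> ('a \<Rightarrow> complex) \<Rightarrow> ('a \<Rightarrow> complex)
       \<Rightarrow> 'a \<Rightarrow> complex" where
  "harmonic_conv d Y f g =
     series_function d Y (\<lambda>k j. harmonic_coeff d Y f k j * harmonic_coeff d Y g k j)"

definition multipliers ::
    "(nat \<Rightarrow> nat) \<Rightarrow> (nat \<Rightarrow> nat \<Rightarrow> 'a::euclidean_space \<Rightarrow> real) \<Rightarrow> ('a \<Rightarrow> complex) set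
       \<Rightarrow> ('a \<Rightarrow> complex) set \<Rightarrow> (nat \<Rightarrow> nat \<Rightarrow> complex) set" where
  "multipliers d Y X Z =
     {c. \<forall>f\<in>X. series_converges d Y (\<lambda>k j. c k j * harmonic_coeff d Y f k j) \<and>
               series_function d Y (\<lambda>k j. c k j * harmonic_coeff d Y f k j) \<in> Z}"

text \<open>The constant is the one for which the Poisson kernel has integral \<open>1\<close> over the sphere.\<close>

definition poisson_kernel :: "'a::euclidean_space \<Rightarrow> 'a \<Rightarrow> complex" where
  "poisson_kernel y x =
     complex_of_real (1 / measure (surface_measure :: 'a measure) (sphere 0 1) *
       ((1 - (norm x)\<^sup>2) / norm (x - y) ^ DIM('a)))"

definition sphere_mean :: "real \<Rightarrow> ('a::euclidean_space \<Rightarrow> complex) \<Rightarrow> real \<Rightarrow> real" where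
  "sphere_mean s f r = (\<integral>x. cmod (f (r *\<^sub>R x)) powr s \<partial>surface_measure) powr (1 / s)"

definition harmonic_hardy :: "real \<Rightarrow> ('a::euclidean_space \<Rightarrow> complex) set" where
  "harmonic_hardy s = {f \<in> harmonic_ball. (SUP r\<in>{0..<1}. ereal (sphere_mean s f r)) < \<infinity>}"

definition weighted_sup_space :: "real \<Rightarrow> ('a::euclidean_space \<Rightarrow> complex) set" where
  "weighted_sup_space \<beta> =
     {f \<in> harmonic_ball. (SUP x\<in>ball 0 1. ereal ((1 - (norm x)\<^sup>2) powr \<beta> * cmod (f x))) < \<infinity>}"

end

theory Submission
  imports Defs
begin

text \<open>
  Let \<open>G\<^sub>w(x) = \<Sum>\<^sub>k\<^sub>j \<bar>w\<bar>\<^sup>k c\<^sub>k\<^sub>j Y\<^sub>k\<^sub>j(x) Y\<^sub>k\<^sub>j(w / \<bar>w\<bar>)\<close>. Since the coefficients of the Poisson kernel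
  with pole \<open>x\<close> are \<open>Y\<^sub>k\<^sub>j(x)\<close> (\<open>poisson_coeff\<close>), the convolution of \<open>g\<close> with this kernel, evaluated at
  \<open>w\<close>, is \<open>G\<^sub>w(x)\<close>, and the condition of the theorem bounds the \<open>L\<^sup>s\<^sup>'\<close> norm of \<open>G\<^sub>w\<close> by a multiple of
  \<open>(1 - \<bar>w\<bar>)\<^sup>-\<^sup>\<beta>\<close>. The link with multipliers is duality: for \<open>\<phi>\<close> on the sphere, the integral of
  \<open>\<phi> G\<^sub>w\<close> is the value at \<open>w\<close> of the convolution of \<open>c\<close> with the Poisson integral of \<open>\<phi>\<close>
  (\<open>conv_kernel_integral\<close>).

  If the norms are bounded, take \<open>\<phi>(x) = f(r x)\<close> with \<open>f\<close> in the Hardy space, apply Hoelder's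
  inequality and let \<open>r\<close> tend to \<open>1\<close> (\<open>convolution_bound\<close>). Conversely, let \<open>c\<close> be a multiplier. The
  Poisson integral of an \<open>L\<^sup>s\<close> function lies in the Hardy space (\<open>poisson_integral_hardy\<close>), so the
  functionals \<open>\<phi> \<mapsto> (1 - \<bar>w\<bar>)\<^sup>\<beta> \<integral> \<phi> G\<^sub>w\<close> are bounded at each \<open>\<phi>\<close> of \<open>L\<^sup>s\<close>, hence uniformly bounded. The
  uniform boundedness principle is used in the form of a gliding hump (\<open>multiplier_kernel_bounded\<close>):
  if the norms were unbounded, functions that are extremal for kernels of rapidly growing norm could
  be superposed, with weights \<open>3\<^sup>-\<^sup>i\<close> and suitable signs, to a single \<open>\<phi>\<close> violating the bound. A
  multiplier automatically has coefficients whose series converges to a harmonic function, as one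
  sees by applying it to one bounded harmonic function with slowly decaying coefficients
  (\<open>multiplier_subexp\<close>).

  The harmonic analysis on which this rests is developed from the derivatives of polynomials.
  Homogeneous harmonic polynomials (solid harmonics) of different degrees are orthogonal on the
  sphere, because integration by parts against a radial weight relates their weighted inner product
  to a symmetric expression, with a factor that is the degree of either of them. Their values and
  derivatives are controlled by their means over the sphere up to the factor \<open>(1 + \<delta>)\<^sup>k\<close>, for every
  \<open>\<delta> > 0\<close>, by the mean value property (\<open>solid_harmonic_estimate\<close>). Therefore a series of spherical
  harmonics converges to a harmonic function as soon as its coefficients have subexponential growth.
  The span of the solid harmonics is dense in the continuous functions on the sphere, because on the
  sphere it is invariant under multiplication by linear forms (\<open>solid_harmonic_mult_linear\<close>).
  Density and the maximum principle yield the expansion of every harmonic function on the ball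
  (\<open>real_valued_expansion\<close>). The Poisson kernel is then treated as one more harmonic function: its
  coefficients are found from its symmetry and its concentration at the boundary.
\<close>

section \<open>Laplacians of polynomials\<close>

definition dir_deriv :: "'a::euclidean_space \<Rightarrow> ('a \<Rightarrow> real) \<Rightarrow> 'a \<Rightarrow> real" where
  "dir_deriv v p x = frechet_derivative p (at x) v"

lemma dir_deriv_eqI: "(p has_derivative D) (at x) \<Longrightarrow> dir_deriv v p x = D v"
  unfolding dir_deriv_def by (metis frechet_derivative_at)

lemma poly_has_derivative:
  "real_polynomial_function p \<Longrightarrow> (p has_derivative (\<lambda>v. dir_deriv v p x)) (at x)"
  unfolding dir_deriv_def
  by (metis (no_types, lifting) differentiable_at_real_polynomial_function eta_contract_eq
      frechet_derivative_works)

lemma dir_deriv_bounded_linear: "bounded_linear f \<Longrightarrow> dir_deriv v f = (\<lambda>x. f v)"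
  by (intro ext dir_deriv_eqI bounded_linear_imp_has_derivative)

lemma dir_deriv_const: "dir_deriv v (\<lambda>x. c) = (\<lambda>x. 0)"
  by (intro ext dir_deriv_eqI[where D = "\<lambda>_. 0"]) (rule has_derivative_const)

lemma dir_deriv_add:
  assumes "real_polynomial_function p" "real_polynomial_function q"
  shows "dir_deriv v (\<lambda>x. p x + q x) = (\<lambda>x. dir_deriv v p x + dir_deriv v q x)"
  by (intro ext dir_deriv_eqI[where D = "\<lambda>v. dir_deriv v p x + dir_deriv v q x" for x])
     (intro has_derivative_add poly_has_derivative assms)

lemma dir_deriv_mult:
  assumes "real_polynomial_function p" "real_polynomial_function q"
  shows "dir_deriv v (\<lambda>x. p x * q x) = (\<lambda>x. p x * dir_deriv v q x + dir_deriv v p x * q x)"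
  by (intro ext dir_deriv_eqI[where D = "\<lambda>v. p x * dir_deriv v q x + dir_deriv v p x * q x" for x])
     (intro has_derivative_mult poly_has_derivative assms)

lemma poly_dir_deriv: "real_polynomial_function p \<Longrightarrow> real_polynomial_function (dir_deriv v p)"
  by (induction rule: real_polynomial_function.induct)
     (auto simp: dir_deriv_bounded_linear dir_deriv_const dir_deriv_add dir_deriv_mult)

lemma dir_deriv_commute:
  "real_polynomial_function p \<Longrightarrow> dir_deriv v (dir_deriv w p) = dir_deriv w (dir_deriv v p)"
  by (induction rule: real_polynomial_function.induct)
     (auto simp: dir_deriv_bounded_linear dir_deriv_const dir_deriv_add dir_deriv_mult
        poly_dir_deriv real_polynomial_function.intros algebra_simps)

lemma dir_deriv_linear: "real_polynomial_function p \<Longrightarrow> linear (\<lambda>v. dir_deriv v p x)"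
  using poly_has_derivative has_derivative_linear by blast

lemma dir_deriv_cmult:
  assumes "real_polynomial_function p"
  shows "dir_deriv v (\<lambda>x. c * p x) = (\<lambda>x. c * dir_deriv v p x)"
  using dir_deriv_mult[OF real_polynomial_function.intros(2) assms, of v c] by (simp add: dir_deriv_const)

lemma dir_deriv_diff:
  assumes "real_polynomial_function p" "real_polynomial_function q"
  shows "dir_deriv v (\<lambda>x. p x - q x) = (\<lambda>x. dir_deriv v p x - dir_deriv v q x)"
  by (intro ext dir_deriv_eqI[where D = "\<lambda>v. dir_deriv v p x - dir_deriv v q x" for x])
     (intro has_derivative_diff poly_has_derivative assms)

lemma dir_deriv_sum:
  assumes "\<And>i. i \<in> I \<Longrightarrow> real_polynomial_function (p i)"
  shows "dir_deriv v (\<lambda>x. \<Sum>i\<in>I. p i x) = (\<lambda>x. \<Sum>i\<in>I. dir_deriv v (p i) x)"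
  by (intro ext dir_deriv_eqI[where D = "\<lambda>v. \<Sum>i\<in>I. dir_deriv v (p i) x" for x])
     (intro has_derivative_sum poly_has_derivative assms)

lemma poly_continuous: "real_polynomial_function p \<Longrightarrow> continuous_on S p"
  using continuous_on_polymonial_function real_polynomial_function_eq by blast

definition laplacian :: "('a::euclidean_space \<Rightarrow> real) \<Rightarrow> 'a \<Rightarrow> real" where
  "laplacian p x = (\<Sum>i\<in>Basis. dir_deriv i (dir_deriv i p) x)"

lemma laplacian_mult:
  fixes p q :: "'a::euclidean_space \<Rightarrow> real"
  assumes "real_polynomial_function p" "real_polynomial_function q"
  shows "laplacian (\<lambda>x. p x * q x) x =
    p x * laplacian q x + 2 * (\<Sum>i\<in>Basis. dir_deriv i p x * dir_deriv i q x) + laplacian p x * q x"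
  using assms
  by (simp add: laplacian_def dir_deriv_mult dir_deriv_add poly_dir_deriv
      real_polynomial_function.intros sum.distrib sum_distrib_left sum_distrib_right algebra_simps)

lemma laplacian_sum:
  assumes "\<And>i. i \<in> I \<Longrightarrow> real_polynomial_function (p i)"
  shows "laplacian (\<lambda>x. \<Sum>i\<in>I. p i x) x = (\<Sum>i\<in>I. laplacian (p i) x)"
  using assms unfolding laplacian_def
  by (simp add: dir_deriv_sum poly_dir_deriv) (rule sum.swap)

lemma laplacian_cmult:
  assumes "real_polynomial_function p"
  shows "laplacian (\<lambda>x. c * p x) x = c * laplacian p x"
  using assms by (simp add: laplacian_def dir_deriv_cmult poly_dir_deriv sum_distrib_left)

lemma laplacian_diff:
  assumes "real_polynomial_function p" "real_polynomial_function q"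
  shows "laplacian (\<lambda>x. p x - q x) x = laplacian p x - laplacian q x"
  using assms by (simp add: laplacian_def dir_deriv_diff poly_dir_deriv sum_subtractf)

lemma laplacian_dir_deriv:
  assumes "real_polynomial_function p"
  shows "laplacian (dir_deriv v p) = dir_deriv v (laplacian p)"
proof -
  have "dir_deriv i (dir_deriv i (dir_deriv v p)) = dir_deriv v (dir_deriv i (dir_deriv i p))" for i
    using assms by (metis dir_deriv_commute poly_dir_deriv)
  then show ?thesis
    using assms unfolding laplacian_def
    by (subst dir_deriv_sum) (auto simp: poly_dir_deriv laplacian_def)
qed

section \<open>Homogeneous harmonic polynomials\<close>

definition solid_harmonic :: "nat \<Rightarrow> ('a::euclidean_space \<Rightarrow> real) \<Rightarrow> bool" where
  "solid_harmonic k p \<longleftrightarrow> real_polynomial_function p \<and> (\<forall>t x. p (t *\<^sub>R x) = t ^ k * p x) \<and>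
     (\<forall>x. laplacian p x = 0)"

lemma solid_harmonicD:
  assumes "solid_harmonic k p"
  shows "real_polynomial_function p" "p (t *\<^sub>R x) = t ^ k * p x" "laplacian p x = 0"
  using assms by (auto simp: solid_harmonic_def)

lemma euler_identity:
  assumes "solid_harmonic k p"
  shows "dir_deriv x p x = k * p x"
proof -
  have "((\<lambda>t::real. p (t *\<^sub>R x)) has_derivative (\<lambda>h. dir_deriv (h *\<^sub>R x) p x)) (at 1)"
    by (rule has_derivative_compose[where g = p and f = "\<lambda>t. t *\<^sub>R x" and x = 1 and s = UNIV, simplified])
       (auto intro!: derivative_eq_intros poly_has_derivative solid_harmonicD[OF assms])
  moreover have "((\<lambda>t::real. p (t *\<^sub>R x)) has_derivative (\<lambda>h. k * h * p x)) (at 1)"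
    unfolding solid_harmonicD(2)[OF assms] by (auto intro!: derivative_eq_intros)
  ultimately have "(\<lambda>h. dir_deriv (h *\<^sub>R x) p x) = (\<lambda>h::real. k * h * p x)"
    by (rule has_derivative_unique)
  from fun_cong[OF this, of 1] show ?thesis by simp
qed

text \<open>Differentiating \<open>p (t x) = t\<^sup>k p x\<close> in \<open>x\<close> produces an additional factor \<open>t\<close> on the left.\<close>

lemma dir_deriv_homogeneous:
  assumes "solid_harmonic k p"
  shows "dir_deriv v p (t *\<^sub>R x) = t ^ (k - 1) * dir_deriv v p x"
proof -
  note p = solid_harmonicD(1)[OF assms]
  have *: "t * dir_deriv v p (t *\<^sub>R x) = t ^ k * dir_deriv v p x" for t
  proof -
    have "((\<lambda>x. p (t *\<^sub>R x)) has_derivative (\<lambda>v. dir_deriv (t *\<^sub>R v) p (t *\<^sub>R x))) (at x)"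
      by (rule has_derivative_compose[where g = p and f = "\<lambda>x. t *\<^sub>R x" and x = x and s = UNIV, simplified])
         (auto intro!: derivative_eq_intros poly_has_derivative p)
    moreover have "((\<lambda>x. p (t *\<^sub>R x)) has_derivative (\<lambda>v. t ^ k * dir_deriv v p x)) (at x)"
      unfolding solid_harmonicD(2)[OF assms]
      by (intro has_derivative_mult_right poly_has_derivative p)
    ultimately have "(\<lambda>v. dir_deriv (t *\<^sub>R v) p (t *\<^sub>R x)) = (\<lambda>v. t ^ k * dir_deriv v p x)"
      by (rule has_derivative_unique)
    then have "dir_deriv (t *\<^sub>R v) p (t *\<^sub>R x) = t ^ k * dir_deriv v p x"
      by (rule fun_cong)
    then show ?thesis
      using linear_scale[OF dir_deriv_linear[OF p, of "t *\<^sub>R x"], of t v] by simp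
  qed
  show ?thesis
  proof (cases "k = 0")
    case True
    have "dir_deriv v p y = 0" for y
    proof -
      have "p x = p 0" for x using solid_harmonicD(2)[OF assms, of 0 x] True by simp
      then have "p = (\<lambda>_. p 0)" by auto
      then show ?thesis by (metis dir_deriv_const)
    qed
    then show ?thesis by simp
  next
    case False
    then have kk: "t ^ k = t * t ^ (k - 1)" for t :: real
      by (metis power_eq_if)
    have ne: "dir_deriv v p (t *\<^sub>R x) = t ^ (k - 1) * dir_deriv v p x" if "t \<noteq> 0" for t
      using *[of t] that by (simp add: kk)
    \<comment> \<open>Dividing by \<open>t\<close> loses \<open>t = 0\<close>, which is recovered by continuity.\<close>
    have "continuous_on UNIV (\<lambda>t. dir_deriv v p (t *\<^sub>R x) - t ^ (k - 1) * dir_deriv v p x)"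
      by (intro continuous_intros continuous_on_compose2[OF poly_continuous[OF poly_dir_deriv[OF p]]]) auto
    then have "closed {t. dir_deriv v p (t *\<^sub>R x) - t ^ (k - 1) * dir_deriv v p x = 0}" (is "closed ?Z")
      using continuous_closed_preimage_constant[of UNIV _ 0] by fastforce
    moreover have "- {0} \<subseteq> ?Z" using ne by auto
    ultimately have "closure (- {0}) \<subseteq> ?Z" by (rule closure_minimal[rotated])
    then show ?thesis by (auto simp: closure_complement)
  qed
qed

lemma solid_harmonic_dir_deriv:
  assumes "solid_harmonic k p"
  shows "solid_harmonic (k - 1) (dir_deriv v p)"
proof -
  have "laplacian p = (\<lambda>_. 0)" using solid_harmonicD[OF assms] by auto
  then show ?thesis
    using dir_deriv_homogeneous[OF assms] solid_harmonicD[OF assms]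
    by (auto simp: solid_harmonic_def poly_dir_deriv laplacian_dir_deriv dir_deriv_const)
qed

lemma solid_harmonic_sum:
  assumes "\<And>i. i \<in> I \<Longrightarrow> solid_harmonic k (p i)"
  shows "solid_harmonic k (\<lambda>x. \<Sum>i\<in>I. a i * p i x)"
proof (cases "finite I")
  case True
  have pp [intro]: "real_polynomial_function (p i)" if "i \<in> I" for i
    using assms[OF that] by (rule solid_harmonicD)
  then have "real_polynomial_function (\<lambda>x. \<Sum>i\<in>I. a i * p i x)"
    using True by (intro real_polynomial_function_sum) auto
  moreover have "laplacian (\<lambda>x. \<Sum>i\<in>I. a i * p i x) x = 0" for x
    by (subst laplacian_sum) (auto simp: laplacian_cmult[OF pp] solid_harmonicD(3)[OF assms] intro!: sum.neutral)
  moreover have "(\<Sum>i\<in>I. a i * p i (t *\<^sub>R x)) = t ^ k * (\<Sum>i\<in>I. a i * p i x)" for t x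
    by (auto simp: sum_distrib_left solid_harmonicD(2)[OF assms] algebra_simps intro!: sum.cong)
  ultimately show ?thesis by (simp add: solid_harmonic_def)
next
  case False
  then show ?thesis by (auto simp: solid_harmonic_def laplacian_def dir_deriv_const)
qed

lemma solid_harmonic_cmult: "solid_harmonic k p \<Longrightarrow> solid_harmonic k (\<lambda>x. a * p x)"
  using solid_harmonic_sum[of "{()}" k "\<lambda>_. p" "\<lambda>_. a"] by simp

lemma solid_harmonic_const: "solid_harmonic 0 (\<lambda>x. c)"
  by (auto simp: solid_harmonic_def laplacian_def dir_deriv_const)

lemma poly_inner: "real_polynomial_function (\<lambda>x. x \<bullet> v)"
  by (intro real_polynomial_function.intros(1) bounded_linear_inner_left)

lemma dir_deriv_inner: "dir_deriv w (\<lambda>x. x \<bullet> v) = (\<lambda>x. w \<bullet> v)"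
  by (rule dir_deriv_bounded_linear) (rule bounded_linear_inner_left)

lemma laplacian_inner: "laplacian (\<lambda>x. x \<bullet> v) x = 0"
  by (simp add: laplacian_def dir_deriv_inner dir_deriv_const)

lemma dir_deriv_expand:
  assumes "real_polynomial_function p"
  shows "(\<Sum>i\<in>Basis. (v \<bullet> i) * dir_deriv i p x) = dir_deriv v p x"
proof -
  have "dir_deriv v p x = dir_deriv (\<Sum>i\<in>Basis. (v \<bullet> i) *\<^sub>R i) p x"
    by (simp add: euclidean_representation)
  also have "\<dots> = (\<Sum>i\<in>Basis. (v \<bullet> i) * dir_deriv i p x)"
    by (subst linear_sum[OF dir_deriv_linear[OF assms]])
       (simp add: linear_scale[OF dir_deriv_linear[OF assms]])
  finally show ?thesis by simp
qed

lemma poly_norm_sq: "real_polynomial_function (\<lambda>x::'a::euclidean_space. (norm x)\<^sup>2)"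
proof -
  have "(\<lambda>x::'a. (norm x)\<^sup>2) = (\<lambda>x. \<Sum>i\<in>Basis. (x \<bullet> i) * (x \<bullet> i))"
    by (intro ext) (metis dot_square_norm euclidean_inner)
  then show ?thesis by (auto intro!: real_polynomial_function_sum poly_inner)
qed

lemma dir_deriv_norm_sq: "dir_deriv v (\<lambda>x::'a::euclidean_space. (norm x)\<^sup>2) = (\<lambda>x. 2 * (x \<bullet> v))"
  by (intro ext dir_deriv_eqI[where D = "\<lambda>v. 2 * (x \<bullet> v)" for x])
     (auto intro!: derivative_eq_intros simp: power2_norm_eq_inner inner_commute)

lemma laplacian_norm_sq: "laplacian (\<lambda>x::'a::euclidean_space. (norm x)\<^sup>2) x = 2 * DIM('a)"
  by (simp add: laplacian_def dir_deriv_norm_sq dir_deriv_cmult poly_inner dir_deriv_inner)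

lemma laplacian_inner_mult:
  assumes p: "solid_harmonic k p"
  shows "laplacian (\<lambda>x. (x \<bullet> v) * p x) x = 2 * dir_deriv v p x"
  using solid_harmonicD[OF p] dir_deriv_expand[of p v]
  by (simp add: laplacian_mult poly_inner dir_deriv_inner laplacian_inner inner_commute)

lemma laplacian_norm_sq_mult:
  fixes q :: "'a::euclidean_space \<Rightarrow> real"
  assumes q: "solid_harmonic l q"
  shows "laplacian (\<lambda>x. (norm x)\<^sup>2 * q x) x = (2 * DIM('a) + 4 * l) * q x"
proof -
  have "(\<Sum>i\<in>Basis. (2 * (x \<bullet> i)) * dir_deriv i q x) = 2 * (\<Sum>i\<in>Basis. (x \<bullet> i) * dir_deriv i q x)"
    by (simp add: sum_distrib_left mult.assoc)
  also have "\<dots> = 2 * (l * q x)"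
    using dir_deriv_expand[OF solid_harmonicD(1)[OF q], of x x] euler_identity[OF q] by simp
  finally show ?thesis
    using solid_harmonicD[OF q]
    by (simp add: laplacian_mult poly_norm_sq dir_deriv_norm_sq laplacian_norm_sq algebra_simps)
qed

text \<open>On the unit sphere multiplication by a linear form preserves the span of the solid harmonics:
  subtracting a multiple of \<open>\<bar>x\<bar>\<^sup>2 \<partial>\<^sub>v p\<close> makes \<open>(x \<bullet> v) p\<close> harmonic, and on the sphere this
  correction is a multiple of the solid harmonic \<open>\<partial>\<^sub>v p\<close>.\<close>

lemma solid_harmonic_mult_linear:
  fixes p :: "'a::euclidean_space \<Rightarrow> real"
  assumes p: "solid_harmonic k p" and N: "DIM('a) \<ge> 2"
  obtains p1 p2 where "solid_harmonic (Suc k) p1" "solid_harmonic (k - 1) p2"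
    "\<And>x. x \<in> sphere 0 1 \<Longrightarrow> (x \<bullet> v) * p x = p1 x + p2 x"
proof -
  note pp = solid_harmonicD(1)[OF p]
  define q where "q = dir_deriv v p"
  define a where "a = 1 / (DIM('a) + 2 * real k - 2)"
  have q: "solid_harmonic (k - 1) q" unfolding q_def by (rule solid_harmonic_dir_deriv[OF p])
  define p1 where "p1 x = (x \<bullet> v) * p x - a * ((norm x)\<^sup>2 * q x)" for x
  have q0: "q x = 0" if "k = 0" for x
  proof -
    have "p x = p 0" for x using solid_harmonicD(2)[OF p, of 0 x] that by simp
    then have "p = (\<lambda>_. p 0)" by auto
    then show ?thesis by (metis dir_deriv_const q_def)
  qed
  have "real_polynomial_function p1"
    unfolding p1_def using pp solid_harmonicD(1)[OF q]
    by (intro real_polynomial_function_diff real_polynomial_function.intros(2-) poly_inner poly_norm_sq)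
  moreover have "p1 (t *\<^sub>R x) = t ^ Suc k * p1 x" for t x
  proof (cases "k = 0")
    case True
    then show ?thesis
      using solid_harmonicD(2)[OF p, of t x] by (simp add: p1_def q0)
  next
    case False
    then have kk: "t ^ k = t * t ^ (k - 1)" by (metis power_eq_if)
    show ?thesis
      using solid_harmonicD(2)[OF p, of t x] solid_harmonicD(2)[OF q, of t x]
      by (simp add: p1_def kk power_mult_distrib power2_eq_square algebra_simps)
  qed
  moreover have "laplacian p1 x = 0" for x
  proof -
    have "laplacian p1 x = 2 * q x - a * ((2 * DIM('a) + 4 * real (k - 1)) * q x)"
      unfolding p1_def
      using pp solid_harmonicD(1)[OF q] laplacian_norm_sq_mult[OF q, of x] laplacian_inner_mult[OF p, of v x]
      by (simp add: laplacian_diff laplacian_cmult poly_inner poly_norm_sq q_def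
          real_polynomial_function.intros(2-))
    also have "\<dots> = 0"
    proof (cases "k = 0")
      case False
      then have "a * (2 * DIM('a) + 4 * real (k - 1)) = 2"
        using N by (simp add: a_def of_nat_diff field_simps)
      then show ?thesis by (metis mult.assoc right_minus_eq)
    qed (simp add: q0)
    finally show ?thesis .
  qed
  ultimately have "solid_harmonic (Suc k) p1" by (simp add: solid_harmonic_def)
  moreover have "(x \<bullet> v) * p x = p1 x + a * q x" if "x \<in> sphere 0 1" for x
    using that by (simp add: p1_def)
  ultimately show ?thesis
    using that solid_harmonic_cmult[OF q, of a] by blast
qed

section \<open>Integration by parts against compactly supported weights\<close>

lemma lborel_integral_affine:
  fixes f :: "'a::euclidean_space \<Rightarrow> real"
  assumes c: "0 < c" and f [measurable]: "f \<in> borel_measurable borel"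
  shows "(\<integral>x. f x \<partial>lborel) = c ^ DIM('a) * (\<integral>x. f (t + c *\<^sub>R x) \<partial>lborel)"
proof -
  have "(\<integral>x. f x \<partial>lborel) =
      (\<integral>x. f x \<partial>density (distr lborel borel (\<lambda>x. t + c *\<^sub>R x)) (\<lambda>_. \<bar>c\<bar> ^ DIM('a)))"
    using c lborel_affine[of c t] by simp
  also have "\<dots> = (\<integral>x. c ^ DIM('a) * f x \<partial>distr lborel borel (\<lambda>x. t + c *\<^sub>R x))"
    using c by (subst integral_density) auto
  also have "\<dots> = c ^ DIM('a) * (\<integral>x. f (t + c *\<^sub>R x) \<partial>lborel)"
    by (subst integral_distr) auto
  finally show ?thesis .
qed

lemma integrable_compact_support:
  fixes f :: "'a::euclidean_space \<Rightarrow> real"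
  assumes "continuous_on UNIV f" "\<And>x. R < norm x \<Longrightarrow> f x = 0"
  shows "integrable lborel f"
proof -
  have "(\<lambda>x. indicator (cball 0 R) x *\<^sub>R f x) = f"
    using assms(2) by (auto simp: indicator_def fun_eq_iff not_le)
  then show ?thesis
    using borel_integrable_compact[of "cball 0 R" f] assms(1) continuous_on_subset by fastforce
qed

text \<open>By translation invariance the difference quotients of \<open>F\<close> in the direction \<open>v\<close> have integral \<open>0\<close>;
  they are bounded and supported in a fixed ball, so that dominated convergence applies.\<close>

lemma integral_derivative_eq_0:
  fixes F :: "'a::euclidean_space \<Rightarrow> real"
  assumes der: "\<And>x. (F has_derivative F' x) (at x)"
    and cont: "continuous_on UNIV (\<lambda>x. F' x v)"
    and supp: "\<And>x. 1 \<le> norm x \<Longrightarrow> F x = 0"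
  shows "(\<integral>x. F' x v \<partial>lborel) = 0"
proof -
  have contF: "continuous_on UNIV F"
    using der by (meson continuous_at_imp_continuous_on has_derivative_continuous)
  have supp': "F' x v = 0" if "1 < norm x" for x :: 'a
  proof -
    have "open (- cball (0::'a) 1)" by auto
    moreover have "x \<in> - cball 0 1" using that by auto
    ultimately have "(F has_derivative (\<lambda>_. 0)) (at x)"
      using supp by (intro has_derivative_transform_within_open[OF has_derivative_const[of "0::real"]]) auto
    with der have "F' x = (\<lambda>_. 0)" by (rule has_derivative_unique)
    then show ?thesis by simp
  qed
  have "bounded ((\<lambda>x. F' x v) ` cball 0 1)"
    by (intro compact_imp_bounded compact_continuous_image continuous_on_subset[OF cont]) auto
  then obtain B where B0: "B > 0" "\<And>x. x \<in> cball 0 1 \<Longrightarrow> \<bar>F' x v\<bar> \<le> B"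
    by (auto simp: bounded_pos)
  have B: "\<bar>F' x v\<bar> \<le> B" for x
    using B0 supp'[of x] by (cases "norm x \<le> 1") auto
  have line: "((\<lambda>s. F (x + s *\<^sub>R v)) has_real_derivative F' (x + s *\<^sub>R v) v) (at s)" for x s
  proof -
    have "((\<lambda>s. F (x + s *\<^sub>R v)) has_derivative (\<lambda>h. F' (x + s *\<^sub>R v) (h *\<^sub>R v))) (at s)"
      by (rule has_derivative_compose[where g = F and f = "\<lambda>s. x + s *\<^sub>R v" and x = s and s = UNIV, simplified])
         (auto intro!: derivative_eq_intros der)
    moreover have "linear (F' (x + s *\<^sub>R v))" using der has_derivative_linear by blast
    then have "(\<lambda>h. F' (x + s *\<^sub>R v) (h *\<^sub>R v)) = (\<lambda>h. F' (x + s *\<^sub>R v) v * h)"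
      by (simp add: linear_scale mult.commute fun_eq_iff)
    ultimately show ?thesis by (simp add: has_field_derivative_def)
  qed
  define q where "q n x = real (Suc n) * (F (x + (1 / real (Suc n)) *\<^sub>R v) - F x)" for n x
  have intF: "integrable lborel (\<lambda>x. F (x + s *\<^sub>R v))" for s
    by (rule integrable_compact_support[where R = "1 + norm (s *\<^sub>R v)"])
       (auto intro!: supp continuous_on_compose2[OF contF] continuous_intros
          intro: order_trans[OF _ norm_diff_ineq])
  have "(\<integral>x. F (x + s *\<^sub>R v) \<partial>lborel) = (\<integral>x. F x \<partial>lborel)" for s
    using lborel_integral_affine[of 1 F "s *\<^sub>R v"] borel_measurable_continuous_onI[OF contF]
    by (simp add: add.commute)
  then have q0: "(\<integral>x. q n x \<partial>lborel) = 0" for n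
    unfolding q_def using intF[of 0] intF[of "1 / real (Suc n)"]
    by (simp add: Bochner_Integration.integral_diff)
  have "(\<lambda>n. \<integral>x. q n x \<partial>lborel) \<longlonglongrightarrow> (\<integral>x. F' x v \<partial>lborel)"
  proof (rule integral_dominated_convergence[where w = "\<lambda>x. indicator (cball 0 (1 + norm v)) x *\<^sub>R B"])
    show "(\<lambda>x. F' x v) \<in> borel_measurable lborel"
      using borel_measurable_continuous_onI[OF cont] by simp
    show "q n \<in> borel_measurable lborel" for n
      unfolding q_def using borel_measurable_continuous_onI[OF contF, measurable] by measurable
    show "integrable lborel (\<lambda>x. indicator (cball (0::'a) (1 + norm v)) x *\<^sub>R B)"
      by (intro borel_integrable_compact) auto
    show "AE x in lborel. (\<lambda>n. q n x) \<longlonglongrightarrow> F' x v"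
    proof (rule AE_I2)
      fix x
      have "((\<lambda>h. (F (x + h *\<^sub>R v) - F x) / h) \<longlongrightarrow> F' x v) (at 0)"
        using line[of x 0] by (simp add: has_field_derivative_iff)
      moreover have "filterlim (\<lambda>n. 1 / real (Suc n)) (at 0) sequentially"
        unfolding filterlim_at using LIMSEQ_Suc[OF lim_1_over_n] by auto
      ultimately have "(\<lambda>n. (F (x + (1 / real (Suc n)) *\<^sub>R v) - F x) / (1 / real (Suc n))) \<longlonglongrightarrow> F' x v"
        by (rule filterlim_compose)
      then show "(\<lambda>n. q n x) \<longlonglongrightarrow> F' x v" by (simp add: q_def mult.commute)
    qed
    show "AE x in lborel. norm (q n x) \<le> indicator (cball 0 (1 + norm v)) x *\<^sub>R B" for n
    proof (rule AE_I2)
      fix x :: 'a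
      let ?s = "1 / real (Suc n)"
      show "norm (q n x) \<le> indicator (cball 0 (1 + norm v)) x *\<^sub>R B"
      proof (cases "norm x \<le> 1 + norm v")
        case True
        obtain z where "0 < z" "z < ?s" "F (x + ?s *\<^sub>R v) - F (x + 0 *\<^sub>R v) = (?s - 0) * F' (x + z *\<^sub>R v) v"
          using MVT2[of 0 ?s "\<lambda>s. F (x + s *\<^sub>R v)" "\<lambda>s. F' (x + s *\<^sub>R v) v"] line by auto
        then have "q n x = F' (x + z *\<^sub>R v) v" by (simp add: q_def)
        then show ?thesis using True B by simp
      next
        case False
        have "norm (?s *\<^sub>R v) \<le> norm v"
          by (simp add: divide_le_eq mult_le_cancel_left1 mult_left_le)
        then have "1 \<le> norm (x + ?s *\<^sub>R v)"
          using False norm_diff_ineq[of x "?s *\<^sub>R v"] by linarith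
        moreover have "1 \<le> norm x" using False norm_ge_zero[of v] by linarith
        ultimately show ?thesis by (simp add: q_def supp False)
      qed
    qed
  qed
  then have "(\<lambda>n. 0) \<longlonglongrightarrow> (\<integral>x. F' x v \<partial>lborel)" unfolding q0 .
  then show ?thesis by (simp add: tendsto_const_iff)
qed

text \<open>The weights for all integrations by parts: radial, compactly supported, and such that the gradient
  of \<open>bump (m + 1)\<close> is \<open>- 2 (m + 1) bump m y\<close>, with a continuous right side for \<open>m \<ge> 1\<close>.\<close>

definition bump :: "nat \<Rightarrow> 'a::euclidean_space \<Rightarrow> real" where
  "bump m x = max 0 (1 - (norm x)\<^sup>2) ^ m"

lemma bump_nonneg: "0 \<le> bump m x"
  by (simp add: bump_def)

lemma bump_le_1: "bump m x \<le> 1"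
  unfolding bump_def by (intro power_le_one) auto

lemma bump_eq_0:
  assumes "0 < m" "1 \<le> norm x" shows "bump m x = 0"
proof -
  have "1 - (norm x)\<^sup>2 \<le> 0" using assms(2) by (simp add: one_le_power)
  then have "max 0 (1 - (norm x)\<^sup>2) = 0" by (rule max_absorb1)
  then show ?thesis using assms(1) by (simp only: bump_def zero_power)
qed

lemma bump_inside: "norm x < 1 \<Longrightarrow> bump m x = (1 - (norm x)\<^sup>2) ^ m"
  by (simp add: bump_def max_def abs_square_le_1)

lemma continuous_on_bump [continuous_intros]:
  "continuous_on S f \<Longrightarrow> continuous_on S (\<lambda>x. bump m (f x :: 'a::euclidean_space))"
  unfolding bump_def by (intro continuous_intros)

lemma pos_part_power_derivative:
  fixes t :: real
  shows "((\<lambda>t. max 0 t ^ Suc (Suc n)) has_real_derivative real (Suc (Suc n)) * max 0 t ^ Suc n) (at t)"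
proof (cases t "0 :: real" rule: linorder_cases)
  case less
  have "((\<lambda>t. 0) has_real_derivative 0) (at t)" by simp
  then have "((\<lambda>t. max 0 t ^ Suc (Suc n)) has_real_derivative 0) (at t)"
    by (rule has_field_derivative_transform_within_open[where S = "{..<0}"]) (use less in auto)
  then show ?thesis using less by simp
next
  case equal
  have "((\<lambda>h::real. max 0 h ^ Suc (Suc n) / h) \<longlongrightarrow> 0) (at 0)"
  proof (rule tendsto_rabs_zero_cancel, rule tendsto_sandwich[OF _ _ tendsto_const])
    have "\<bar>max 0 h ^ Suc (Suc n) / h\<bar> \<le> \<bar>h\<bar> ^ Suc n" for h :: real
    proof (cases "0 < h")
      case False
      then have "max 0 h = 0" by simp
      then have "max 0 h ^ Suc (Suc n) / h = 0" by simp
      then show ?thesis by (simp only: abs_zero zero_le_power abs_ge_zero)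
    qed (simp add: abs_mult)
    then show "\<forall>\<^sub>F h::real in at 0. \<bar>max 0 h ^ Suc (Suc n) / h\<bar> \<le> \<bar>h\<bar> ^ Suc n"
      by (rule always_eventually[OF allI])
    show "((\<lambda>h::real. \<bar>h\<bar> ^ Suc n) \<longlongrightarrow> 0) (at 0)"
      by (rule tendsto_eq_intros | simp)+
  qed auto
  then show ?thesis using equal by (simp add: has_field_derivative_iff)
next
  case greater
  have "((\<lambda>t. t ^ Suc (Suc n)) has_real_derivative real (Suc (Suc n)) * t ^ Suc n) (at t)"
    using DERIV_pow[of "Suc (Suc n)" t] by simp
  then have "((\<lambda>t. max 0 t ^ Suc (Suc n)) has_real_derivative real (Suc (Suc n)) * t ^ Suc n) (at t)"
    by (rule has_field_derivative_transform_within_open[where S = "{0<..}"]) (use greater in auto)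
  then show ?thesis using greater by simp
qed

lemma bump_derivative:
  "((\<lambda>x. bump (Suc (Suc m)) x) has_derivative (\<lambda>v. - 2 * real (Suc (Suc m)) * bump (Suc m) x * (x \<bullet> v))) (at x)"
proof -
  have "((\<lambda>x. 1 - (norm x)\<^sup>2) has_derivative (\<lambda>v. - 2 * (x \<bullet> v))) (at x)"
    unfolding power2_norm_eq_inner
    by (auto intro!: derivative_eq_intros simp: inner_commute)
  then have "((\<lambda>x. max 0 (1 - (norm x)\<^sup>2) ^ Suc (Suc m)) has_derivative
      (\<lambda>v. (- 2 * (x \<bullet> v)) * (real (Suc (Suc m)) * max 0 (1 - (norm x)\<^sup>2) ^ Suc m))) (at x)"
    by (rule DERIV_compose_FDERIV[OF pos_part_power_derivative])
  then have "((\<lambda>x. max 0 (1 - (norm x)\<^sup>2) ^ Suc (Suc m)) has_derivative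
      (\<lambda>v. - 2 * real (Suc (Suc m)) * max 0 (1 - (norm x)\<^sup>2) ^ Suc m * (x \<bullet> v))) (at x)"
    by (rule has_derivative_eq_rhs) (simp add: fun_eq_iff algebra_simps)
  then show ?thesis
    unfolding bump_def .
qed

lemma integrable_bump_poly:
  assumes "0 < m" "continuous_on UNIV q"
  shows "integrable lborel (\<lambda>y. bump m y * q y)"
  using assms
  by (intro integrable_compact_support[where R = 1] continuous_intros) (auto simp: bump_eq_0)

lemma bump_integration_by_parts:
  fixes q :: "'a::euclidean_space \<Rightarrow> real"
  assumes q: "real_polynomial_function q"
  shows "(\<integral>y. bump (Suc (Suc m)) y * dir_deriv v q y \<partial>lborel) =
    2 * real (Suc (Suc m)) * (\<integral>y. bump (Suc m) y * ((y \<bullet> v) * q y) \<partial>lborel)"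
proof -
  note cont = poly_continuous[OF q] poly_continuous[OF poly_dir_deriv[OF q]]
  have i1: "integrable lborel (\<lambda>y. bump (Suc (Suc m)) y * dir_deriv v q y)"
    by (intro integrable_bump_poly cont) auto
  have i2: "integrable lborel (\<lambda>y. bump (Suc m) y * ((y \<bullet> v) * q y))"
    by (intro integrable_bump_poly continuous_intros cont) auto
  have "(\<integral>y. bump (Suc (Suc m)) y * dir_deriv v q y -
      2 * real (Suc (Suc m)) * bump (Suc m) y * (y \<bullet> v) * q y \<partial>lborel) = 0"
  proof (rule integral_derivative_eq_0[where v = v and F = "\<lambda>y. bump (Suc (Suc m)) y * q y" and
        F' = "\<lambda>y v. bump (Suc (Suc m)) y * dir_deriv v q y -
          2 * real (Suc (Suc m)) * bump (Suc m) y * (y \<bullet> v) * q y"])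
    show "((\<lambda>y. bump (Suc (Suc m)) y * q y) has_derivative (\<lambda>v. bump (Suc (Suc m)) y * dir_deriv v q y -
          2 * real (Suc (Suc m)) * bump (Suc m) y * (y \<bullet> v) * q y)) (at y)" for y
      by (rule has_derivative_eq_rhs[OF has_derivative_mult[OF bump_derivative poly_has_derivative[OF q]]])
         (auto simp: fun_eq_iff algebra_simps)
  qed (auto intro!: continuous_intros cont simp: bump_eq_0)
  also have "(\<integral>y. bump (Suc (Suc m)) y * dir_deriv v q y -
      2 * real (Suc (Suc m)) * bump (Suc m) y * (y \<bullet> v) * q y \<partial>lborel) =
      (\<integral>y. bump (Suc (Suc m)) y * dir_deriv v q y \<partial>lborel) -
      (\<integral>y. 2 * real (Suc (Suc m)) * (bump (Suc m) y * ((y \<bullet> v) * q y)) \<partial>lborel)"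
    using Bochner_Integration.integral_diff[OF i1 integrable_mult_right[OF i2, of "2 * real (Suc (Suc m))"]]
    by (simp only: mult.assoc)
  finally show ?thesis by (simp only: Bochner_Integration.integral_mult_right_zero right_minus_eq)
qed

section \<open>Surface measure\<close>

lemma space_surface_measure [simp]: "space surface_measure = sphere 0 1"
  by (simp add: surface_measure_def space_scale_measure space_restrict_space)

lemma sets_surface_measure [simp, measurable_cong]:
  "sets (surface_measure :: 'a::euclidean_space measure) = sets (restrict_space borel (sphere 0 1))"
  by (simp add: surface_measure_def)

lemma scale_measure_eq_density:
  "0 \<le> c \<Longrightarrow> scale_measure (ennreal c) M = density M (\<lambda>_. ennreal c)"
  by (rule measure_eqI) (auto simp: emeasure_density nn_integral_cmult_indicator)

lemma surface_measure_eq: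
  "(surface_measure :: 'a::euclidean_space measure) = density
     (distr (restrict_space lborel (ball 0 1 - {0})) (restrict_space borel (sphere 0 1)) sgn)
     (\<lambda>_. ennreal (real DIM('a)))"
  unfolding surface_measure_def
  by (subst scale_measure_eq_density[symmetric]) (auto simp: ennreal_of_nat_eq_real_of_nat)

lemma integral_surface_measure:
  fixes F :: "'a::euclidean_space \<Rightarrow> real"
  assumes F: "F \<in> borel_measurable borel"
  shows "(\<integral>x. F x \<partial>surface_measure) =
    real DIM('a) * (\<integral>x. indicator (ball 0 1 - {0}) x * F (sgn x) \<partial>lborel)"
proof -
  have F' [measurable]: "F \<in> borel_measurable (restrict_space borel (sphere 0 1))"
    using F by (rule measurable_restrict_space1)
  show ?thesis unfolding surface_measure_eq
    by (subst integral_density, simp_all, subst integral_distr[OF sgn_measurable_sphere],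
        simp_all add: integral_restrict_space)
qed

lemma finite_measure_surface: "finite_measure (surface_measure :: 'a::euclidean_space measure)"
proof
  have *: "sphere 0 1 \<in> sets (restrict_space borel (sphere (0::'a) 1))"
    by (subst sets_restrict_space_iff) auto
  have e1: "emeasure (surface_measure :: 'a measure) (space surface_measure) =
      of_nat DIM('a) * emeasure (restrict_space lborel (ball 0 1 - {0 :: 'a})) (sgn -` sphere 0 1 \<inter> (ball 0 1 - {0}))"
    unfolding surface_measure_def
    by (simp add: space_scale_measure emeasure_distr[OF sgn_measurable_sphere *] space_restrict_space)
  have "emeasure (restrict_space lborel (ball 0 1 - {0 :: 'a})) (sgn -` sphere 0 1 \<inter> (ball 0 1 - {0})) \<le>
      emeasure (restrict_space lborel (ball 0 1 - {0 :: 'a})) (ball 0 1 - {0})"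
    by (intro emeasure_mono) (auto simp: sets_restrict_space_iff)
  also have "emeasure (restrict_space lborel (ball 0 1 - {0 :: 'a})) (ball 0 1 - {0}) \<le> emeasure lborel (ball (0::'a) 1)"
    by (subst emeasure_restrict_space) (auto intro: emeasure_mono)
  also have "\<dots> < \<infinity>"
    using emeasure_bounded_finite[of "ball (0::'a) 1"] by simp
  finally show "emeasure (surface_measure :: 'a measure) (space surface_measure) \<noteq> \<infinity>"
    unfolding e1 by (auto simp: ennreal_mult_eq_top_iff ennreal_of_nat_eq_real_of_nat)
qed

interpretation surface: finite_measure "surface_measure :: 'a::euclidean_space measure"
  by (rule finite_measure_surface)

lemma surface_measurable:
  fixes F :: "'a::euclidean_space \<Rightarrow> 'b::topological_space"
  assumes "continuous_on (sphere 0 1) F"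
  shows "F \<in> borel_measurable surface_measure"
  using borel_measurable_continuous_on_restrict[OF assms]
  by (subst measurable_cong_sets[OF sets_surface_measure refl])

lemma surface_integrable:
  fixes F :: "'a::euclidean_space \<Rightarrow> 'b::{banach, second_countable_topology}"
  assumes "continuous_on (sphere 0 1) F"
  shows "integrable surface_measure F"
proof -
  have "bounded (F ` sphere 0 1)"
    by (intro compact_imp_bounded compact_continuous_image assms) auto
  then obtain B where "\<And>x. x \<in> sphere 0 1 \<Longrightarrow> norm (F x) \<le> B" unfolding bounded_iff by blast
  then show ?thesis
    by (intro surface.integrable_const_bound[where B = B] surface_measurable assms) auto
qed

lemma surface_measure_pos: "0 < measure (surface_measure :: 'a::euclidean_space measure) (sphere 0 1)"
proof -
  have m: "measure (surface_measure :: 'a measure) (sphere 0 1) = (\<integral>x. 1 \<partial>(surface_measure :: 'a measure))"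
    by simp
  also have "\<dots> = real DIM('a) * (\<integral>x. indicator (ball 0 1 - {0::'a}) x * 1 \<partial>lborel)"
    by (subst integral_surface_measure) auto
  also have "\<dots> = real DIM('a) * measure lborel (ball (0::'a) 1 - {0})"
    by simp
  also have "measure lborel (ball (0::'a) 1 - {0}) = measure lborel (ball (0::'a) 1)"
    using emeasure_bounded_finite[of "ball (0::'a) 1"]
    by (subst measure_Diff) auto
  finally show ?thesis
    using content_ball_pos[of 1 "0::'a"] by (simp add: measure_completion)
qed

text \<open>Integration in polar coordinates for a power of the radius times a function of the direction:
  write \<open>1 - \<bar>x\<bar>\<^sup>b\<close> as an integral over the radii between \<open>\<bar>x\<bar>\<close> and \<open>1\<close> and exchange the order of
  integration.\<close>

lemma polar_power:
  fixes \<Phi> :: "'a::euclidean_space \<Rightarrow> real"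
  assumes [measurable]: "\<Phi> \<in> borel_measurable borel" and bnd: "\<And>x. \<bar>\<Phi> x\<bar> \<le> C"
  shows "(real DIM('a) + real b) * (\<integral>x. indicator (ball 0 1) x * (norm x ^ b * \<Phi> (sgn x)) \<partial>lborel) =
    real DIM('a) * (\<integral>x. indicator (ball 0 1) x * \<Phi> (sgn x) \<partial>lborel)"
proof (cases b)
  case 0
  then show ?thesis by simp
next
  case (Suc n)
  define J where "J = (\<integral>x. indicator (ball 0 1) (x::'a) * \<Phi> (sgn x) \<partial>lborel)"
  define f where "f x t = (indicator {norm x..1} t * (real b * t ^ n)) * (indicator (ball 0 1) x * \<Phi> (sgn x))"
    for x :: 'a and t :: real
  have C: "0 \<le> C" using bnd[of 0] by linarith
  have [measurable]: "ball (0::'a) 1 \<in> sets borel" by auto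
  have f_eq: "f x t = (if norm x \<le> t \<and> t \<le> 1 then real b * t ^ n else 0) *
      (indicator (ball 0 1) x * \<Phi> (sgn x))" for x t
    by (auto simp: f_def indicator_def)
  have [measurable]: "(\<lambda>(x, t). f x t) \<in> borel_measurable (lborel \<Otimes>\<^sub>M lborel)"
    unfolding f_eq by measurable
  have emb: "emeasure lborel (ball (0::'a) 1) < \<infinity>"
    using emeasure_bounded_finite[of "ball (0::'a) 1"] by simp
  have bound: "\<bar>f x t\<bar> \<le> real b * C" if "0 \<le> t" "t \<le> 1" for x t
  proof -
    have "\<bar>real b * t ^ n\<bar> \<le> real b" using that by (auto simp: mult_left_le power_le_one)
    moreover have "\<bar>indicator (ball 0 1) x * \<Phi> (sgn x)\<bar> \<le> C"
      using bnd[of "sgn x"] C by (auto simp: indicator_def)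
    ultimately have "\<bar>real b * t ^ n\<bar> * \<bar>indicator (ball 0 1) x * \<Phi> (sgn x)\<bar> \<le> real b * C"
      by (intro mult_mono) auto
    then show ?thesis using C by (auto simp: f_eq abs_mult)
  qed
  have int: "integrable (lborel \<Otimes>\<^sub>M lborel) (\<lambda>(x, t). f x t)"
  proof (rule integrableI_bounded_set[where A = "ball 0 1 \<times> {0..1}" and B = "real b * C"])
    show "emeasure (lborel \<Otimes>\<^sub>M lborel) (ball (0::'a) 1 \<times> {0..1::real}) < \<infinity>"
      using emb by (subst lborel.emeasure_pair_measure_Times) auto
    show "AE z in lborel \<Otimes>\<^sub>M lborel. z \<in> ball (0::'a) 1 \<times> {0..1} \<longrightarrow> norm (case z of (x, t) \<Rightarrow> f x t) \<le> real b * C"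
      using bound by (intro AE_I2) (auto split: prod.splits)
    show "AE z in lborel \<Otimes>\<^sub>M lborel. z \<notin> ball (0::'a) 1 \<times> {0..1} \<longrightarrow> (case z of (x, t) \<Rightarrow> f x t) = 0"
      by (intro AE_I2) (auto simp: f_eq indicator_def split: prod.splits intro: order_trans[OF norm_ge_zero])
  qed auto
  have intPhi: "integrable lborel (\<lambda>x::'a. indicator (ball 0 1) x *\<^sub>R (\<Phi> (sgn x)))"
    using emb bnd by (intro integrableI_bounded_set_indicator[where B = C]) auto
  have intPhi2: "integrable lborel (\<lambda>x::'a. indicator (ball 0 1) x *\<^sub>R (norm x ^ b * \<Phi> (sgn x)))"
  proof (intro integrableI_bounded_set_indicator[where B = C] emb AE_I2 impI)
    fix x :: 'a assume "x \<in> ball 0 1"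
    then have "norm x ^ b \<le> 1" by (auto simp: power_le_one)
    then have "norm x ^ b * \<bar>\<Phi> (sgn x)\<bar> \<le> 1 * C" using bnd C by (intro mult_mono) auto
    then show "norm (norm x ^ b * \<Phi> (sgn x)) \<le> C" by (simp add: abs_mult)
  qed auto
  have inner_t: "(\<integral>t. f x t \<partial>lborel) = indicator (ball 0 1) x * \<Phi> (sgn x) - indicator (ball 0 1) x * (norm x ^ b * \<Phi> (sgn x))" for x
  proof (cases "norm x < 1")
    case True
    have "(\<integral>t. f x t \<partial>lborel) = (\<integral>t. real b * (t ^ n * indicator {norm x..1} t) * (indicator (ball 0 1) x * \<Phi> (sgn x)) \<partial>lborel)"
      by (simp add: f_def mult_ac)
    also have "\<dots> = real b * ((1 - norm x ^ Suc n) / real (Suc n)) * (indicator (ball 0 1) x * \<Phi> (sgn x))"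
      using integral_power[of "norm x" 1 n] True by simp
    also have "real b * ((1 - norm x ^ Suc n) / real (Suc n)) = 1 - norm x ^ b"
      using Suc by simp
    finally show ?thesis by (simp add: algebra_simps)
  qed (auto simp: f_def)
  have inner_x: "(\<integral>x. f x t \<partial>lborel) = real b * J * (t ^ (n + DIM('a)) * indicator {0..1} t)" if t: "t \<noteq> 0" for t
  proof (cases "0 < t \<and> t \<le> 1")
    case True
    define h where "h x = (if norm x \<le> t then indicator (ball 0 1) x * \<Phi> (sgn x) else 0)" for x :: 'a
    have [measurable]: "h \<in> borel_measurable borel" unfolding h_def by measurable
    have "(\<integral>x. f x t \<partial>lborel) = real b * t ^ n * (\<integral>x. h x \<partial>lborel)"
      unfolding Bochner_Integration.integral_mult_right_zero[symmetric]
      using True by (intro Bochner_Integration.integral_cong) (auto simp: f_eq h_def)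
    also have "(\<integral>x. h x \<partial>lborel) = t ^ DIM('a) * (\<integral>x. h (0 + t *\<^sub>R x) \<partial>lborel)"
      using True by (intro lborel_integral_affine) auto
    also have "(\<integral>x. h (0 + t *\<^sub>R x) \<partial>lborel) = J" unfolding J_def
    proof (rule integral_cong_AE)
      have "AE x in lborel. x \<notin> sphere (0::'a) 1"
        using negligible_sphere[of "0::'a" 1]
        by (intro AE_not_in) (simp add: negligible_iff_null_sets null_sets_completion_iff)
      then show "AE x in lborel. h (0 + t *\<^sub>R x) = indicator (ball 0 1) x * \<Phi> (sgn x)"
      proof eventually_elim
        case (elim x)
        have "norm (t *\<^sub>R x) \<le> t \<longleftrightarrow> norm x \<le> 1" using True by (simp add: mult_le_cancel_left2)
        moreover have "norm (t *\<^sub>R x) < 1" if "norm x < 1"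
          using True that mult_left_le_one_le[of "norm x" t] by simp
        moreover have "sgn (t *\<^sub>R x) = sgn x" using True by (simp add: sgn_scaleR)
        ultimately show ?case using elim by (auto simp: h_def indicator_def)
      qed
    qed auto
    finally show ?thesis using True by (simp add: power_add)
  next
    case False
    then have "f x t = 0" for x using t norm_ge_zero[of x] by (auto simp: f_eq simp del: norm_ge_zero)
    then show ?thesis using False t by auto
  qed
  have "(\<integral>x. (\<integral>t. f x t \<partial>lborel) \<partial>lborel) = (\<integral>t. (\<integral>x. f x t \<partial>lborel) \<partial>lborel)"
    using lborel_pair.Fubini_integral[of f] int by simp
  also have "(\<integral>t. (\<integral>x. f x t \<partial>lborel) \<partial>lborel) = (\<integral>t. real b * J * (t ^ (n + DIM('a)) * indicator {0..1} t) \<partial>lborel)"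
  proof (rule integral_cong_AE)
    show "AE t in lborel. (\<integral>x. f x t \<partial>lborel) = real b * J * (t ^ (n + DIM('a)) * indicator {0..1} t)"
      using AE_lborel_singleton[of "0::real"] by eventually_elim (rule inner_x)
    have "(\<lambda>(t, x). f x t) \<in> borel_measurable (lborel \<Otimes>\<^sub>M lborel)" unfolding f_eq by measurable
    then show "(\<lambda>t. \<integral>x. f x t \<partial>lborel) \<in> borel_measurable lborel"
      by (rule lborel.borel_measurable_lebesgue_integral)
  qed measurable
  also have "\<dots> = real b * J * (1 / (real n + 1 + real DIM('a)))"
    using integral_power[of 0 1 "n + DIM('a)"] by (simp add: add_ac)
  also have "(\<integral>x. (\<integral>t. f x t \<partial>lborel) \<partial>lborel) = J - (\<integral>x. indicator (ball 0 1) x * (norm x ^ b * \<Phi> (sgn x)) \<partial>lborel)"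
    unfolding inner_t J_def using intPhi intPhi2 by (simp add: Bochner_Integration.integral_diff)
  finally have "J - (\<integral>x. indicator (ball 0 1) x * (norm x ^ b * \<Phi> (sgn x)) \<partial>lborel) =
      real b * J * (1 / (real b + real DIM('a)))"
    using Suc by (simp add: add_ac)
  moreover have "real b + real DIM('a) > 0" using Suc by simp
  ultimately show ?thesis unfolding J_def[symmetric] by (simp add: field_simps)
qed

section \<open>Orthogonality of solid harmonics of different degrees\<close>

lemma sgn_scale_self: "x = norm x *\<^sub>R sgn x"
  by (cases "x = 0") (simp_all add: sgn_div_norm)

lemma solid_harmonic_polar: "solid_harmonic k p \<Longrightarrow> p x = norm x ^ k * p (sgn x)"
  using solid_harmonicD(2)[of k p "norm x" "sgn x"] unfolding sgn_scale_self[symmetric] .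

lemma solid_harmonic_borel: "solid_harmonic k p \<Longrightarrow> p \<in> borel_measurable borel"
  using poly_continuous solid_harmonicD(1) borel_measurable_continuous_onI by blast

lemma solid_harmonic_sphere_continuous: "solid_harmonic k p \<Longrightarrow> continuous_on S p"
  using poly_continuous solid_harmonicD(1) by blast

text \<open>Integrate the divergence of \<open>bump 2 \<cdot> q \<cdot> \<nabla>p\<close>: the derivative of the weight contributes a multiple of
  \<open>y \<bullet> \<nabla>p\<close>, which is \<open>k p\<close> by Euler's identity. The right side is symmetric in \<open>p\<close> and \<open>q\<close>.\<close>

lemma orthogonal_bump:
  fixes p q :: "'a::euclidean_space \<Rightarrow> real"
  assumes p: "solid_harmonic k p" and q: "solid_harmonic l q"
  shows "4 * k * (\<integral>y. bump 1 y * (p y * q y) \<partial>lborel) =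
    (\<integral>y. bump 2 y * (\<Sum>i\<in>Basis. dir_deriv i p y * dir_deriv i q y) \<partial>lborel)"
proof -
  note pp = solid_harmonicD(1)[OF p] and qp = solid_harmonicD(1)[OF q]
  have cp: "continuous_on UNIV p" "continuous_on UNIV q"
    by (intro poly_continuous pp qp)+
  have cd: "continuous_on UNIV (dir_deriv i p)" "continuous_on UNIV (dir_deriv i q)"
      "continuous_on UNIV (dir_deriv i (dir_deriv i p))" for i
    by (intro poly_continuous poly_dir_deriv pp qp)+
  have *: "(\<integral>y. bump 2 y * (dir_deriv i p y * dir_deriv i q y + dir_deriv i (dir_deriv i p) y * q y) \<partial>lborel) =
      4 * (\<integral>y. bump 1 y * ((y \<bullet> i) * (dir_deriv i p y * q y)) \<partial>lborel)" for i :: 'a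
    using bump_integration_by_parts[of "\<lambda>y. dir_deriv i p y * q y" 0 i] pp qp
    by (simp add: dir_deriv_mult poly_dir_deriv real_polynomial_function.intros numeral_2_eq_2)
  have lap: "(\<Sum>i\<in>Basis. dir_deriv i (dir_deriv i p) y * q y) = 0" for y
    using solid_harmonicD(3)[OF p, of y] by (simp add: laplacian_def flip: sum_distrib_right)
  have "(\<integral>y. bump 2 y * (\<Sum>i\<in>Basis. dir_deriv i p y * dir_deriv i q y) \<partial>lborel) =
      (\<integral>y. (\<Sum>i\<in>Basis. bump 2 y * (dir_deriv i p y * dir_deriv i q y + dir_deriv i (dir_deriv i p) y * q y)) \<partial>lborel)"
    by (simp add: sum.distrib lap flip: sum_distrib_left)
  also have "\<dots> = (\<Sum>i\<in>Basis. \<integral>y. bump 2 y * (dir_deriv i p y * dir_deriv i q y + dir_deriv i (dir_deriv i p) y * q y) \<partial>lborel)"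
    by (intro Bochner_Integration.integral_sum integrable_bump_poly continuous_intros cp cd) auto
  also have "\<dots> = 4 * (\<Sum>i\<in>Basis. \<integral>y. bump 1 y * ((y \<bullet> i) * (dir_deriv i p y * q y)) \<partial>lborel)"
    unfolding * by (simp add: sum_distrib_left)
  also have "(\<Sum>i\<in>Basis. \<integral>y. bump 1 y * ((y \<bullet> i) * (dir_deriv i p y * q y)) \<partial>lborel) =
      (\<integral>y. (\<Sum>i\<in>Basis. bump 1 y * ((y \<bullet> i) * (dir_deriv i p y * q y))) \<partial>lborel)"
    by (intro Bochner_Integration.integral_sum[symmetric] integrable_bump_poly continuous_intros cp cd) auto
  also have "\<dots> = (\<integral>y. k * (bump 1 y * (p y * q y)) \<partial>lborel)"
  proof (intro Bochner_Integration.integral_cong refl)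
    fix y :: 'a
    have "(\<Sum>i\<in>Basis. bump 1 y * ((y \<bullet> i) * (dir_deriv i p y * q y))) =
        bump 1 y * ((\<Sum>i\<in>Basis. (y \<bullet> i) * dir_deriv i p y) * q y)"
      by (simp add: sum_distrib_left sum_distrib_right mult.assoc)
    then show "(\<Sum>i\<in>Basis. bump 1 y * ((y \<bullet> i) * (dir_deriv i p y * q y))) = k * (bump 1 y * (p y * q y))"
      by (simp add: dir_deriv_expand[OF pp] euler_identity[OF p])
  qed
  finally show ?thesis by simp
qed

text \<open>Exchanging the roles of \<open>p\<close> and \<open>q\<close> shows that \<open>k\<close> and \<open>l\<close> multiply the same weighted integral to the
  same result, so that this integral is \<open>0\<close>. In polar coordinates it is a nonzero multiple of the
  integral over the sphere, because \<open>p q\<close> is homogeneous.\<close>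

lemma solid_harmonic_orthogonal:
  fixes p q :: "'a::euclidean_space \<Rightarrow> real"
  assumes p: "solid_harmonic k p" and q: "solid_harmonic l q" and kl: "k \<noteq> l"
  shows "(\<integral>x. p x * q x \<partial>surface_measure) = 0"
proof -
  define \<Phi> where "\<Phi> x = p (sgn x) * q (sgn x)" for x
  note [measurable] = solid_harmonic_borel[OF p] solid_harmonic_borel[OF q]
  define J where "J b = (\<integral>x. indicator (ball 0 1) x * (norm x ^ b * \<Phi> (sgn x)) \<partial>lborel)" for b :: nat
  \<comment> \<open>\<open>\<Phi>\<close> is \<open>p q\<close> made homogeneous of degree \<open>0\<close>, and \<open>J 0\<close> is essentially its integral over the sphere.\<close>
  have "4 * real k * (\<integral>y. bump 1 y * (p y * q y) \<partial>lborel) = 4 * real l * (\<integral>y. bump 1 y * (q y * p y) \<partial>lborel)"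
    unfolding orthogonal_bump[OF p q] orthogonal_bump[OF q p] by (simp add: mult.commute)
  then have z: "(\<integral>y. bump 1 y * (p y * q y) \<partial>lborel) = 0"
    using kl by (simp add: mult.commute)
  have "bounded ((\<lambda>x. p x * q x) ` cball 0 1)"
    by (intro compact_imp_bounded compact_continuous_image continuous_intros
        solid_harmonic_sphere_continuous[OF p] solid_harmonic_sphere_continuous[OF q]) auto
  then obtain C where C: "\<And>x. x \<in> cball 0 1 \<Longrightarrow> \<bar>p x * q x\<bar> \<le> C" unfolding bounded_iff real_norm_def by blast
  have bnd: "\<bar>\<Phi> x\<bar> \<le> C" for x
    using C[of "sgn x"] by (auto simp: \<Phi>_def norm_sgn)
  have [measurable]: "\<Phi> \<in> borel_measurable borel" unfolding \<Phi>_def by measurable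
  have [measurable]: "ball (0::'a) 1 \<in> sets borel" by auto
  have polar: "(real DIM('a) + real b) * J b = real DIM('a) * J 0" for b
    using polar_power[of \<Phi> C b] bnd by (simp add: J_def)
  have int: "integrable lborel (\<lambda>x::'a. indicator (ball 0 1) x * (norm x ^ b * \<Phi> (sgn x)))" for b
  proof -
    have "integrable lborel (\<lambda>x::'a. indicator (ball 0 1) x *\<^sub>R (norm x ^ b * \<Phi> (sgn x)))"
    proof (intro integrableI_bounded_set_indicator[where B = C] AE_I2 impI)
      fix x :: 'a assume "x \<in> ball 0 1"
      then have "norm x ^ b * \<bar>\<Phi> (sgn x)\<bar> \<le> 1 * C" using bnd C[of 0] by (intro mult_mono power_le_one) auto
      then show "norm (norm x ^ b * \<Phi> (sgn x)) \<le> C" by (simp add: abs_mult)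
    qed (use emeasure_bounded_finite[of "ball (0::'a) 1"] in auto)
    then show ?thesis by simp
  qed
  have ss: "sgn (sgn x) = sgn x" for x :: 'a by (cases "x = 0") (simp_all add: sgn_div_norm)
  have "bump 1 x * (p x * q x) = indicator (ball 0 1) x * (norm x ^ (k + l) * \<Phi> (sgn x)) -
      indicator (ball 0 1) x * (norm x ^ (k + l + 2) * \<Phi> (sgn x))" for x
  proof (cases "norm x < 1")
    case True
    have "p x * q x = norm x ^ (k + l) * \<Phi> (sgn x)"
      using solid_harmonic_polar[OF p, of x] solid_harmonic_polar[OF q, of x]
      by (simp add: \<Phi>_def ss power_add)
    then show ?thesis using True by (simp add: bump_inside power_add power2_eq_square algebra_simps)
  next
    case False
    then show ?thesis by (simp add: bump_eq_0)
  qed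
  then have "(\<integral>y. bump 1 y * (p y * q y) \<partial>lborel) = J (k + l) - J (k + l + 2)"
    unfolding J_def using Bochner_Integration.integral_diff[OF int[of "k + l"] int[of "k + l + 2"]] by simp
  then have JJ: "J (k + l + 2) = J (k + l)" using z by simp
  from polar[of "k + l + 2"] polar[of "k + l"] have "J (k + l) = 0"
    unfolding JJ by (simp add: algebra_simps)
  with polar[of "k + l"] have J0: "J 0 = 0" by simp
  have "(\<integral>x. p x * q x \<partial>surface_measure) =
      real DIM('a) * (\<integral>x. indicator (ball 0 1 - {0}) x * (p (sgn x) * q (sgn x)) \<partial>lborel)"
    by (subst integral_surface_measure) auto
  also have "(\<integral>x. indicator (ball 0 1 - {0}) x * (p (sgn x) * q (sgn x)) \<partial>lborel) = J 0"
    unfolding J_def using AE_lborel_singleton[of "0::'a"]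
    by (intro integral_cong_AE) (auto simp: \<Phi>_def ss indicator_def elim!: eventually_mono)
  finally show ?thesis using J0 by simp
qed

section \<open>Estimates for solid harmonics\<close>

lemma poly_affine:
  fixes p :: "'a::euclidean_space \<Rightarrow> real"
  assumes p: "real_polynomial_function p"
  shows "real_polynomial_function (\<lambda>y. p (x + t *\<^sub>R y))"
    and "dir_deriv v (\<lambda>y. p (x + t *\<^sub>R y)) = (\<lambda>y. t * dir_deriv v p (x + t *\<^sub>R y))"
proof -
  have "polynomial_function (\<lambda>y. x + t *\<^sub>R y)"
    by (intro polynomial_function_add polynomial_function_const polynomial_function_cmul polynomial_function_id)
  from real_polynomial_function_compose[OF this p]
  show "real_polynomial_function (\<lambda>y. p (x + t *\<^sub>R y))" by (simp add: o_def)
  show "dir_deriv v (\<lambda>y. p (x + t *\<^sub>R y)) = (\<lambda>y. t * dir_deriv v p (x + t *\<^sub>R y))"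
  proof
    fix y
    have "((\<lambda>y. p (x + t *\<^sub>R y)) has_derivative (\<lambda>v. dir_deriv (t *\<^sub>R v) p (x + t *\<^sub>R y))) (at y)"
      by (rule has_derivative_compose[where g = p and f = "\<lambda>y. x + t *\<^sub>R y" and x = y and s = UNIV, simplified])
         (auto intro!: derivative_eq_intros poly_has_derivative p)
    from dir_deriv_eqI[OF this, of v]
    show "dir_deriv v (\<lambda>y. p (x + t *\<^sub>R y)) y = t * dir_deriv v p (x + t *\<^sub>R y)"
      by (simp add: linear_scale[OF dir_deriv_linear[OF p]])
  qed
qed

text \<open>The mean value property for the weight \<open>(1 - \<bar>y\<bar>\<^sup>2)\<^sup>2\<close>: the derivative in \<open>t\<close> of the weighted
  mean over the ball of radius \<open>t\<close> is, after an integration by parts, an integral of the Laplacian.\<close>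

lemma mean_value_dir_deriv:
  fixes p :: "'a::euclidean_space \<Rightarrow> real"
  assumes p: "solid_harmonic k p"
  shows "(\<integral>y. bump 2 y * dir_deriv y p (x + t *\<^sub>R y) \<partial>lborel) = 0"
proof -
  note pp = solid_harmonicD(1)[OF p]
  have c: "continuous_on UNIV (\<lambda>y. dir_deriv i p (x + t *\<^sub>R y))" for i
    by (rule poly_continuous[OF poly_affine(1)[OF poly_dir_deriv[OF pp]]])
  have c2: "continuous_on UNIV (\<lambda>y. dir_deriv i (dir_deriv i p) (x + t *\<^sub>R y))" for i
    by (rule poly_continuous[OF poly_affine(1)[OF poly_dir_deriv[OF poly_dir_deriv[OF pp]]]])
  have "(\<integral>y. bump 2 y * ((y \<bullet> i) * dir_deriv i p (x + t *\<^sub>R y)) \<partial>lborel) =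
      t / 6 * (\<integral>y. bump 3 y * dir_deriv i (dir_deriv i p) (x + t *\<^sub>R y) \<partial>lborel)" for i :: 'a
    using bump_integration_by_parts[OF poly_affine(1)[OF poly_dir_deriv[OF pp]], of 1 i i x t]
    by (simp add: poly_affine(2)[OF poly_dir_deriv[OF pp]] numeral_3_eq_3 numeral_2_eq_2 mult.left_commute)
  then have "(\<Sum>i\<in>Basis. \<integral>y. bump 2 y * ((y \<bullet> i) * dir_deriv i p (x + t *\<^sub>R y)) \<partial>lborel) =
      t / 6 * (\<Sum>i\<in>Basis. \<integral>y. bump 3 y * dir_deriv i (dir_deriv i p) (x + t *\<^sub>R y) \<partial>lborel)"
    unfolding sum_distrib_left by (rule sum.cong[OF refl])
  also have "(\<Sum>i\<in>Basis. \<integral>y. bump 3 y * dir_deriv i (dir_deriv i p) (x + t *\<^sub>R y) \<partial>lborel) =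
      (\<integral>y. (\<Sum>i\<in>Basis. bump 3 y * dir_deriv i (dir_deriv i p) (x + t *\<^sub>R y)) \<partial>lborel)"
    by (intro Bochner_Integration.integral_sum[symmetric] integrable_bump_poly c2) auto
  also have "\<dots> = (\<integral>y. bump 3 y * laplacian p (x + t *\<^sub>R y) \<partial>lborel)"
    by (simp add: laplacian_def sum_distrib_left)
  also have "\<dots> = 0" by (simp add: solid_harmonicD(3)[OF p])
  also have "(\<Sum>i\<in>Basis. \<integral>y. bump 2 y * ((y \<bullet> i) * dir_deriv i p (x + t *\<^sub>R y)) \<partial>lborel) =
      (\<integral>y. (\<Sum>i\<in>Basis. bump 2 y * ((y \<bullet> i) * dir_deriv i p (x + t *\<^sub>R y))) \<partial>lborel)"
    by (intro Bochner_Integration.integral_sum[symmetric] integrable_bump_poly continuous_intros c) auto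
  also have "\<dots> = (\<integral>y. bump 2 y * dir_deriv y p (x + t *\<^sub>R y) \<partial>lborel)"
    by (simp add: dir_deriv_expand[OF pp] flip: sum_distrib_left)
  finally show ?thesis by simp
qed

lemma lborel_integral_eq_box:
  fixes f :: "'a::euclidean_space \<Rightarrow> real"
  assumes "continuous_on UNIV f" "\<And>x. 1 < norm x \<Longrightarrow> f x = 0" "cball 0 1 \<subseteq> cbox a b"
  shows "(\<integral>x. f x \<partial>lborel) = integral (cbox a b) f"
proof -
  have "f = (\<lambda>x. if x \<in> cbox a b then f x else 0)"
  proof
    fix x show "f x = (if x \<in> cbox a b then f x else 0)"
    proof (cases "x \<in> cbox a b")
      case False
      then have "x \<notin> cball 0 1" using assms(3) by blast
      then show ?thesis using assms(2) False by auto
    qed simp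
  qed
  then have "integral UNIV f = integral (cbox a b) f"
    by (metis Henstock_Kurzweil_Integration.integral_restrict_UNIV)
  then show ?thesis
    using integral_lborel[OF integrable_compact_support[OF assms(1), of 1]] assms(2) by simp
qed

lemma mean_value_property:
  fixes p :: "'a::euclidean_space \<Rightarrow> real"
  assumes p: "solid_harmonic k p"
  shows "(\<integral>y. bump 2 y * p (x + \<delta> *\<^sub>R y) \<partial>lborel) = p x * (\<integral>y. bump 2 (y::'a) \<partial>lborel)"
proof -
  note pp = solid_harmonicD(1)[OF p]
  have cp: "continuous_on UNIV p" by (rule poly_continuous[OF pp])
  have cd: "continuous_on UNIV (dir_deriv i p)" for i by (rule poly_continuous[OF poly_dir_deriv[OF pp]])
  obtain a :: 'a where a: "cball 0 1 \<subseteq> cbox (- a) a"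
    using bounded_subset_cbox_symmetric[of "cball (0::'a) 1"] by auto
  define I where "I t = integral (cbox (- a) a) (\<lambda>y. bump 2 y * p (x + t *\<^sub>R y))" for t :: real
  have I: "(\<integral>y. bump 2 y * p (x + t *\<^sub>R y) \<partial>lborel) = I t" for t
    unfolding I_def
    by (intro lborel_integral_eq_box a continuous_intros continuous_on_compose2[OF cp])
       (auto simp: bump_eq_0)
  have dd: "dir_deriv y p z = (\<Sum>i\<in>Basis. (y \<bullet> i) * dir_deriv i p z)" for y z
    by (simp add: dir_deriv_expand[OF pp])
  have "(I has_vector_derivative integral (cbox (- a) a) (\<lambda>y. bump 2 y * dir_deriv y p (x + t *\<^sub>R y))) (at t within UNIV)" for t
    unfolding I_def
  proof (rule leibniz_rule_vector_derivative)
    fix t :: real and y :: 'a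
    have "((\<lambda>t. p (x + t *\<^sub>R y)) has_derivative (\<lambda>h. dir_deriv (h *\<^sub>R y) p (x + t *\<^sub>R y))) (at t)"
      by (rule has_derivative_compose[where g = p and f = "\<lambda>t. x + t *\<^sub>R y" and x = t and s = UNIV, simplified])
         (auto intro!: derivative_eq_intros poly_has_derivative pp)
    then have "((\<lambda>t. bump 2 y * p (x + t *\<^sub>R y)) has_derivative
        (\<lambda>h. bump 2 y * dir_deriv (h *\<^sub>R y) p (x + t *\<^sub>R y))) (at t)"
      by (rule has_derivative_mult_right)
    then show "((\<lambda>t. bump 2 y * p (x + t *\<^sub>R y)) has_vector_derivative bump 2 y * dir_deriv y p (x + t *\<^sub>R y)) (at t within UNIV)"
      by (simp add: has_vector_derivative_def linear_scale[OF dir_deriv_linear[OF pp]] mult.left_commute)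
  next
    fix t :: real
    show "(\<lambda>y. bump 2 y * p (x + t *\<^sub>R y)) integrable_on cbox (- a) a"
      by (intro integrable_continuous continuous_intros continuous_on_compose2[OF cp]) auto
  next
    have "continuous_on (UNIV \<times> cbox (- a) a) (\<lambda>z. bump 2 (snd z) * (\<Sum>i\<in>Basis. (snd z \<bullet> i) * dir_deriv i p (x + fst z *\<^sub>R snd z)))"
      by (intro continuous_intros continuous_on_compose2[OF cd]) auto
    then show "continuous_on (UNIV \<times> cbox (- a) a) (\<lambda>(t, y). bump 2 y * dir_deriv y p (x + t *\<^sub>R y))"
      by (simp add: split_beta flip: dd)
  qed auto
  moreover have "integral (cbox (- a) a) (\<lambda>y. bump 2 y * dir_deriv y p (x + t *\<^sub>R y)) = 0" for t
  proof -
    have "continuous_on UNIV (\<lambda>y. bump 2 y * (\<Sum>i\<in>Basis. (y \<bullet> i) * dir_deriv i p (x + t *\<^sub>R y)))"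
      by (intro continuous_intros continuous_on_compose2[OF cd]) auto
    then have "continuous_on UNIV (\<lambda>y. bump 2 y * dir_deriv y p (x + t *\<^sub>R y))"
      by (simp flip: dd)
    then show ?thesis
      using lborel_integral_eq_box[OF _ _ a, of "\<lambda>y. bump 2 y * dir_deriv y p (x + t *\<^sub>R y)"]
        mean_value_dir_deriv[OF p, of x t] by (simp add: bump_eq_0)
  qed
  ultimately have "(I has_real_derivative 0) (at t)" for t
    by (simp add: has_real_derivative_iff_has_vector_derivative)
  then have "I \<delta> = I 0" using DERIV_isconst_all by blast
  then show ?thesis
    using I[of \<delta>] I[of 0] by (simp add: mult.commute)
qed

lemma bump_integral_pos: "0 < (\<integral>y. bump m (y::'a::euclidean_space) \<partial>lborel)" if "0 < m"
proof -
  have int: "integrable lborel (\<lambda>y::'a. bump m y)"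
    using integrable_bump_poly[OF that, of "\<lambda>_. 1"] by simp
  have "(\<integral>y. indicator (ball (0::'a) (1/2)) y * ((3/4)^m) \<partial>lborel) \<le> (\<integral>y. bump m (y::'a) \<partial>lborel)"
  proof (rule integral_mono[OF _ int])
    show "integrable lborel (\<lambda>y. indicator (ball (0::'a) (1/2)) y * ((3/4)^m::real))"
      using emeasure_bounded_finite[of "ball (0::'a) (1/2)"] by auto
    fix y :: 'a
    show "indicator (ball 0 (1/2)) y * ((3/4)^m) \<le> bump m y"
    proof (cases "norm y < 1/2")
      case True
      have "(norm y)\<^sup>2 \<le> (1/2)\<^sup>2" using True by (intro power_mono) auto
      then show ?thesis using True by (simp add: bump_def power2_eq_square power_mono)
    qed (simp add: bump_nonneg)
  qed
  moreover have "(\<integral>y. indicator (ball (0::'a) (1/2)) y * ((3/4)^m) \<partial>lborel) = measure lborel (ball (0::'a) (1/2)) * (3/4)^m"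
    by simp
  moreover have "0 < measure lborel (ball (0::'a) (1/2))"
    using content_ball_pos[of "1/2" "0::'a"] by (simp add: measure_completion)
  ultimately show ?thesis by (smt (verit) zero_less_mult_iff zero_less_power divide_pos_pos)
qed

text \<open>Integrals of a solid harmonic over small balls around points of the closed unit ball grow only
  like \<open>(1 + \<delta>)\<^sup>k\<close>, because such balls lie in the ball of radius \<open>1 + \<delta>\<close>.\<close>

lemma solid_harmonic_local_integral:
  fixes p :: "'a::euclidean_space \<Rightarrow> real"
  assumes p: "solid_harmonic k p" and \<delta>: "0 < \<delta>" and x: "norm x \<le> 1"
  shows "(\<integral>y. indicator (ball 0 1) y * \<bar>p (x + \<delta> *\<^sub>R y)\<bar> \<partial>lborel) \<le>
    ((1 + \<delta>) / \<delta>) ^ DIM('a) * (1 + \<delta>) ^ k * (\<integral>x. \<bar>p x\<bar> \<partial>surface_measure)"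
proof -
  note [measurable] = solid_harmonic_borel[OF p]
  have cp: "continuous_on S (\<lambda>x. \<bar>p x\<bar>)" for S
    by (intro continuous_intros solid_harmonic_sphere_continuous[OF p])
  have [measurable]: "ball (z::'a) r \<in> sets borel" for z r by auto
  have intb: "integrable lborel (\<lambda>u::'a. indicator (ball z r) u * \<bar>p u\<bar>)" for z r
  proof (rule Bochner_Integration.integrable_bound)
    show "integrable lborel (\<lambda>u::'a. indicator (cball z r) u *\<^sub>R \<bar>p u\<bar>)"
      by (intro borel_integrable_compact cp) auto
  qed (auto simp: indicator_def)
  have "(\<integral>u. indicator (ball x \<delta>) u * \<bar>p u\<bar> \<partial>lborel) =
      \<delta> ^ DIM('a) * (\<integral>y. indicator (ball x \<delta>) (x + \<delta> *\<^sub>R y) * \<bar>p (x + \<delta> *\<^sub>R y)\<bar> \<partial>lborel)"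
    using \<delta> by (intro lborel_integral_affine) auto
  also have "(\<lambda>y. indicator (ball x \<delta>) (x + \<delta> *\<^sub>R y) * \<bar>p (x + \<delta> *\<^sub>R y)\<bar>) =
      (\<lambda>y. indicator (ball 0 1) y * \<bar>p (x + \<delta> *\<^sub>R y)\<bar>)"
    using \<delta> by (auto simp: indicator_def fun_eq_iff dist_norm)
  finally have 1: "(\<integral>y. indicator (ball 0 1) y * \<bar>p (x + \<delta> *\<^sub>R y)\<bar> \<partial>lborel) =
      (1 / \<delta> ^ DIM('a)) * (\<integral>u. indicator (ball x \<delta>) u * \<bar>p u\<bar> \<partial>lborel)"
    using \<delta> by simp
  have "(\<integral>u. indicator (ball x \<delta>) u * \<bar>p u\<bar> \<partial>lborel) \<le> (\<integral>u. indicator (ball 0 (1 + \<delta>)) u * \<bar>p u\<bar> \<partial>lborel)"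
  proof (rule integral_mono[OF intb intb])
    fix u
    have "norm u < 1 + \<delta>" if "dist x u < \<delta>"
      using that x norm_triangle_ineq[of x "u - x"] by (simp add: dist_norm norm_minus_commute)
    then show "indicator (ball x \<delta>) u * \<bar>p u\<bar> \<le> indicator (ball 0 (1 + \<delta>)) u * \<bar>p u\<bar>"
      by (auto simp: indicator_def)
  qed
  also have "\<dots> = (1 + \<delta>) ^ DIM('a) * (\<integral>y. indicator (ball 0 (1 + \<delta>)) (0 + (1 + \<delta>) *\<^sub>R y) * \<bar>p (0 + (1 + \<delta>) *\<^sub>R y)\<bar> \<partial>lborel)"
    using \<delta> by (intro lborel_integral_affine) auto
  also have "(\<lambda>y. indicator (ball 0 (1 + \<delta>)) (0 + (1 + \<delta>) *\<^sub>R y) * \<bar>p (0 + (1 + \<delta>) *\<^sub>R y)\<bar>) =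
      (\<lambda>y. (1 + \<delta>) ^ k * (indicator (ball 0 1) y * \<bar>p y\<bar>))"
    using \<delta> by (auto simp: indicator_def fun_eq_iff solid_harmonicD(2)[OF p] abs_mult)
  also have "(\<integral>y. (1 + \<delta>) ^ k * (indicator (ball 0 1) y * \<bar>p y\<bar>) \<partial>lborel) =
      (1 + \<delta>) ^ k * (\<integral>y. indicator (ball 0 1) y * \<bar>p y\<bar> \<partial>lborel)" by simp
  also have "(\<integral>y. indicator (ball 0 1) y * \<bar>p y\<bar> \<partial>lborel) \<le> (\<integral>x. \<bar>p x\<bar> \<partial>surface_measure)"
  proof -
    have "(\<integral>y. indicator (ball 0 1) y * \<bar>p y\<bar> \<partial>lborel) \<le> (\<integral>x. indicator (ball 0 1 - {0}) x * \<bar>p (sgn x)\<bar> \<partial>lborel)"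
    proof (rule integral_mono_AE[OF intb])
      have "bounded (p ` cball 0 1)"
        by (intro compact_imp_bounded compact_continuous_image solid_harmonic_sphere_continuous[OF p]) auto
      then obtain C where C: "\<And>x. x \<in> cball 0 1 \<Longrightarrow> \<bar>p x\<bar> \<le> C" unfolding bounded_iff real_norm_def by blast
      have "integrable lborel (\<lambda>x. indicator (ball 0 1 - {0}) x *\<^sub>R \<bar>p (sgn x)\<bar>)"
        using emeasure_bounded_finite[of "ball (0::'a) 1 - {0}"] C
        by (intro integrableI_bounded_set_indicator[where B = C]) (auto simp: norm_sgn)
      then show "integrable lborel (\<lambda>x. indicator (ball 0 1 - {0}) x * \<bar>p (sgn x)\<bar>)" by simp
      show "AE x in lborel. indicator (ball 0 1) x * \<bar>p x\<bar> \<le> indicator (ball 0 1 - {0}) x * \<bar>p (sgn x)\<bar>"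
        using AE_lborel_singleton[of "0::'a"]
      proof eventually_elim
        case (elim x)
        have "\<bar>p x\<bar> \<le> \<bar>p (sgn x)\<bar>" if "norm x < 1"
          using solid_harmonic_polar[OF p, of x] that
          by (simp add: abs_mult mult_left_le_one_le power_le_one)
        then show ?case using elim by (auto simp: indicator_def)
      qed
    qed
    also have "\<dots> \<le> real DIM('a) * (\<integral>x. indicator (ball 0 1 - {0}) x * \<bar>p (sgn x)\<bar> \<partial>lborel)"
    proof -
      have nn: "0 \<le> (\<integral>x. indicator (ball 0 1 - {0}) x * \<bar>p (sgn x)\<bar> \<partial>lborel)"
        by (intro Bochner_Integration.integral_nonneg) auto
      have "1 \<le> real DIM('a)" using DIM_positive[where 'a = 'a] by linarith
      from mult_right_mono[OF this nn] show ?thesis by (simp only: mult_1)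
    qed
    also have "\<dots> = (\<integral>x. \<bar>p x\<bar> \<partial>surface_measure)"
      by (subst integral_surface_measure) auto
    finally show ?thesis .
  qed
  finally have 2: "(\<integral>u. indicator (ball x \<delta>) u * \<bar>p u\<bar> \<partial>lborel) \<le>
      (1 + \<delta>) ^ DIM('a) * ((1 + \<delta>) ^ k * (\<integral>x. \<bar>p x\<bar> \<partial>surface_measure))"
    using \<delta> by (simp add: mult_left_mono)
  show ?thesis unfolding 1 using mult_left_mono[OF 2, of "1 / \<delta> ^ DIM('a)"] \<delta>
    by (simp add: power_divide mult.assoc)
qed

text \<open>A small value of \<open>\<delta>\<close> makes the growth in the degree slower than any given geometric growth. The
  mean value property over the ball of radius \<open>\<delta>\<close> bounds the values; applied to the derivative it also
  bounds the derivative, after an integration by parts has moved the differentiation to the weight.\<close>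

lemma solid_harmonic_estimate:
  assumes \<delta>: "0 < (\<delta>::real)"
  obtains K where "K > 0"
    "\<And>k (p :: 'a::euclidean_space \<Rightarrow> real) x. solid_harmonic k p \<Longrightarrow> norm x \<le> 1 \<Longrightarrow>
       \<bar>p x\<bar> \<le> K * (1 + \<delta>) ^ k * (\<integral>x. \<bar>p x\<bar> \<partial>surface_measure)"
    "\<And>k (p :: 'a \<Rightarrow> real) x v. solid_harmonic k p \<Longrightarrow> norm x \<le> 1 \<Longrightarrow>
       \<bar>dir_deriv v p x\<bar> \<le> K * (1 + \<delta>) ^ k * (\<integral>x. \<bar>p x\<bar> \<partial>surface_measure) * norm v"
proof -
  define C where "C = (\<integral>y. bump 2 (y::'a) \<partial>lborel)"
  have C: "0 < C" unfolding C_def by (rule bump_integral_pos) simp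
  define D where "D = ((1 + \<delta>) / \<delta>) ^ DIM('a)"
  have D: "0 < D" unfolding D_def using \<delta> by simp
  define K where "K = (1 + 4 / \<delta>) * D / C"
  have [measurable]: "ball (0::'a) r \<in> sets borel" for r by auto
  have weighted: "\<bar>\<integral>y. w y * p (x + \<delta> *\<^sub>R y) \<partial>lborel\<bar> \<le> M * (D * (1 + \<delta>) ^ k * (\<integral>x. \<bar>p x\<bar> \<partial>surface_measure))"
    if p: "solid_harmonic k p" and x: "norm x \<le> 1"
      and w: "\<And>y. \<bar>w y\<bar> \<le> M * indicator (ball 0 1) y" "continuous_on UNIV w" and M: "0 \<le> M"
    for k and p :: "'a \<Rightarrow> real" and x w M
  proof -
    have cp: "continuous_on UNIV (\<lambda>y. p (x + \<delta> *\<^sub>R y))"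
      by (rule poly_continuous[OF poly_affine(1)[OF solid_harmonicD(1)[OF p]]])
    have [measurable]: "(\<lambda>y. p (x + \<delta> *\<^sub>R y)) \<in> borel_measurable borel" "w \<in> borel_measurable borel"
      using cp w(2) borel_measurable_continuous_onI by blast+
    have int: "integrable lborel (\<lambda>y. indicator (ball 0 1) y * \<bar>p (x + \<delta> *\<^sub>R y)\<bar>)"
    proof (rule Bochner_Integration.integrable_bound)
      show "integrable lborel (\<lambda>y. indicator (cball 0 1) y *\<^sub>R \<bar>p (x + \<delta> *\<^sub>R y)\<bar>)"
        by (intro borel_integrable_compact continuous_intros continuous_on_subset[OF cp]) auto
    qed (auto simp: indicator_def)
    have bd: "\<bar>w y * p (x + \<delta> *\<^sub>R y)\<bar> \<le> M * (indicator (ball 0 1) y * \<bar>p (x + \<delta> *\<^sub>R y)\<bar>)" for y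
      using mult_right_mono[OF w(1)[of y], of "\<bar>p (x + \<delta> *\<^sub>R y)\<bar>"] by (simp add: abs_mult mult.assoc)
    have int1: "integrable lborel (\<lambda>y. M * (indicator (ball 0 1) y * \<bar>p (x + \<delta> *\<^sub>R y)\<bar>))"
      using int by simp
    then have int2: "integrable lborel (\<lambda>y. w y * p (x + \<delta> *\<^sub>R y))"
    proof (rule Bochner_Integration.integrable_bound)
      show "AE y in lborel. norm (w y * p (x + \<delta> *\<^sub>R y)) \<le> norm (M * (indicator (ball 0 1) y * \<bar>p (x + \<delta> *\<^sub>R y)\<bar>))"
        unfolding real_norm_def using bd by (intro AE_I2 order_trans[OF bd abs_ge_self])
    qed measurable
    have "\<bar>\<integral>y. w y * p (x + \<delta> *\<^sub>R y) \<partial>lborel\<bar> \<le> (\<integral>y. \<bar>w y * p (x + \<delta> *\<^sub>R y)\<bar> \<partial>lborel)"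
      by (rule integral_abs_bound)
    also have "\<dots> \<le> (\<integral>y. M * (indicator (ball 0 1) y * \<bar>p (x + \<delta> *\<^sub>R y)\<bar>) \<partial>lborel)"
      by (rule integral_mono[OF integrable_abs[OF int2] int1 bd])
    also have "\<dots> = M * (\<integral>y. indicator (ball 0 1) y * \<bar>p (x + \<delta> *\<^sub>R y)\<bar> \<partial>lborel)" by simp
    also have "\<dots> \<le> M * (D * (1 + \<delta>) ^ k * (\<integral>x. \<bar>p x\<bar> \<partial>surface_measure))"
      using solid_harmonic_local_integral[OF p \<delta> x] M by (intro mult_left_mono) (auto simp: D_def)
    finally show ?thesis .
  qed
  have nn: "0 \<le> D * (1 + \<delta>) ^ k * (\<integral>x. \<bar>p x\<bar> \<partial>surface_measure)" for k and p :: "'a \<Rightarrow> real"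
    using D \<delta> by (intro mult_nonneg_nonneg Bochner_Integration.integral_nonneg) auto
  show ?thesis
  proof
    show "K > 0" unfolding K_def using C D \<delta> by (simp add: add_pos_pos)
  next
    fix k and p :: "'a \<Rightarrow> real" and x :: 'a
    assume p: "solid_harmonic k p" and x: "norm x \<le> 1"
    have "C * \<bar>p x\<bar> = \<bar>\<integral>y. bump 2 y * p (x + \<delta> *\<^sub>R y) \<partial>lborel\<bar>"
      using C by (simp add: mean_value_property[OF p] C_def[symmetric] abs_mult)
    also have "\<dots> \<le> 1 * (D * (1 + \<delta>) ^ k * (\<integral>x. \<bar>p x\<bar> \<partial>surface_measure))"
      by (rule weighted[OF p x])
         (auto simp: indicator_def bump_le_1 bump_nonneg abs_of_nonneg bump_eq_0 intro!: continuous_intros)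
    also have "\<dots> \<le> (1 + 4 / \<delta>) * (D * (1 + \<delta>) ^ k * (\<integral>x. \<bar>p x\<bar> \<partial>surface_measure))"
      using \<delta> by (intro mult_right_mono nn) simp
    finally show "\<bar>p x\<bar> \<le> K * (1 + \<delta>) ^ k * (\<integral>x. \<bar>p x\<bar> \<partial>surface_measure)"
      using C by (simp add: K_def field_simps)
  next
    fix k and p :: "'a \<Rightarrow> real" and x v :: 'a
    assume p: "solid_harmonic k p" and x: "norm x \<le> 1"
    have "C * dir_deriv v p x = (\<integral>y. bump 2 y * dir_deriv v p (x + \<delta> *\<^sub>R y) \<partial>lborel)"
      by (simp add: mean_value_property[OF solid_harmonic_dir_deriv[OF p]] C_def[symmetric])
    also have "\<dots> = 4 / \<delta> * (\<integral>y. bump 1 y * (y \<bullet> v) * p (x + \<delta> *\<^sub>R y) \<partial>lborel)"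
      using bump_integration_by_parts[OF poly_affine(1)[OF solid_harmonicD(1)[OF p]], of 0 v x \<delta>] \<delta>
      by (simp add: poly_affine(2)[OF solid_harmonicD(1)[OF p]] numeral_2_eq_2 mult.left_commute[of _ \<delta>] mult.assoc field_simps)
    finally have "\<bar>C * dir_deriv v p x\<bar> = \<bar>4 / \<delta> * (\<integral>y. bump 1 y * (y \<bullet> v) * p (x + \<delta> *\<^sub>R y) \<partial>lborel)\<bar>"
      by (rule arg_cong)
    then have "C * \<bar>dir_deriv v p x\<bar> = 4 / \<delta> * \<bar>\<integral>y. bump 1 y * (y \<bullet> v) * p (x + \<delta> *\<^sub>R y) \<partial>lborel\<bar>"
      unfolding abs_mult using C \<delta> by simp
    also have "\<dots> \<le> 4 / \<delta> * (norm v * (D * (1 + \<delta>) ^ k * (\<integral>x. \<bar>p x\<bar> \<partial>surface_measure)))"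
    proof (rule mult_left_mono[OF weighted[OF p x]])
      fix y :: 'a
      show "\<bar>bump 1 y * (y \<bullet> v)\<bar> \<le> norm v * indicator (ball 0 1) y"
      proof (cases "norm y < 1")
        case True
        have "\<bar>y \<bullet> v\<bar> \<le> norm v"
          using Cauchy_Schwarz_ineq2[of y v] True mult_left_le_one_le[of "norm v" "norm y"] by simp
        then have "bump 1 y * \<bar>y \<bullet> v\<bar> \<le> 1 * norm v"
          by (intro mult_mono) (auto simp: bump_le_1)
        then show ?thesis using True by (simp add: abs_mult bump_nonneg)
      qed (simp add: bump_eq_0)
    qed (use \<delta> in \<open>auto intro!: continuous_intros\<close>)
    also have "\<dots> \<le> (1 + 4 / \<delta>) * (norm v * (D * (1 + \<delta>) ^ k * (\<integral>x. \<bar>p x\<bar> \<partial>surface_measure)))"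
      using \<delta> by (intro mult_right_mono mult_nonneg_nonneg[OF norm_ge_zero nn]) auto
    finally show "\<bar>dir_deriv v p x\<bar> \<le> K * (1 + \<delta>) ^ k * (\<integral>x. \<bar>p x\<bar> \<partial>surface_measure) * norm v"
      using C by (simp add: K_def field_simps)
  qed
qed

section \<open>Harmonic functions and the maximum principle\<close>

text \<open>Partial derivatives are easier to compute with than the nested bounded linear maps in the
  definition of a harmonic function; the next two lemmas translate between them.\<close>

lemma harmonic_on_partial_derivatives:
  assumes "harmonic_on U f"
  shows "\<exists>D H. (\<forall>x\<in>U. (f has_derivative D x) (at x)) \<and>
    (\<forall>x\<in>U. \<forall>v. ((\<lambda>x. D x v) has_derivative H x v) (at x)) \<and>
    (\<forall>v w. continuous_on U (\<lambda>x. H x v w)) \<and>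
    (\<forall>x\<in>U. (\<Sum>i\<in>Basis. H x i i) = 0)"
proof -
  obtain f' f'' where *: "\<forall>x\<in>U. (f has_derivative blinfun_apply (f' x)) (at x)"
    "\<forall>x\<in>U. (f' has_derivative blinfun_apply (f'' x)) (at x)" "continuous_on U f''"
    "\<forall>x\<in>U. (\<Sum>i\<in>Basis. blinfun_apply (blinfun_apply (f'' x) i) i) = 0"
    using assms unfolding harmonic_on_def by blast
  show ?thesis
  proof (intro exI[of _ "\<lambda>x. blinfun_apply (f' x)"]
      exI[of _ "\<lambda>x v w. blinfun_apply (blinfun_apply (f'' x) w) v"] conjI ballI allI)
    show "((\<lambda>x. blinfun_apply (f' x) v) has_derivative (\<lambda>w. blinfun_apply (blinfun_apply (f'' x) w) v)) (at x)"
      if "x \<in> U" for x v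
      using bounded_linear.has_derivative[OF blinfun.bounded_linear_left] *(2) that by blast
    show "continuous_on U (\<lambda>x. blinfun_apply (blinfun_apply (f'' x) w) v)" for v w
      by (intro blinfun.continuous_on continuous_on_const *(3))
  qed (use * in auto)
qed

lemma harmonic_onI:
  fixes f :: "'a::euclidean_space \<Rightarrow> 'b::real_normed_vector"
  assumes D: "\<And>x. x \<in> U \<Longrightarrow> (f has_derivative D x) (at x)"
    and H: "\<And>x v. x \<in> U \<Longrightarrow> v \<in> Basis \<Longrightarrow> ((\<lambda>x. D x v) has_derivative H x v) (at x)"
    and cont: "\<And>v w. v \<in> Basis \<Longrightarrow> w \<in> Basis \<Longrightarrow> continuous_on U (\<lambda>x. H x v w)"
    and lap: "\<And>x. x \<in> U \<Longrightarrow> (\<Sum>i\<in>Basis. H x i i) = 0"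
  shows "harmonic_on U f"
proof -
  have E_linear: "bounded_linear (\<lambda>y :: 'c::real_normed_vector. blinfun_scaleR_left y o\<^sub>L blinfun_inner_left (i :: 'a))" for i
    by (rule bounded_linear_compose[OF
          bounded_bilinear.bounded_linear_left[OF bounded_bilinear_blinfun_compose]
          bounded_linear_blinfun_scaleR_left])
  define f' where "f' x = (\<Sum>i\<in>Basis. blinfun_scaleR_left (D x i) o\<^sub>L blinfun_inner_left i)" for x
  define f'' where "f'' x = (\<Sum>j\<in>Basis. blinfun_scaleR_left
      (\<Sum>i\<in>Basis. blinfun_scaleR_left (H x i j) o\<^sub>L blinfun_inner_left i) o\<^sub>L blinfun_inner_left j)" for x
  have expand: "(\<Sum>i\<in>Basis. (v \<bullet> i) *\<^sub>R L i) = L v" if "linear L" for L :: "'a \<Rightarrow> 'c::real_vector" and v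
  proof -
    have "L v = L (\<Sum>i\<in>Basis. (v \<bullet> i) *\<^sub>R i)" by (simp add: euclidean_representation)
    then show ?thesis by (simp add: linear_sum[OF that] linear_scale[OF that])
  qed
  have f': "blinfun_apply (f' x) v = D x v" if "x \<in> U" for x v
    using expand[OF has_derivative_linear[OF D[OF that]], of v]
    by (simp add: f'_def blinfun.sum_left inner_commute)
  have f'': "blinfun_apply (f'' x) w = (\<Sum>i\<in>Basis. blinfun_scaleR_left (H x i w) o\<^sub>L blinfun_inner_left i)" if "x \<in> U" for x w
  proof -
    have "linear (\<lambda>w. \<Sum>i\<in>Basis. blinfun_scaleR_left (H x i w) o\<^sub>L blinfun_inner_left i)"
      by (intro linear_compose_sum ballI linear_compose[OF has_derivative_linear[OF H[OF that]], unfolded o_def]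
          bounded_linear.linear E_linear)
    from expand[OF this, of w] show ?thesis
      by (simp add: f''_def blinfun.sum_left inner_commute)
  qed
  have "blinfun_apply (blinfun_apply (f'' x) k) k = H x k k" if "x \<in> U" "k \<in> Basis" for x k
    using that by (simp add: f'' blinfun.sum_left inner_Basis if_distrib[of "\<lambda>c. c *\<^sub>R _"] sum.delta' cong: if_cong)
  then have 4: "\<forall>x\<in>U. (\<Sum>i\<in>Basis. blinfun_apply (blinfun_apply (f'' x) i) i) = 0"
    using lap by simp
  have 1: "\<forall>x\<in>U. (f has_derivative blinfun_apply (f' x)) (at x)"
  proof
    fix x assume x: "x \<in> U"
    then have "blinfun_apply (f' x) = D x" by (intro ext f')
    with D[OF x] show "(f has_derivative blinfun_apply (f' x)) (at x)" by simp
  qed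
  have 2: "(f' has_derivative blinfun_apply (f'' x)) (at x)" if "x \<in> U" for x
  proof -
    have "(f' has_derivative (\<lambda>w. \<Sum>i\<in>Basis. blinfun_scaleR_left (H x i w) o\<^sub>L blinfun_inner_left i)) (at x)"
      unfolding f'_def
      by (intro has_derivative_sum bounded_linear.has_derivative[OF E_linear] H that)
    then show ?thesis by (rule has_derivative_eq_rhs) (simp add: f''[OF that] fun_eq_iff)
  qed
  have 3: "continuous_on U f''"
    unfolding f''_def
    by (intro continuous_on_sum bounded_linear.continuous_on[OF E_linear] cont)
  show ?thesis unfolding harmonic_on_def using 1 2 3 4 by blast
qed

lemma harmonic_on_subset: "harmonic_on U f \<Longrightarrow> V \<subseteq> U \<Longrightarrow> harmonic_on V f"
  unfolding harmonic_on_def by (blast intro: continuous_on_subset)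

lemma harmonic_on_continuous: "harmonic_on U f \<Longrightarrow> continuous_on U f"
  unfolding harmonic_on_def by (blast intro: continuous_at_imp_continuous_on has_derivative_continuous)

lemma harmonic_on_cong:
  assumes "open U" "\<And>x. x \<in> U \<Longrightarrow> f x = g x" "harmonic_on U f"
  shows "harmonic_on U g"
proof -
  have "(g has_derivative L) (at x)" if "(f has_derivative L) (at x)" "x \<in> U" for L x
    using has_derivative_transform_within_open[OF that(1) assms(1) that(2) assms(2)] .
  then show ?thesis using assms(3) unfolding harmonic_on_def by blast
qed

lemma harmonic_on_bounded_linear:
  assumes T: "bounded_linear T" and f: "harmonic_on U f"
  shows "harmonic_on U (\<lambda>x. T (f x))"
proof -
  obtain D H where *: "\<And>x. x \<in> U \<Longrightarrow> (f has_derivative D x) (at x)"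
    "\<And>x v. x \<in> U \<Longrightarrow> ((\<lambda>x. D x v) has_derivative H x v) (at x)"
    "\<And>v w. continuous_on U (\<lambda>x. H x v w)"
    "\<And>x. x \<in> U \<Longrightarrow> (\<Sum>i\<in>Basis. H x i i) = 0"
    using harmonic_on_partial_derivatives[OF f] by blast
  show ?thesis
  proof (rule harmonic_onI[where D = "\<lambda>x v. T (D x v)" and H = "\<lambda>x v w. T (H x v w)"])
    show "(\<Sum>i\<in>Basis. T (H x i i)) = 0" if "x \<in> U" for x
      using *(4)[OF that] T by (metis bounded_linear.linear linear_0 linear_sum)
  qed (intro bounded_linear.has_derivative[OF T] bounded_linear.continuous_on[OF T] *; assumption)+
qed

lemma harmonic_on_add:
  assumes f: "harmonic_on U f" and g: "harmonic_on U g"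
  shows "harmonic_on U (\<lambda>x. f x + g x)"
proof -
  obtain D H where *: "\<And>x. x \<in> U \<Longrightarrow> (f has_derivative D x) (at x)"
    "\<And>x v. x \<in> U \<Longrightarrow> ((\<lambda>x. D x v) has_derivative H x v) (at x)"
    "\<And>v w. continuous_on U (\<lambda>x. H x v w)"
    "\<And>x. x \<in> U \<Longrightarrow> (\<Sum>i\<in>Basis. H x i i) = 0"
    using harmonic_on_partial_derivatives[OF f] by blast
  obtain D' H' where **: "\<And>x. x \<in> U \<Longrightarrow> (g has_derivative D' x) (at x)"
    "\<And>x v. x \<in> U \<Longrightarrow> ((\<lambda>x. D' x v) has_derivative H' x v) (at x)"
    "\<And>v w. continuous_on U (\<lambda>x. H' x v w)"
    "\<And>x. x \<in> U \<Longrightarrow> (\<Sum>i\<in>Basis. H' x i i) = 0"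
    using harmonic_on_partial_derivatives[OF g] by blast
  show ?thesis
    by (rule harmonic_onI[where D = "\<lambda>x v. D x v + D' x v" and H = "\<lambda>x v w. H x v w + H' x v w"])
       (auto intro!: has_derivative_add continuous_on_add * ** simp: sum.distrib *(4) **(4))
qed

lemma harmonic_on_diff:
  assumes f: "harmonic_on U f" and g: "harmonic_on U g"
  shows "harmonic_on U (\<lambda>x. f x - g x)"
  using harmonic_on_add[OF f harmonic_on_bounded_linear[OF bounded_linear_minus[OF bounded_linear_ident] g]]
  by simp

lemma harmonic_on_scale:
  assumes f: "harmonic_on (ball 0 1) f" and r: "0 < r"
  shows "harmonic_on (ball 0 (1 / r)) (\<lambda>x. f (r *\<^sub>R x))"
proof -
  obtain D H where *: "\<And>x. x \<in> ball 0 1 \<Longrightarrow> (f has_derivative D x) (at x)"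
    "\<And>x v. x \<in> ball 0 1 \<Longrightarrow> ((\<lambda>x. D x v) has_derivative H x v) (at x)"
    "\<And>v w. continuous_on (ball 0 1) (\<lambda>x. H x v w)"
    "\<And>x. x \<in> ball 0 1 \<Longrightarrow> (\<Sum>i\<in>Basis. H x i i) = 0"
    using harmonic_on_partial_derivatives[OF f] by blast
  have in_ball: "r *\<^sub>R x \<in> ball 0 1" if "x \<in> ball 0 (1 / r)" for x :: 'a
    using that r by (simp add: field_simps)
  have chain: "((\<lambda>x. F (r *\<^sub>R x)) has_derivative (\<lambda>v. r *\<^sub>R L v)) (at x)"
    if L: "(F has_derivative L) (at (r *\<^sub>R x))" for F :: "'a \<Rightarrow> 'b" and L x
  proof -
    have "((\<lambda>x. F (r *\<^sub>R x)) has_derivative (\<lambda>v. L (r *\<^sub>R v))) (at x)"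
      using L by (intro has_derivative_compose[where g = F and f = "\<lambda>x. r *\<^sub>R x" and x = x and s = UNIV, simplified])
         (auto intro!: derivative_eq_intros)
    then show ?thesis by (simp add: linear_scale[OF has_derivative_linear[OF L]])
  qed
  show ?thesis
  proof (rule harmonic_onI[where D = "\<lambda>x v. r *\<^sub>R D (r *\<^sub>R x) v" and H = "\<lambda>x v w. r *\<^sub>R r *\<^sub>R H (r *\<^sub>R x) v w"])
    show "((\<lambda>x. r *\<^sub>R D (r *\<^sub>R x) v) has_derivative (\<lambda>w. r *\<^sub>R r *\<^sub>R H (r *\<^sub>R x) v w)) (at x)"
      if "x \<in> ball 0 (1 / r)" for x v
      by (intro has_derivative_scaleR_right chain *(2) in_ball that)
    show "continuous_on (ball 0 (1 / r)) (\<lambda>x. r *\<^sub>R r *\<^sub>R H (r *\<^sub>R x) v w)" for v w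
      by (intro continuous_intros continuous_on_compose2[OF *(3)]) (use in_ball in auto)
    show "(\<Sum>i\<in>Basis. r *\<^sub>R r *\<^sub>R H (r *\<^sub>R x) i i) = 0" if "x \<in> ball 0 (1 / r)" for x
      using *(4)[OF in_ball[OF that]] by (simp flip: scaleR_sum_right)
  qed (intro chain * in_ball; assumption)
qed

lemma harmonic_on_poly:
  assumes "real_polynomial_function p" "\<And>x. laplacian p x = 0"
  shows "harmonic_on U p"
  by (rule harmonic_onI[where D = "\<lambda>x v. dir_deriv v p x" and H = "\<lambda>x v w. dir_deriv w (dir_deriv v p) x"])
     (use assms in \<open>auto intro!: poly_has_derivative poly_dir_deriv poly_continuous simp: laplacian_def\<close>)

lemma laplacian_harmonic_poly:
  assumes p: "real_polynomial_function p" and h: "harmonic_on UNIV p"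
  shows "laplacian p x = 0"
proof -
  obtain D H where *: "\<And>x. (p has_derivative D x) (at x)"
    "\<And>x v. ((\<lambda>x. D x v) has_derivative H x v) (at x)"
    "\<And>x. (\<Sum>i\<in>Basis. H x i i) = 0"
    using harmonic_on_partial_derivatives[OF h] by blast
  have 1: "dir_deriv v p = (\<lambda>x. D x v)" for v
    by (intro ext dir_deriv_eqI *)
  have "dir_deriv w (dir_deriv v p) x = H x v w" for v w x
    unfolding 1 by (intro dir_deriv_eqI *)
  then show ?thesis using *(3) by (simp add: laplacian_def)
qed

text \<open>Adding \<open>\<epsilon> \<bar>x\<bar>\<^sup>2\<close> makes the Laplacian positive, so that an interior maximum contradicts the
  second derivative test in one of the coordinate directions.\<close>

lemma maximum_principle_aux:
  fixes u :: "'a::euclidean_space \<Rightarrow> real"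
  assumes h: "harmonic_on (ball 0 1) u" and cont: "continuous_on (cball 0 1) u"
    and bd: "\<And>x. x \<in> sphere 0 1 \<Longrightarrow> u x \<le> M" and x0: "x0 \<in> cball 0 1"
  shows "u x0 \<le> M"
proof (rule ccontr)
  assume "\<not> u x0 \<le> M"
  define \<epsilon> where "\<epsilon> = (u x0 - M) / 2"
  have \<epsilon>: "0 < \<epsilon>" using \<open>\<not> u x0 \<le> M\<close> by (simp add: \<epsilon>_def)
  obtain D H where *: "\<And>x. x \<in> ball 0 1 \<Longrightarrow> (u has_derivative D x) (at x)"
    "\<And>x v. x \<in> ball 0 1 \<Longrightarrow> ((\<lambda>x. D x v) has_derivative H x v) (at x)"
    "\<And>x. x \<in> ball 0 1 \<Longrightarrow> (\<Sum>i\<in>Basis. H x i i) = 0"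
    using harmonic_on_partial_derivatives[OF h] by blast
  define v where "v x = u x + \<epsilon> * (x \<bullet> x)" for x
  have "continuous_on (cball 0 1) v" unfolding v_def by (intro continuous_intros cont)
  then obtain z where z: "z \<in> cball 0 1" "\<And>y. y \<in> cball 0 1 \<Longrightarrow> v y \<le> v z"
    using continuous_attains_sup[of "cball (0::'a) 1" v] by auto
  have "z \<notin> sphere 0 1"
  proof
    assume zs: "z \<in> sphere 0 1"
    then have "v z \<le> M + \<epsilon>" using bd[OF zs] by (simp add: v_def dot_square_norm)
    moreover have "u x0 \<le> v x0" using \<epsilon> by (simp add: v_def)
    moreover have "v x0 \<le> v z" by (rule z(2)[OF x0])
    ultimately show False using \<epsilon> by (simp add: \<epsilon>_def field_simps)
  qed
  with z(1) have zb: "norm z < 1" by auto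
  have "\<exists>i\<in>Basis. 0 < H z i i + 2 * \<epsilon>"
  proof (rule ccontr)
    assume "\<not> ?thesis"
    then have "(\<Sum>i\<in>Basis. H z i i + 2 * \<epsilon>) \<le> 0" by (intro sum_nonpos) (auto simp: not_less)
    moreover have "(\<Sum>i\<in>Basis. H z i i + 2 * \<epsilon>) = 2 * \<epsilon> * real DIM('a)"
      using *(3)[of z] zb by (simp add: sum.distrib)
    ultimately show False using \<epsilon> by (simp add: mult_le_0_iff)
  qed
  then obtain i where i: "i \<in> Basis" "0 < H z i i + 2 * \<epsilon>" by blast
  define \<delta> where "\<delta> = 1 - norm z"
  have \<delta>: "0 < \<delta>" using zb by (simp add: \<delta>_def)
  have in_ball: "z + t *\<^sub>R i \<in> ball 0 1" if "\<bar>t\<bar> < \<delta>" for t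
    using norm_triangle_ineq[of z "t *\<^sub>R i"] that i(1) by (simp add: \<delta>_def)
  define \<phi> where "\<phi> t = v (z + t *\<^sub>R i)" for t
  define \<phi>' where "\<phi>' t = D (z + t *\<^sub>R i) i + 2 * \<epsilon> * ((z + t *\<^sub>R i) \<bullet> i)" for t
  have line: "((\<lambda>t. F (z + t *\<^sub>R i)) has_real_derivative L i) (at t)"
    if L: "(F has_derivative L) (at (z + t *\<^sub>R i))" for F :: "'a \<Rightarrow> real" and L t
  proof -
    have "((\<lambda>t. F (z + t *\<^sub>R i)) has_derivative (\<lambda>h. L (h *\<^sub>R i))) (at t)"
      using L by (intro has_derivative_compose[where g = F and f = "\<lambda>t. z + t *\<^sub>R i" and x = t and s = UNIV, simplified])
         (auto intro!: derivative_eq_intros)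
    then show ?thesis
      by (simp add: linear_scale[OF has_derivative_linear[OF L]] has_field_derivative_def mult.commute[of _ "L i"])
  qed
  have \<phi>: "(\<phi> has_real_derivative \<phi>' t) (at t)" if "\<bar>t\<bar> < \<delta>" for t
  proof -
    have "((\<lambda>x. u x + \<epsilon> * (x \<bullet> x)) has_derivative (\<lambda>w. D (z + t *\<^sub>R i) w + 2 * \<epsilon> * ((z + t *\<^sub>R i) \<bullet> w))) (at (z + t *\<^sub>R i))"
      by (auto intro!: derivative_eq_intros *(1)[OF in_ball[OF that]] simp: inner_commute fun_eq_iff)
    from line[OF this] show ?thesis unfolding \<phi>_def v_def \<phi>'_def .
  qed
  have \<phi>': "(\<phi>' has_real_derivative H z i i + 2 * \<epsilon>) (at 0)"
    unfolding \<phi>'_def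
    using line[of "\<lambda>x. D x i" "H z i" 0] *(2)[of z i] zb i(1)
    by (auto intro!: derivative_eq_intros simp: inner_add_left)
  have max: "\<phi> t \<le> \<phi> 0" if "\<bar>t\<bar> < \<delta>" for t
    using z(2)[of "z + t *\<^sub>R i"] in_ball[OF that] by (simp add: \<phi>_def)
  have "\<phi>' 0 = 0"
    by (rule DERIV_local_max[OF \<phi> \<delta>]) (use max \<delta> in auto)
  then obtain d where d: "0 < d" "\<And>h. 0 < h \<Longrightarrow> h < d \<Longrightarrow> 0 < \<phi>' h"
    using DERIV_pos_inc_right[OF \<phi>' i(2)] by auto
  define h where "h = min d \<delta> / 2"
  have h: "0 < h" "h < d" "h < \<delta>" using d(1) \<delta> by (auto simp: h_def)
  obtain t where t: "0 < t" "t < h" "\<phi> h - \<phi> 0 = (h - 0) * \<phi>' t"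
    using MVT2[of 0 h \<phi> \<phi>'] h \<phi> by auto
  have "0 < h * \<phi>' t" using h t d(2) by (intro mult_pos_pos) auto
  then show False using t(3) max[of h] h by simp
qed

lemma maximum_principle:
  fixes u :: "'a::euclidean_space \<Rightarrow> real"
  assumes h: "harmonic_on (ball 0 1) u" and cont: "continuous_on (cball 0 1) u"
    and bd: "\<And>x. x \<in> sphere 0 1 \<Longrightarrow> \<bar>u x\<bar> \<le> M" and x: "x \<in> cball 0 1"
  shows "\<bar>u x\<bar> \<le> M"
proof -
  have "u x \<le> M"
    by (rule maximum_principle_aux[OF h cont _ x]) (use bd in force)
  moreover have "- u x \<le> M"
    by (rule maximum_principle_aux[OF harmonic_on_bounded_linear[OF bounded_linear_minus[OF bounded_linear_ident] h] _ _ x])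
       (use bd in \<open>force intro!: continuous_intros cont\<close>)+
  ultimately show ?thesis by simp
qed

section \<open>Density of the solid harmonics on the sphere\<close>

inductive harmonic_span :: "('a::euclidean_space \<Rightarrow> real) \<Rightarrow> bool" where
  solid: "solid_harmonic k p \<Longrightarrow> harmonic_span p"
| add: "harmonic_span p \<Longrightarrow> harmonic_span q \<Longrightarrow> harmonic_span (\<lambda>x. p x + q x)"

lemma harmonic_span_cmult: "harmonic_span p \<Longrightarrow> harmonic_span (\<lambda>x. c * p x)"
  by (induction rule: harmonic_span.induct)
     (auto simp: distrib_left intro: harmonic_span.intros solid_harmonic_cmult)

lemma harmonic_span_mult_linear:
  fixes u :: "'a::euclidean_space \<Rightarrow> real"
  assumes "harmonic_span u" and N: "DIM('a) \<ge> 2"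
  shows "\<exists>w. harmonic_span w \<and> (\<forall>x\<in>sphere 0 1. (x \<bullet> v) * u x = w x)"
  using assms(1)
proof induction
  case (solid k p)
  then obtain p1 p2 where "solid_harmonic (Suc k) p1" "solid_harmonic (k - 1) p2"
    "\<And>x. x \<in> sphere 0 1 \<Longrightarrow> (x \<bullet> v) * p x = p1 x + p2 x"
    using solid_harmonic_mult_linear[OF _ N] by metis
  then show ?case
    by (intro exI[of _ "\<lambda>x. p1 x + p2 x"]) (auto intro: harmonic_span.intros)
next
  case (add p q)
  then obtain w1 w2 where "harmonic_span w1" "\<forall>x\<in>sphere 0 1. (x \<bullet> v) * p x = w1 x"
    "harmonic_span w2" "\<forall>x\<in>sphere 0 1. (x \<bullet> v) * q x = w2 x" by blast
  then show ?case
    by (intro exI[of _ "\<lambda>x. w1 x + w2 x"]) (auto intro: harmonic_span.intros simp: distrib_left)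
qed

text \<open>Starting from the constant \<open>1\<close>, multiplication by linear forms reaches every polynomial, so that
  on the sphere every polynomial agrees with an element of the span.\<close>

lemma harmonic_span_mult_poly:
  fixes q :: "'a::euclidean_space \<Rightarrow> real"
  assumes "real_polynomial_function q" and N: "DIM('a) \<ge> 2"
  shows "harmonic_span u \<Longrightarrow> \<exists>w. harmonic_span w \<and> (\<forall>x\<in>sphere 0 1. q x * u x = w x)"
  using assms(1)
proof (induction arbitrary: u)
  case (linear f)
  have "f x = x \<bullet> (\<Sum>i\<in>Basis. f i *\<^sub>R i)" for x
  proof -
    have "f x = f (\<Sum>i\<in>Basis. (x \<bullet> i) *\<^sub>R i)" by (simp add: euclidean_representation)
    then show ?thesis
      using bounded_linear.linear[OF linear(1)]
      by (simp add: linear_sum linear_scale inner_sum_right mult.commute)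
  qed
  moreover obtain w where "harmonic_span w" "\<forall>x\<in>sphere 0 1. (x \<bullet> (\<Sum>i\<in>Basis. f i *\<^sub>R i)) * u x = w x"
    using harmonic_span_mult_linear[OF linear(2) N] by blast
  ultimately show ?case by metis
next
  case (const c)
  then show ?case using harmonic_span_cmult by blast
next
  case (add f g)
  obtain w1 w2 where "harmonic_span w1" "\<forall>x\<in>sphere 0 1. f x * u x = w1 x"
    "harmonic_span w2" "\<forall>x\<in>sphere 0 1. g x * u x = w2 x"
    using add.IH(1)[OF add.prems] add.IH(2)[OF add.prems] by blast
  then show ?case
    by (intro exI[of _ "\<lambda>x. w1 x + w2 x"]) (auto intro: harmonic_span.intros simp: distrib_right)
next
  case (mult f g)
  obtain w2 where w2: "harmonic_span w2" "\<forall>x\<in>sphere 0 1. g x * u x = w2 x" using mult.IH(2)[OF mult.prems] by blast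
  obtain w1 where "harmonic_span w1" "\<forall>x\<in>sphere 0 1. f x * w2 x = w1 x" using mult.IH(1)[OF w2(1)] by blast
  then show ?case using w2(2) by (intro exI[of _ w1]) (auto simp: mult.assoc)
qed

lemma harmonic_span_dense:
  fixes \<phi> :: "'a::euclidean_space \<Rightarrow> real"
  assumes N: "DIM('a) \<ge> 2" and cont: "continuous_on (sphere 0 1) \<phi>" and e: "0 < e"
  obtains w where "harmonic_span w" "\<And>x. x \<in> sphere 0 1 \<Longrightarrow> \<bar>\<phi> x - w x\<bar> < e"
proof -
  obtain q where q: "real_polynomial_function q" "\<And>x. x \<in> sphere 0 1 \<Longrightarrow> \<bar>\<phi> x - q x\<bar> < e"
    using Stone_Weierstrass_real_polynomial_function[OF compact_sphere cont e] by metis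
  obtain w where "harmonic_span w" "\<forall>x\<in>sphere 0 1. q x * 1 = w x"
    using harmonic_span_mult_poly[OF q(1) N harmonic_span.solid[OF solid_harmonic_const[of 1]]] by auto
  then show ?thesis using q(2) that by auto
qed

section \<open>Sequences of subexponential growth\<close>

text \<open>The sequences \<open>a\<close> for which the power series \<open>\<Sum>\<^sub>k a\<^sub>k r\<^sup>k\<close> has radius of convergence at least \<open>1\<close>,
  expressed by bounds on its terms, which can be multiplied.\<close>

definition subexp :: "(nat \<Rightarrow> real) \<Rightarrow> bool" where
  "subexp a \<longleftrightarrow> (\<forall>r. 0 < r \<longrightarrow> r < 1 \<longrightarrow> (\<exists>C. \<forall>k. \<bar>a k\<bar> * r ^ k \<le> C))"

lemma subexpD: "subexp a \<Longrightarrow> 0 < r \<Longrightarrow> r < 1 \<Longrightarrow> \<exists>C. \<forall>k. \<bar>a k\<bar> * r ^ k \<le> C"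
  unfolding subexp_def by blast

lemma subexp_mono: "subexp b \<Longrightarrow> (\<And>k. \<bar>a k\<bar> \<le> \<bar>b k\<bar>) \<Longrightarrow> subexp a"
  unfolding subexp_def
proof (intro allI impI)
  fix r :: real
  assume b: "\<forall>r>0. r < 1 \<longrightarrow> (\<exists>C. \<forall>k. \<bar>b k\<bar> * r ^ k \<le> C)" and le: "\<And>k. \<bar>a k\<bar> \<le> \<bar>b k\<bar>" and r: "0 < r" "r < 1"
  obtain C where C: "\<And>k. \<bar>b k\<bar> * r ^ k \<le> C" using b r by blast
  have "\<bar>a k\<bar> * r ^ k \<le> C" for k
    by (rule order_trans[OF mult_right_mono[OF le] C]) (use r in simp)
  then show "\<exists>C. \<forall>k. \<bar>a k\<bar> * r ^ k \<le> C" by blast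
qed

lemma subexp_mult:
  assumes "subexp a" "subexp b"
  shows "subexp (\<lambda>k. a k * b k)"
  unfolding subexp_def
proof (intro allI impI)
  fix r :: real assume r: "0 < r" "r < 1"
  define s where "s = sqrt r"
  have s: "0 < s" "s < 1" "r = s * s" using r by (auto simp: s_def)
  obtain A B where AB: "\<And>k. \<bar>a k\<bar> * s ^ k \<le> A" "\<And>k. \<bar>b k\<bar> * s ^ k \<le> B"
    using subexpD[OF assms(1) s(1,2)] subexpD[OF assms(2) s(1,2)] by blast
  have "\<bar>a k * b k\<bar> * r ^ k \<le> A * B" for k
  proof -
    have "\<bar>a k * b k\<bar> * r ^ k = (\<bar>a k\<bar> * s ^ k) * (\<bar>b k\<bar> * s ^ k)"
      by (simp add: s(3) abs_mult power_mult_distrib)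
    also have "\<dots> \<le> A * B"
      using s(1) AB[of k] by (intro mult_mono AB) (auto intro: order_trans[OF _ AB(1)[of k]])
    finally show ?thesis .
  qed
  then show "\<exists>C. \<forall>k. \<bar>a k * b k\<bar> * r ^ k \<le> C" by blast
qed

lemma subexp_const: "subexp (\<lambda>k. c)"
  unfolding subexp_def
proof (intro allI impI exI[of _ "\<bar>c\<bar>"])
  fix r :: real and k :: nat assume "0 < r" "r < 1"
  then have "r ^ k \<le> 1" by (intro power_le_one) auto
  then show "\<bar>c\<bar> * r ^ k \<le> \<bar>c\<bar>" using mult_left_mono[of "r ^ k" 1 "\<bar>c\<bar>"] by simp
qed

lemma subexp_add:
  assumes "subexp a" "subexp b"
  shows "subexp (\<lambda>k. a k + b k)"
  unfolding subexp_def
proof (intro allI impI)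
  fix r :: real assume r: "0 < r" "r < 1"
  obtain A B where AB: "\<And>k. \<bar>a k\<bar> * r ^ k \<le> A" "\<And>k. \<bar>b k\<bar> * r ^ k \<le> B"
    using subexpD[OF assms(1) r] subexpD[OF assms(2) r] by blast
  have "\<bar>a k + b k\<bar> * r ^ k \<le> A + B" for k
    using mult_right_mono[OF abs_triangle_ineq[of "a k" "b k"], of "r ^ k"] AB[of k] r
    by (simp add: distrib_right)
  then show "\<exists>C. \<forall>k. \<bar>a k + b k\<bar> * r ^ k \<le> C" by blast
qed

lemma subexp_linear: "subexp (\<lambda>k. real (Suc k))"
  unfolding subexp_def
proof (intro allI impI)
  fix r :: real assume r: "0 < r" "r < 1"
  have "(\<lambda>n. real n * r ^ n) \<longlonglongrightarrow> 0"
    using r by (intro powser_times_n_limit_0) auto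
  then have "Bseq (\<lambda>n. real n * r ^ n)" by (intro convergent_imp_Bseq convergentI)
  then obtain C where C: "\<And>n. \<bar>real n * r ^ n\<bar> \<le> C"
    unfolding Bseq_def real_norm_def by blast
  have "\<bar>real (Suc k)\<bar> * r ^ k \<le> C + 1" for k
    using C[of k] power_le_one[of r k] r by (simp add: algebra_simps)
  then show "\<exists>C. \<forall>k. \<bar>real (Suc k)\<bar> * r ^ k \<le> C" by blast
qed

lemma subexp_summable:
  assumes "subexp a" "0 \<le> r" "r < 1"
  shows "summable (\<lambda>k. \<bar>a k\<bar> * r ^ k)"
proof (cases "r = 0")
  case True
  then show ?thesis using summable_finite[of "{0}" "\<lambda>k. \<bar>a k\<bar> * r ^ k"] by auto
next
  case False
  with assms have r: "0 < r" by simp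
  define s where "s = sqrt r"
  have s: "0 < s" "s < 1" "r = s * s" using r assms(3) by (auto simp: s_def)
  obtain A where A: "\<And>k. \<bar>a k\<bar> * s ^ k \<le> A" using subexpD[OF assms(1) s(1,2)] by blast
  show ?thesis
  proof (rule summable_comparison_test'[where g = "\<lambda>k. A * s ^ k" and N = 0])
    show "summable (\<lambda>k. A * s ^ k)" using s by (intro summable_mult summable_geometric) auto
    show "norm (\<bar>a k\<bar> * r ^ k) \<le> A * s ^ k" for k
      using mult_right_mono[OF A[of k], of "s ^ k"] s(1)
      by (simp add: s(3) power_mult_distrib abs_mult mult.assoc)
  qed
qed

section \<open>Series of solid harmonics\<close>

text \<open>A sequence of solid harmonics that is subexponential on the closed unit ball. The degrees may
  lag behind the index by a fixed number \<open>m\<close>, so that the derivatives of the sequence are again of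
  this kind.\<close>

definition harmonic_sequence :: "nat \<Rightarrow> (nat \<Rightarrow> 'a::euclidean_space \<Rightarrow> real) \<Rightarrow> bool" where
  "harmonic_sequence m h \<longleftrightarrow> (\<forall>k. \<exists>n. solid_harmonic n (h k) \<and> n \<le> k \<and> k \<le> n + m) \<and>
     (\<forall>r. 0 < r \<longrightarrow> r < 1 \<longrightarrow> (\<exists>C. \<forall>k x. norm x \<le> 1 \<longrightarrow> \<bar>h k x\<bar> * r ^ k \<le> C))"

lemma direction_sphere: "norm (direction x) = 1"
proof -
  obtain b :: 'a where "b \<in> Basis" using nonempty_Basis by blast
  then have "\<exists>u::'a. norm u = 1" by (intro exI[of _ b]) simp
  then have "norm (SOME u::'a. norm u = 1) = 1" by (rule someI_ex)
  then show ?thesis by (simp add: direction_def norm_sgn)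
qed

lemma direction_scale: "norm x *\<^sub>R direction x = x"
  by (simp add: direction_def flip: sgn_scale_self)

lemma solid_harmonic_direction: "solid_harmonic k p \<Longrightarrow> p x = norm x ^ k * p (direction x)"
  using solid_harmonicD(2)[of k p "norm x" "direction x"] by (simp add: direction_scale)

lemma solid_harmonic_bound:
  assumes "solid_harmonic k p" "\<And>x. norm x = 1 \<Longrightarrow> \<bar>p x\<bar> \<le> B"
  shows "\<bar>p x\<bar> \<le> norm x ^ k * B"
  using assms(2)[OF direction_sphere, of x]
  by (subst solid_harmonic_direction[OF assms(1)]) (simp add: abs_mult mult_left_mono)

lemma harmonic_sequence_solid:
  assumes "\<And>k. solid_harmonic k (h k)" "subexp M" "\<And>k x. norm x = 1 \<Longrightarrow> \<bar>h k x\<bar> \<le> M k"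
  shows "harmonic_sequence 0 h"
  unfolding harmonic_sequence_def
proof (intro conjI allI impI)
  fix k show "\<exists>n. solid_harmonic n (h k) \<and> n \<le> k \<and> k \<le> n + 0" using assms(1) by auto
next
  fix r :: real assume r: "0 < r" "r < 1"
  obtain C where C: "\<And>k. \<bar>M k\<bar> * r ^ k \<le> C" using subexpD[OF assms(2) r] by blast
  have "\<bar>h k x\<bar> * r ^ k \<le> C" if "norm x \<le> 1" for k x
  proof -
    have "\<bar>h k x\<bar> \<le> norm x ^ k * M k" by (rule solid_harmonic_bound[OF assms(1,3)])
    also have "\<dots> \<le> norm x ^ k * \<bar>M k\<bar>" by (intro mult_left_mono) auto
    also have "\<dots> \<le> 1 * \<bar>M k\<bar>" using that by (intro mult_right_mono power_le_one) auto
    finally have "\<bar>h k x\<bar> * r ^ k \<le> \<bar>M k\<bar> * r ^ k" using r by (intro mult_right_mono) auto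
    then show ?thesis using C[of k] by (rule order_trans)
  qed
  then show "\<exists>C. \<forall>k x. norm x \<le> 1 \<longrightarrow> \<bar>h k x\<bar> * r ^ k \<le> C" by blast
qed

lemma harmonic_sequence_poly: "harmonic_sequence m h \<Longrightarrow> real_polynomial_function (h k)"
  unfolding harmonic_sequence_def using solid_harmonicD(1) by blast

text \<open>Write \<open>r = s\<^sup>2\<close>. One factor \<open>s\<^sup>k\<close> absorbs the growth of the sequence, the other one the constant
  \<open>(1 + \<delta>)\<^sup>k\<close> of the derivative estimate, where \<open>1 + \<delta> = 1 / s\<close>.\<close>

lemma harmonic_sequence_dir_deriv:
  fixes h :: "nat \<Rightarrow> 'a::euclidean_space \<Rightarrow> real"
  assumes h: "harmonic_sequence m h"
  shows "harmonic_sequence (Suc m) (\<lambda>k. dir_deriv v (h k))"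
  unfolding harmonic_sequence_def
proof (intro conjI allI impI)
  fix k
  obtain n where n: "solid_harmonic n (h k)" "n \<le> k" "k \<le> n + m"
    using h unfolding harmonic_sequence_def by blast
  then show "\<exists>n. solid_harmonic n (dir_deriv v (h k)) \<and> n \<le> k \<and> k \<le> n + Suc m"
    by (intro exI[of _ "n - 1"]) (use solid_harmonic_dir_deriv[OF n(1)] in auto)
next
  fix r :: real assume r: "0 < r" "r < 1"
  define s where "s = sqrt r"
  have s: "0 < s" "s < 1" "r = s * s" using r by (auto simp: s_def)
  have \<delta>: "0 < 1 / s - 1" using s by simp
  obtain K where K: "K > 0" "\<And>n (p :: 'a \<Rightarrow> real) x. solid_harmonic n p \<Longrightarrow> norm x \<le> 1 \<Longrightarrow>
       \<bar>dir_deriv v p x\<bar> \<le> K * (1 + (1 / s - 1)) ^ n * (\<integral>x. \<bar>p x\<bar> \<partial>surface_measure) * norm v"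
    using solid_harmonic_estimate[OF \<delta>, where 'a = 'a] by metis
  obtain C where C: "\<And>k x. norm x \<le> 1 \<Longrightarrow> \<bar>h k x\<bar> * s ^ k \<le> C"
    using h s unfolding harmonic_sequence_def by blast
  let ?S = "measure (surface_measure :: 'a measure) (sphere 0 1)"
  have "\<bar>dir_deriv v (h k) x\<bar> * r ^ k \<le> K * (C * ?S) * norm v" if x: "norm x \<le> 1" for k x
  proof -
    obtain n where n: "solid_harmonic n (h k)" "n \<le> k"
      using h unfolding harmonic_sequence_def by blast
    have "(\<integral>x. \<bar>h k x\<bar> \<partial>surface_measure) \<le> (\<integral>x. C / s ^ k \<partial>(surface_measure :: 'a measure))"
    proof (rule integral_mono)
      show "integrable surface_measure (\<lambda>x. \<bar>h k x\<bar>)"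
        by (intro surface_integrable continuous_intros solid_harmonic_sphere_continuous[OF n(1)])
      show "\<bar>h k x\<bar> \<le> C / s ^ k" if "x \<in> space surface_measure" for x
        using C[of x k] that s by (simp add: field_simps)
    qed auto
    also have "\<dots> = C * ?S / s ^ k" by simp
    finally have I: "(\<integral>x. \<bar>h k x\<bar> \<partial>surface_measure) \<le> C * ?S / s ^ k" .
    have I0: "0 \<le> (\<integral>x. \<bar>h k x\<bar> \<partial>surface_measure)" by (intro Bochner_Integration.integral_nonneg) auto
    have "\<bar>dir_deriv v (h k) x\<bar> \<le> K * (1 / s) ^ n * (\<integral>x. \<bar>h k x\<bar> \<partial>surface_measure) * norm v"
      using K(2)[OF n(1) x] by simp
    also have "\<dots> \<le> K * (1 / s) ^ k * (C * ?S / s ^ k) * norm v"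
      using s n(2) K(1) I I0
      by (intro mult_right_mono mult_mono mult_left_mono power_increasing) auto
    finally have "\<bar>dir_deriv v (h k) x\<bar> * r ^ k \<le> K * (1 / s) ^ k * (C * ?S / s ^ k) * norm v * r ^ k"
      using r by (intro mult_right_mono) auto
    also have "\<dots> = K * (C * ?S) * norm v"
      using s by (simp add: power_divide power_mult_distrib)
    finally show ?thesis .
  qed
  then show "\<exists>C. \<forall>k x. norm x \<le> 1 \<longrightarrow> \<bar>dir_deriv v (h k) x\<bar> * r ^ k \<le> C" by blast
qed

lemma harmonic_sequence_summable_bound:
  assumes h: "harmonic_sequence m h" and \<rho>: "0 < \<rho>" "\<rho> < 1"
  obtains M where "summable M" "\<And>k x. norm x \<le> \<rho> \<Longrightarrow> \<bar>h k x\<bar> \<le> M k"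
proof -
  define s where "s = sqrt \<rho>"
  have s: "0 < s" "s < 1" "\<rho> = s * s" using \<rho> by (auto simp: s_def)
  obtain C where C: "\<And>k x. norm x \<le> 1 \<Longrightarrow> \<bar>h k x\<bar> * s ^ k \<le> C"
    using h s unfolding harmonic_sequence_def by blast
  define M where "M k = C / \<rho> ^ m * s ^ k" for k
  have "summable M" unfolding M_def using s by (intro summable_mult summable_geometric) auto
  moreover have "\<bar>h k x\<bar> \<le> M k" if x: "norm x \<le> \<rho>" for k x
  proof -
    obtain n where n: "solid_harmonic n (h k)" "n \<le> k" "k \<le> n + m"
      using h unfolding harmonic_sequence_def by blast
    have "\<bar>h k x\<bar> \<le> norm x ^ n * (C / s ^ k)"
      by (rule solid_harmonic_bound[OF n(1)]) (use C s in \<open>simp add: field_simps\<close>)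
    also have "\<dots> \<le> \<rho> ^ n * (C / s ^ k)"
      using x \<rho> s order_trans[OF _ C[of 0 k]] by (intro mult_right_mono power_mono divide_nonneg_pos) auto
    also have "\<dots> \<le> (\<rho> ^ k / \<rho> ^ m) * (C / s ^ k)"
    proof (rule mult_right_mono)
      have "\<rho> ^ (n + m) \<le> \<rho> ^ k" using n(3) \<rho> by (intro power_decreasing) auto
      then show "\<rho> ^ n \<le> \<rho> ^ k / \<rho> ^ m" using \<rho> by (simp add: power_add field_simps)
      show "0 \<le> C / s ^ k" using order_trans[OF _ C[of 0 k]] s by (intro divide_nonneg_pos) auto
    qed
    also have "\<dots> = M k" using s by (simp add: M_def power_mult_distrib)
    finally show ?thesis .
  qed
  ultimately show ?thesis using that by blast
qed

lemma harmonic_sequence_summable: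
  assumes h: "harmonic_sequence m h" and x: "norm x < 1"
  shows "summable (\<lambda>k. h k x)"
proof -
  obtain \<rho> where \<rho>: "norm x < \<rho>" "\<rho> < 1" using dense[OF x] by blast
  then have "0 < \<rho>" using norm_ge_zero[of x] by linarith
  then obtain M where M: "summable M" "\<And>k x. norm x \<le> \<rho> \<Longrightarrow> \<bar>h k x\<bar> \<le> M k"
    using harmonic_sequence_summable_bound[OF h _ \<rho>(2)] by metis
  show ?thesis by (rule summable_comparison_test'[OF M(1), of 0]) (use M(2)[of x] \<rho> in auto)
qed

text \<open>The sequences of derivatives are again of this kind, hence have summable bounds on smaller balls,
  and the series may be differentiated term by term.\<close>

lemma harmonic_sequence_has_derivative:
  fixes h :: "nat \<Rightarrow> 'a::euclidean_space \<Rightarrow> real"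
  assumes h: "harmonic_sequence m h" and x: "norm x < 1"
  shows "((\<lambda>x. \<Sum>k. h k x) has_derivative (\<lambda>v. \<Sum>k. dir_deriv v (h k) x)) (at x)"
proof -
  obtain \<rho> where \<rho>: "norm x < \<rho>" "\<rho> < 1" using dense[OF x] by blast
  then have \<rho>0: "0 < \<rho>" using norm_ge_zero[of x] by linarith
  have "\<exists>M. summable M \<and> (\<forall>k x. norm x \<le> \<rho> \<longrightarrow> \<bar>dir_deriv i (h k) x\<bar> \<le> M k)" for i
    using harmonic_sequence_summable_bound[OF harmonic_sequence_dir_deriv[OF h] \<rho>0 \<rho>(2)] by metis
  then obtain M where M: "\<And>i. summable (M i)" "\<And>i k x. norm x \<le> \<rho> \<Longrightarrow> \<bar>dir_deriv i (h k) x\<bar> \<le> M i k"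
    by metis
  define N where "N k = (\<Sum>i\<in>(Basis :: 'a set). M i k)" for k
  have N: "summable N" unfolding N_def by (intro summable_sum M)
  have bd: "\<bar>dir_deriv v (h k) y\<bar> \<le> N k * norm v" if "norm y \<le> \<rho>" for k y v
  proof -
    have "\<bar>dir_deriv v (h k) y\<bar> \<le> (\<Sum>i\<in>Basis. \<bar>(v \<bullet> i) * dir_deriv i (h k) y\<bar>)"
      unfolding dir_deriv_expand[OF harmonic_sequence_poly[OF h, of k], of v y, symmetric] by (rule sum_abs)
    also have "\<dots> \<le> (\<Sum>i\<in>Basis. norm v * M i k)"
      unfolding abs_mult using M(2)[OF that]
      by (intro sum_mono mult_mono Basis_le_norm) auto
    finally show ?thesis by (simp add: N_def sum_distrib_left mult.commute)
  qed
  have sm: "summable (\<lambda>k. dir_deriv v (h k) y)" if "norm y \<le> \<rho>" for v y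
    by (rule summable_comparison_test'[OF summable_mult2[OF N], of 0]) (use bd[OF that] in auto)
  have "\<exists>g. \<forall>y\<in>ball 0 \<rho>. (\<lambda>n. h n y) sums g y \<and>
      (g has_derivative (\<lambda>v. \<Sum>k. dir_deriv v (h k) y)) (at y within ball 0 \<rho>)"
  proof (rule has_derivative_series[where x = x and l = "\<Sum>k. h k x" and f = h
        and f' = "\<lambda>n y v. dir_deriv v (h n) y" and g' = "\<lambda>y v. \<Sum>k. dir_deriv v (h k) y"])
    show "(h n has_derivative (\<lambda>v. dir_deriv v (h n) y)) (at y within ball 0 \<rho>)" for n y
      by (rule has_derivative_at_withinI[OF poly_has_derivative[OF harmonic_sequence_poly[OF h]]])
    show "(\<lambda>n. h n x) sums (\<Sum>k. h k x)"
      using harmonic_sequence_summable[OF h x] by (rule summable_sums)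
    fix e :: real assume e: "0 < e"
    obtain n0 where n0: "\<And>n. n \<ge> n0 \<Longrightarrow> norm (\<Sum>i. N (i + n)) < e"
      using suminf_exist_split[OF e N] by blast
    show "\<forall>\<^sub>F n in sequentially. \<forall>y\<in>ball 0 \<rho>. \<forall>v.
        norm ((\<Sum>i<n. dir_deriv v (h i) y) - (\<Sum>k. dir_deriv v (h k) y)) \<le> e * norm v"
      unfolding eventually_sequentially
    proof (intro exI[of _ n0] allI impI ballI)
      fix n y v assume n: "n0 \<le> n" and y: "y \<in> ball (0::'a) \<rho>"
      have y': "norm y \<le> \<rho>" using y by simp
      have "(\<Sum>i<n. dir_deriv v (h i) y) - (\<Sum>k. dir_deriv v (h k) y) = - (\<Sum>i. dir_deriv v (h (i + n)) y)"
        using suminf_minus_initial_segment[OF sm[OF y', of v], of n] by simp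
      moreover have "norm (\<Sum>i. dir_deriv v (h (i + n)) y) \<le> (\<Sum>i. N (i + n) * norm v)"
      proof (rule norm_suminf_le)
        show "norm (dir_deriv v (h (i + n)) y) \<le> N (i + n) * norm v" for i
          using bd[OF y'] by simp
        show "summable (\<lambda>i. N (i + n) * norm v)"
          using N by (intro summable_mult2) (simp add: summable_iff_shift)
      qed
      moreover have "(\<Sum>i. N (i + n) * norm v) = (\<Sum>i. N (i + n)) * norm v"
        using N by (intro suminf_mult2[symmetric]) (simp add: summable_iff_shift)
      moreover have "\<dots> \<le> e * norm v" using n0[OF n] by (intro mult_right_mono) auto
      ultimately show "norm ((\<Sum>i<n. dir_deriv v (h i) y) - (\<Sum>k. dir_deriv v (h k) y)) \<le> e * norm v"
        by simp
    qed
  qed (use \<rho> in auto)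
  then obtain g where g: "\<And>y. y \<in> ball 0 \<rho> \<Longrightarrow> (\<lambda>n. h n y) sums g y"
    "\<And>y. y \<in> ball 0 \<rho> \<Longrightarrow> (g has_derivative (\<lambda>v. \<Sum>k. dir_deriv v (h k) y)) (at y within ball 0 \<rho>)"
    by blast
  have xb: "x \<in> ball 0 \<rho>" using \<rho> by simp
  have "(g has_derivative (\<lambda>v. \<Sum>k. dir_deriv v (h k) x)) (at x)"
    using g(2)[OF xb] at_within_open[OF xb open_ball] by simp
  then show ?thesis
    by (rule has_derivative_transform_within_open[OF _ open_ball xb]) (metis g(1) sums_unique)
qed

lemma harmonic_series:
  fixes h :: "nat \<Rightarrow> 'a::euclidean_space \<Rightarrow> real"
  assumes h: "harmonic_sequence m h"
  shows "harmonic_on (ball 0 1) (\<lambda>x. \<Sum>k. h k x)"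
proof (rule harmonic_onI[where D = "\<lambda>x v. \<Sum>k. dir_deriv v (h k) x" and
      H = "\<lambda>x v w. \<Sum>k. dir_deriv w (dir_deriv v (h k)) x"])
  note h1 = harmonic_sequence_dir_deriv[OF h]
  note h2 = harmonic_sequence_dir_deriv[OF h1]
  show "((\<lambda>x. \<Sum>k. h k x) has_derivative (\<lambda>v. \<Sum>k. dir_deriv v (h k) x)) (at x)"
    if "x \<in> ball 0 1" for x
    using harmonic_sequence_has_derivative[OF h] that by simp
  show "((\<lambda>x. \<Sum>k. dir_deriv v (h k) x) has_derivative (\<lambda>w. \<Sum>k. dir_deriv w (dir_deriv v (h k)) x)) (at x)"
    if "x \<in> ball 0 1" for x v
    using harmonic_sequence_has_derivative[OF h1] that by simp
  show "continuous_on (ball 0 1) (\<lambda>x. \<Sum>k. dir_deriv w (dir_deriv v (h k)) x)" for v w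
  proof (rule continuous_at_imp_continuous_on, rule ballI)
    fix x :: 'a assume "x \<in> ball 0 1"
    then show "isCont (\<lambda>x. \<Sum>k. dir_deriv w (dir_deriv v (h k)) x) x"
      using has_derivative_continuous[OF harmonic_sequence_has_derivative[OF h2]] by simp
  qed
  show "(\<Sum>i\<in>Basis. \<Sum>k. dir_deriv i (dir_deriv i (h k)) x) = 0" if "x \<in> ball 0 1" for x
  proof -
    have lap: "laplacian (h k) x = 0" for k
      using h solid_harmonicD(3) unfolding harmonic_sequence_def by blast
    have "(\<Sum>i\<in>Basis. \<Sum>k. dir_deriv i (dir_deriv i (h k)) x) = (\<Sum>k. \<Sum>i\<in>Basis. dir_deriv i (dir_deriv i (h k)) x)"
      using that harmonic_sequence_summable[OF h2] by (intro suminf_sum[symmetric]) auto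
    then show ?thesis using lap by (simp add: laplacian_def)
  qed
qed

section \<open>Expansion in spherical harmonics\<close>

locale harmonic_basis =
  fixes d :: "nat \<Rightarrow> nat" and Y :: "nat \<Rightarrow> nat \<Rightarrow> 'a::euclidean_space \<Rightarrow> real"
  assumes dim: "DIM('a) \<ge> 2" and basis: "spherical_harmonic_basis d Y"
begin

definition solid :: "nat \<Rightarrow> nat \<Rightarrow> 'a \<Rightarrow> real" where
  "solid k j = (SOME p. solid_harmonic k p \<and> (\<forall>x\<in>sphere 0 1. p x = Y k j x))"

lemma solid_properties:
  assumes j: "j \<in> {1..d k}"
  shows "solid_harmonic k (solid k j) \<and> (\<forall>x\<in>sphere 0 1. solid k j x = Y k j x)"
proof -
  have "(\<lambda>x. complex_of_real (Y k j x)) \<in> spherical_harmonics k"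
    using basis j unfolding spherical_harmonic_basis_def by blast
  then obtain p where p: "polynomial_function p" "\<forall>t x. p (t *\<^sub>R x) = t ^ k *\<^sub>R p x"
    "harmonic_on UNIV p" "\<forall>x\<in>sphere 0 1. complex_of_real (Y k j x) = p x"
    unfolding spherical_harmonics_def by blast
  have poly: "real_polynomial_function (\<lambda>x. Re (p x))"
    using p(1) bounded_linear_Re unfolding polynomial_function_def o_def by blast
  have harm: "harmonic_on UNIV (\<lambda>x. Re (p x))"
    by (rule harmonic_on_bounded_linear[OF bounded_linear_Re p(3)])
  have "solid_harmonic k (\<lambda>x. Re (p x))"
    using poly p(2) laplacian_harmonic_poly[OF poly harm] by (simp add: solid_harmonic_def)
  moreover have "\<forall>x\<in>sphere 0 1. Re (p x) = Y k j x"
  proof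
    fix x :: 'a assume "x \<in> sphere 0 1"
    with p(4) have "p x = complex_of_real (Y k j x)" by simp
    then show "Re (p x) = Y k j x" by simp
  qed
  ultimately show ?thesis
    unfolding solid_def by (intro someI[of "\<lambda>p. solid_harmonic k p \<and> (\<forall>x\<in>sphere 0 1. p x = Y k j x)"] conjI)
qed

lemmas solid_harmonic_solid = solid_properties[THEN conjunct1]

lemma solid_sphere: "j \<in> {1..d k} \<Longrightarrow> norm x = 1 \<Longrightarrow> solid k j x = Y k j x"
  using solid_properties by simp

lemma Y_continuous:
  assumes "j \<in> {1..d k}"
  shows "continuous_on (sphere 0 1) (Y k j)"
  by (rule continuous_on_eq[OF solid_harmonic_sphere_continuous[OF solid_harmonic_solid[OF assms]]])
     (simp add: solid_sphere[OF assms])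

lemma orthonormal:
  "i \<in> {1..d k} \<Longrightarrow> j \<in> {1..d k} \<Longrightarrow> (\<integral>x. Y k i x * Y k j x \<partial>surface_measure) = (if i = j then 1 else 0)"
  using basis unfolding spherical_harmonic_basis_def by blast

lemma surface_integral_cong:
  fixes f g :: "'a \<Rightarrow> 'b::{banach, second_countable_topology}"
  shows "(\<And>x. norm x = 1 \<Longrightarrow> f x = g x) \<Longrightarrow> (\<integral>x. f x \<partial>surface_measure) = (\<integral>x. g x \<partial>surface_measure)"
  by (intro Bochner_Integration.integral_cong) auto

lemma orthogonal_degrees:
  assumes "solid_harmonic l p" "j \<in> {1..d k}" "k \<noteq> l"
  shows "(\<integral>x. Y k j x * p x \<partial>surface_measure) = 0"
proof -
  have "(\<integral>x. Y k j x * p x \<partial>surface_measure) = (\<integral>x. solid k j x * p x \<partial>surface_measure)"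
    by (intro surface_integral_cong) (simp add: solid_sphere[OF assms(2)])
  also have "\<dots> = 0" by (rule solid_harmonic_orthogonal[OF solid_harmonic_solid[OF assms(2)] assms(1,3)])
  finally show ?thesis .
qed

definition sphere_coeff :: "('a \<Rightarrow> 'b::{banach, second_countable_topology}) \<Rightarrow> nat \<Rightarrow> nat \<Rightarrow> 'b" where
  "sphere_coeff \<phi> k j = (\<integral>x. Y k j x *\<^sub>R \<phi> x \<partial>surface_measure)"

lemma solid_harmonic_sphere_unique:
  assumes "solid_harmonic k p" "solid_harmonic k q" "\<And>x. norm x = 1 \<Longrightarrow> p x = q x"
  shows "p = q"
proof
  fix x show "p x = q x"
    using assms(3)[OF direction_sphere, of x]
    by (simp add: solid_harmonic_direction[OF assms(1), of x] solid_harmonic_direction[OF assms(2), of x])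
qed

lemma solid_harmonic_expand:
  assumes h: "solid_harmonic k h"
  shows "h x = (\<Sum>j=1..d k. sphere_coeff h k j * solid k j x)"
proof -
  have poly: "polynomial_function (\<lambda>x. complex_of_real (h x))"
    using polynomial_function_compose[of h complex_of_real] solid_harmonicD(1)[OF h]
      polynomial_function_bounded_linear[OF bounded_linear_of_real]
    by (simp add: real_polynomial_function_eq o_def)
  have "harmonic_on UNIV h"
    by (rule harmonic_on_poly[OF solid_harmonicD(1,3)[OF h]])
  then have "harmonic_on UNIV (\<lambda>x. complex_of_real (h x))"
    by (rule harmonic_on_bounded_linear[OF bounded_linear_of_real])
  then have u: "(\<lambda>x. complex_of_real (h x)) \<in> spherical_harmonics k"
    unfolding spherical_harmonics_def using poly solid_harmonicD(2)[OF h]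
    by (intro CollectI exI[of _ "\<lambda>x. complex_of_real (h x)"]) (auto simp: scaleR_conv_of_real)
  have "\<forall>u\<in>spherical_harmonics k. \<exists>a. \<forall>x\<in>sphere 0 1.
      u x = (\<Sum>j=1..d k. a j * complex_of_real (Y k j x))"
    using basis unfolding spherical_harmonic_basis_def by blast
  from bspec[OF this u] obtain a where a: "\<forall>x\<in>sphere 0 1. complex_of_real (h x) = (\<Sum>j=1..d k. a j * complex_of_real (Y k j x))"
    by (rule exE)
  define b where "b j = Re (a j)" for j
  have b: "h x = (\<Sum>j=1..d k. b j * Y k j x)" if "norm x = 1" for x
  proof -
    have "h x = Re (complex_of_real (h x))" by simp
    also have "\<dots> = (\<Sum>j=1..d k. b j * Y k j x)"
      using a that by (subst bspec[OF a]) (auto simp: b_def)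
    finally show ?thesis .
  qed
  have coeff: "sphere_coeff h k i = b i" if i: "i \<in> {1..d k}" for i
  proof -
    have "sphere_coeff h k i = (\<integral>x. (\<Sum>j=1..d k. b j * (Y k i x * Y k j x)) \<partial>surface_measure)"
      unfolding sphere_coeff_def
      by (intro surface_integral_cong) (simp add: b sum_distrib_left mult_ac)
    also have "\<dots> = (\<Sum>j=1..d k. \<integral>x. b j * (Y k i x * Y k j x) \<partial>surface_measure)"
      by (intro Bochner_Integration.integral_sum surface_integrable continuous_intros Y_continuous i) auto
    also have "\<dots> = (\<Sum>j=1..d k. b j * (if i = j then 1 else 0))"
      by (intro sum.cong refl) (simp add: orthonormal[OF i])
    also have "\<dots> = b i" using i by (simp add: if_distrib sum.delta' cong: if_cong)
    finally show ?thesis .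
  qed
  have "h = (\<lambda>x. \<Sum>j=1..d k. b j * solid k j x)"
  proof (rule solid_harmonic_sphere_unique[OF h])
    show "solid_harmonic k (\<lambda>x. \<Sum>j=1..d k. b j * solid k j x)"
      by (rule solid_harmonic_sum) (rule solid_harmonic_solid)
    show "h x = (\<Sum>j=1..d k. b j * solid k j x)" if "norm x = 1" for x
      using b[OF that] that by (simp add: solid_sphere)
  qed
  then show ?thesis using coeff by simp
qed

text \<open>The reproducing kernel \<open>\<Sum>\<^sub>j Y\<^sub>k\<^sub>j(x) Y\<^sub>k\<^sub>j\<close> is a solid harmonic whose mean over the sphere is
  controlled by its value at \<open>x\<close>; the general estimate for solid harmonics then bounds that value.\<close>

lemma kernel_diagonal_bound:
  fixes K \<delta> :: real
  assumes \<delta>: "0 < \<delta>" and K: "K > 0"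
    "\<And>(p :: 'a \<Rightarrow> real) x. solid_harmonic k p \<Longrightarrow> norm x \<le> 1 \<Longrightarrow>
       \<bar>p x\<bar> \<le> K * (1 + \<delta>) ^ k * (\<integral>x. \<bar>p x\<bar> \<partial>surface_measure)"
    and x: "norm x = 1"
  shows "(\<Sum>j=1..d k. (Y k j x)\<^sup>2) \<le> (K * (1 + \<delta>) ^ k)\<^sup>2 * measure (surface_measure :: 'a measure) (sphere 0 1)"
proof -
  define T where "T = K * (1 + \<delta>) ^ k"
  have T: "0 < T" using K(1) \<delta> by (simp add: T_def)
  define h where "h y = (\<Sum>j=1..d k. Y k j x * solid k j y)" for y
  define Z where "Z = (\<Sum>j=1..d k. (Y k j x)\<^sup>2)"
  let ?S = "measure (surface_measure :: 'a measure) (sphere 0 1)"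
  have h: "solid_harmonic k h" unfolding h_def by (rule solid_harmonic_sum) (rule solid_harmonic_solid)
  note hc = solid_harmonic_sphere_continuous[OF h]
  have hx: "h x = Z" using x by (simp add: h_def Z_def solid_sphere power2_eq_square)
  have h2: "(\<integral>y. h y * h y \<partial>surface_measure) = Z"
  proof -
    have "(\<integral>y. h y * h y \<partial>surface_measure) =
        (\<integral>y. (\<Sum>i=1..d k. \<Sum>j=1..d k. (Y k i x * Y k j x) * (Y k i y * Y k j y)) \<partial>surface_measure)"
      by (intro surface_integral_cong) (simp add: h_def solid_sphere sum_product mult_ac)
    also have "\<dots> = (\<Sum>i=1..d k. \<Sum>j=1..d k. \<integral>y. (Y k i x * Y k j x) * (Y k i y * Y k j y) \<partial>surface_measure)"
      by (subst Bochner_Integration.integral_sum, (intro surface_integrable continuous_intros Y_continuous; simp),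
          intro sum.cong refl Bochner_Integration.integral_sum surface_integrable continuous_intros Y_continuous; simp)
    also have "\<dots> = (\<Sum>i=1..d k. \<Sum>j=1..d k. (Y k i x * Y k j x) * (if i = j then 1 else 0))"
      by (intro sum.cong refl) (simp add: orthonormal)
    also have "\<dots> = (\<Sum>i=1..d k. Y k i x * Y k i x)"
      by (intro sum.cong refl) (simp add: if_distrib sum.delta' cong: if_cong)
    finally show ?thesis by (simp add: Z_def power2_eq_square)
  qed
  have "(\<integral>y. \<bar>h y\<bar> \<partial>surface_measure) \<le> (\<integral>y. ((1 / T) * (h y * h y) + T) / 2 \<partial>surface_measure)"
  proof (rule integral_mono)
    show "integrable surface_measure (\<lambda>y. \<bar>h y\<bar>)"
      "integrable surface_measure (\<lambda>y. ((1 / T) * (h y * h y) + T) / 2)"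
      by (intro surface_integrable continuous_intros hc; simp)+
    fix y
    \<comment> \<open>With this choice of the constant \<open>T\<close> half of \<open>Z\<close> can be absorbed below.\<close>
    have "0 \<le> (\<bar>h y\<bar> - T)\<^sup>2 / T" using T by simp
    then show "\<bar>h y\<bar> \<le> ((1 / T) * (h y * h y) + T) / 2"
      using T by (simp add: power2_eq_square field_simps)
  qed
  also have "\<dots> = ((1 / T) * Z + T * ?S) / 2"
  proof -
    have i: "integrable surface_measure (\<lambda>y. (1 / T) * (h y * h y))"
      by (intro surface_integrable continuous_intros hc)
    show ?thesis using Bochner_Integration.integral_add[OF i, of "\<lambda>_. T"] h2 by simp
  qed
  finally have mean: "(\<integral>y. \<bar>h y\<bar> \<partial>surface_measure) \<le> ((1 / T) * Z + T * ?S) / 2" .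
  have "Z \<le> T * (\<integral>y. \<bar>h y\<bar> \<partial>surface_measure)"
    using K(2)[OF h, of x] x hx by (simp add: T_def)
  also have "\<dots> \<le> T * (((1 / T) * Z + T * ?S) / 2)" using mean T by (intro mult_left_mono) auto
  finally have "Z \<le> T\<^sup>2 * ?S" using T by (simp add: field_simps power2_eq_square)
  then show ?thesis by (simp add: Z_def T_def)
qed

text \<open>One sequence that dominates both the dimensions and the values of the basis functions.\<close>

definition growth :: "nat \<Rightarrow> real" where
  "growth k = 1 + real (d k) + (SUP x\<in>sphere 0 1. \<Sum>j=1..d k. (Y k j x)\<^sup>2)"

lemma kernel_diagonal_bdd: "bdd_above ((\<lambda>x. \<Sum>j=1..d k. (Y k j x)\<^sup>2) ` sphere 0 1)"
  by (intro bounded_imp_bdd_above compact_imp_bounded compact_continuous_image continuous_intros Y_continuous) auto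

lemma kernel_diagonal_le_Sup: "norm x = 1 \<Longrightarrow>
    (\<Sum>j=1..d k. (Y k j x)\<^sup>2) \<le> (SUP x\<in>sphere 0 1. \<Sum>j=1..d k. (Y k j x)\<^sup>2)"
  by (rule cSUP_upper[OF _ kernel_diagonal_bdd]) simp

lemma kernel_Sup_nonneg: "0 \<le> (SUP x\<in>sphere 0 1. \<Sum>j=1..d k. (Y k j x)\<^sup>2)"
  using order_trans[OF sum_nonneg kernel_diagonal_le_Sup[OF direction_sphere]] by simp

lemma growth_ge_1: "1 \<le> growth k"
  using kernel_Sup_nonneg[of k] by (simp add: growth_def)

lemma degree_le_growth: "real (d k) \<le> growth k"
  using kernel_Sup_nonneg[of k] by (simp add: growth_def)

lemma Y_le_growth:
  assumes "j \<in> {1..d k}" "norm x = 1"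
  shows "\<bar>Y k j x\<bar> \<le> growth k"
proof -
  have "\<bar>Y k j x\<bar> \<le> 1 + (Y k j x)\<^sup>2"
    using zero_le_power2[of "\<bar>Y k j x\<bar> - 1"] by (simp add: power2_diff)
  also have "(Y k j x)\<^sup>2 \<le> (\<Sum>j=1..d k. (Y k j x)\<^sup>2)"
    using assms(1) by (intro member_le_sum) auto
  also have "\<dots> \<le> (SUP x\<in>sphere 0 1. \<Sum>j=1..d k. (Y k j x)\<^sup>2)" by (rule kernel_diagonal_le_Sup[OF assms(2)])
  finally show ?thesis by (simp add: growth_def)
qed

text \<open>The dimension is the trace of the reproducing kernel.\<close>

lemma dimension_le_kernel_Sup:
  "real (d k) \<le> (SUP x\<in>sphere 0 1. \<Sum>j=1..d k. (Y k j x)\<^sup>2) * measure (surface_measure :: 'a measure) (sphere 0 1)"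
proof -
  have "real (d k) = (\<Sum>j=1..d k. \<integral>x. Y k j x * Y k j x \<partial>surface_measure)"
    by (simp add: orthonormal)
  also have "\<dots> = (\<integral>x. (\<Sum>j=1..d k. Y k j x * Y k j x) \<partial>surface_measure)"
    by (intro Bochner_Integration.integral_sum[symmetric] surface_integrable continuous_intros Y_continuous)
  also have "\<dots> \<le> (\<integral>x. (SUP x\<in>sphere 0 1. \<Sum>j=1..d k. (Y k j x)\<^sup>2) \<partial>(surface_measure :: 'a measure))"
  proof (rule integral_mono)
    show "integrable surface_measure (\<lambda>x. \<Sum>j=1..d k. Y k j x * Y k j x)"
      by (intro surface_integrable continuous_intros Y_continuous)
    show "(\<Sum>j=1..d k. Y k j x * Y k j x) \<le> (SUP x\<in>sphere 0 1. \<Sum>j=1..d k. (Y k j x)\<^sup>2)"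
      if "x \<in> space surface_measure" for x
      using kernel_diagonal_le_Sup[of x k] that by (simp add: power2_eq_square)
  qed simp
  finally show ?thesis by (simp add: mult.commute)
qed

lemma subexp_growth: "subexp growth"
proof -
  let ?S = "measure (surface_measure :: 'a measure) (sphere 0 1)"
  define Z where "Z k = (SUP x\<in>sphere 0 1. \<Sum>j=1..d k. (Y k j x)\<^sup>2)" for k
  have Z: "subexp Z" unfolding subexp_def
  proof (intro allI impI)
    fix r :: real assume r: "0 < r" "r < 1"
    define s where "s = sqrt r"
    have s: "0 < s" "s < 1" "r = s * s" using r by (auto simp: s_def)
    have \<delta>: "0 < 1 / s - 1" using s by simp
    obtain K where K: "K > 0" "\<And>k (p :: 'a \<Rightarrow> real) x. solid_harmonic k p \<Longrightarrow> norm x \<le> 1 \<Longrightarrow>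
         \<bar>p x\<bar> \<le> K * (1 + (1 / s - 1)) ^ k * (\<integral>x. \<bar>p x\<bar> \<partial>surface_measure)"
      using solid_harmonic_estimate[OF \<delta>, where 'a = 'a] by metis
    have "\<bar>Z k\<bar> * r ^ k \<le> K\<^sup>2 * ?S" for k
    proof -
      have "Z k \<le> (K * (1 / s) ^ k)\<^sup>2 * ?S"
        unfolding Z_def
      proof (rule cSUP_least)
        show "sphere (0::'a) 1 \<noteq> {}" using direction_sphere by auto
        show "(\<Sum>j=1..d k. (Y k j x)\<^sup>2) \<le> (K * (1 / s) ^ k)\<^sup>2 * ?S" if "x \<in> sphere 0 1" for x
          using kernel_diagonal_bound[OF \<delta> K(1) K(2), of k x] that by simp
      qed
      then have "Z k * r ^ k \<le> ((K * (1 / s) ^ k)\<^sup>2 * ?S) * r ^ k" using r by (intro mult_right_mono) auto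
      also have "\<dots> = K\<^sup>2 * ?S"
        using s by (simp add: power_mult_distrib power_divide power2_eq_square)
      finally show ?thesis using kernel_Sup_nonneg[of k] by (simp add: Z_def)
    qed
    then show "\<exists>C. \<forall>k. \<bar>Z k\<bar> * r ^ k \<le> C" by blast
  qed
  have "subexp (\<lambda>k. 1 + Z k * ?S + Z k)"
    by (intro subexp_add subexp_mult subexp_const Z)
  then show ?thesis
  proof (rule subexp_mono)
    fix k
    have "0 \<le> growth k" using growth_ge_1[of k] by linarith
    moreover have "growth k \<le> 1 + Z k * ?S + Z k"
      using dimension_le_kernel_Sup[of k] by (simp add: growth_def Z_def)
    ultimately show "\<bar>growth k\<bar> \<le> \<bar>1 + Z k * ?S + Z k\<bar>" by linarith
  qed
qed

lemma solid_le_growth: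
  assumes "j \<in> {1..d k}"
  shows "\<bar>solid k j x\<bar> \<le> norm x ^ k * growth k"
  by (rule solid_harmonic_bound[OF solid_harmonic_solid[OF assms]])
     (simp add: solid_sphere[OF assms] Y_le_growth[OF assms])

lemma surface_integrable_mult:
  fixes \<phi> :: "'a \<Rightarrow> 'b::{banach, second_countable_topology}"
  assumes "continuous_on (sphere 0 1) u" and \<phi>: "integrable surface_measure \<phi>"
  shows "integrable surface_measure (\<lambda>x. u x *\<^sub>R \<phi> x)"
proof -
  have "bounded (u ` sphere 0 1)"
    by (intro compact_imp_bounded compact_continuous_image assms) auto
  then obtain B where B: "\<And>x. x \<in> sphere 0 1 \<Longrightarrow> norm (u x) \<le> B" unfolding bounded_iff by blast
  note [measurable] = surface_measurable[OF assms(1)] borel_measurable_integrable[OF \<phi>]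
  show ?thesis
  proof (rule Bochner_Integration.integrable_bound)
    show "integrable surface_measure (\<lambda>x. B * norm (\<phi> x))" using \<phi> by simp
    show "AE x in surface_measure. norm (u x *\<^sub>R \<phi> x) \<le> norm (B * norm (\<phi> x))"
      using B by (intro AE_I2) (auto simp: abs_mult intro!: mult_right_mono intro: order_trans[OF _ abs_ge_self])
  qed measurable
qed

lemma sphere_coeff_bound:
  fixes \<phi> :: "'a \<Rightarrow> 'b::{banach, second_countable_topology}"
  assumes j: "j \<in> {1..d k}" and \<phi>: "integrable surface_measure \<phi>"
  shows "norm (sphere_coeff \<phi> k j) \<le> growth k * (\<integral>x. norm (\<phi> x) \<partial>surface_measure)"
proof -
  have "norm (sphere_coeff \<phi> k j) \<le> (\<integral>x. norm (Y k j x *\<^sub>R \<phi> x) \<partial>surface_measure)"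
    unfolding sphere_coeff_def by (rule integral_norm_bound)
  also have "\<dots> \<le> (\<integral>x. growth k * norm (\<phi> x) \<partial>surface_measure)"
  proof (rule integral_mono)
    show "integrable surface_measure (\<lambda>x. norm (Y k j x *\<^sub>R \<phi> x))"
      by (intro integrable_norm surface_integrable_mult Y_continuous j \<phi>)
    show "norm (Y k j x *\<^sub>R \<phi> x) \<le> growth k * norm (\<phi> x)" if "x \<in> space surface_measure" for x
      using Y_le_growth[OF j, of x] that by (simp add: mult_right_mono)
  qed (use \<phi> in simp)
  finally show ?thesis by simp
qed

lemma sphere_coeff_add:
  fixes \<phi> \<psi> :: "'a \<Rightarrow> 'b::{banach, second_countable_topology}"
  assumes "j \<in> {1..d k}" "integrable surface_measure \<phi>" "integrable surface_measure \<psi>"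
  shows "sphere_coeff (\<lambda>x. \<phi> x + \<psi> x) k j = sphere_coeff \<phi> k j + sphere_coeff \<psi> k j"
  unfolding sphere_coeff_def scaleR_add_right
  by (intro Bochner_Integration.integral_add surface_integrable_mult Y_continuous assms)

lemma sphere_coeff_diff:
  fixes \<phi> \<psi> :: "'a \<Rightarrow> 'b::{banach, second_countable_topology}"
  assumes "j \<in> {1..d k}" "integrable surface_measure \<phi>" "integrable surface_measure \<psi>"
  shows "sphere_coeff (\<lambda>x. \<phi> x - \<psi> x) k j = sphere_coeff \<phi> k j - sphere_coeff \<psi> k j"
  unfolding sphere_coeff_def scaleR_diff_right
  by (intro Bochner_Integration.integral_diff surface_integrable_mult Y_continuous assms)

lemma harmonic_span_expansion:
  assumes "harmonic_span w"
  shows "continuous_on UNIV w \<and> harmonic_on UNIV w \<and>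
    (\<forall>x. (\<lambda>k. \<Sum>j=1..d k. sphere_coeff w k j * solid k j x) sums w x)"
  using assms
proof induction
  case (solid l p)
  note p = solid_harmonicD[OF solid]
  have 0: "(\<Sum>j=1..d k. sphere_coeff p k j * solid k j x) = 0" if "k \<noteq> l" for k x
    by (rule sum.neutral) (simp add: sphere_coeff_def orthogonal_degrees[OF solid _ that])
  have "(\<lambda>k. \<Sum>j=1..d k. sphere_coeff p k j * solid k j x) sums p x" for x
    using sums_finite[of "{l}" "\<lambda>k. \<Sum>j=1..d k. sphere_coeff p k j * solid k j x"] 0
    unfolding solid_harmonic_expand[OF solid, of x] by simp
  then show ?case
    using poly_continuous[OF p(1)] harmonic_on_poly[OF p(1,3)] by blast
next
  case (add p q)
  have ip: "integrable surface_measure p" "integrable surface_measure q"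
    using add.IH continuous_on_subset by (blast intro: surface_integrable)+
  have eq: "(\<Sum>j=1..d k. sphere_coeff (\<lambda>x. p x + q x) k j * solid k j x) =
      (\<Sum>j=1..d k. sphere_coeff p k j * solid k j x) + (\<Sum>j=1..d k. sphere_coeff q k j * solid k j x)" for k x
    unfolding sum.distrib[symmetric]
    by (intro sum.cong refl) (simp add: sphere_coeff_add[OF _ ip] distrib_right)
  show ?case
    unfolding eq using add.IH by (intro conjI allI sums_add continuous_on_add harmonic_on_add) auto
qed

lemma expansion_term_bound:
  assumes b: "\<And>j. j \<in> {1..d k} \<Longrightarrow> cmod (b j) \<le> \<bar>\<beta>\<bar>"
  shows "cmod (\<Sum>j=1..d k. b j * of_real (solid k j x)) \<le> \<bar>\<beta> * (growth k * growth k)\<bar> * norm x ^ k"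
proof -
  have A0: "0 \<le> growth k" using growth_ge_1[of k] by linarith
  have "cmod (\<Sum>j=1..d k. b j * of_real (solid k j x)) \<le> (\<Sum>j=1..d k. cmod (b j * of_real (solid k j x)))"
    by (rule norm_sum)
  also have "\<dots> \<le> (\<Sum>j=1..d k. \<bar>\<beta>\<bar> * (norm x ^ k * growth k))"
    unfolding norm_mult norm_of_real using A0 by (intro sum_mono mult_mono b solid_le_growth) auto
  also have "\<dots> = real (d k) * (\<bar>\<beta>\<bar> * (norm x ^ k * growth k))" by simp
  also have "\<dots> \<le> growth k * (\<bar>\<beta>\<bar> * (norm x ^ k * growth k))"
    using A0 by (intro mult_right_mono degree_le_growth) auto
  finally show ?thesis using A0 by (simp add: abs_mult mult_ac)
qed

lemma expansion_bound_summable: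
  assumes "subexp \<beta>" "norm x < 1"
  shows "summable (\<lambda>k. \<bar>\<beta> k * (growth k * growth k)\<bar> * norm x ^ k)"
  by (intro subexp_summable subexp_mult assms subexp_growth norm_ge_zero)

lemma real_expansion_term_bound:
  assumes "\<And>j. j \<in> {1..d k} \<Longrightarrow> \<bar>b j\<bar> \<le> \<bar>\<beta>\<bar>"
  shows "\<bar>\<Sum>j=1..d k. b j * solid k j x\<bar> \<le> \<bar>\<beta> * (growth k * growth k)\<bar> * norm x ^ k"
  using expansion_term_bound[of k "\<lambda>j. complex_of_real (b j)" \<beta> x] assms
  by (simp flip: of_real_mult of_real_sum)

text \<open>On the sphere of radius \<open>r\<close> the function is uniformly close to some harmonic polynomial; by the
  maximum principle they are also close inside, and so are their expansions, because the
  coefficients are integrals over the sphere.\<close>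

lemma real_valued_expansion:
  fixes f :: "'a \<Rightarrow> real"
  assumes f: "harmonic_on (ball 0 1) f" and r: "0 < r" "r < 1" and x: "norm x < 1"
  shows "(\<lambda>k. \<Sum>j=1..d k. sphere_coeff (\<lambda>y. f (r *\<^sub>R y)) k j * solid k j x) sums f (r *\<^sub>R x)"
proof -
  define \<phi> where "\<phi> y = f (r *\<^sub>R y)" for y
  have \<phi>_harm: "harmonic_on (ball 0 (1 / r)) \<phi>"
    unfolding \<phi>_def by (rule harmonic_on_scale[OF f r(1)])
  have "1 < 1 / r" using r by simp
  then have sub: "cball 0 1 \<subseteq> ball (0::'a) (1 / r)" by auto
  have \<phi>_cont: "continuous_on (cball 0 1) \<phi>"
    using continuous_on_subset[OF harmonic_on_continuous[OF \<phi>_harm] sub] .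
  have \<phi>_cont': "continuous_on (sphere 0 1) \<phi>"
    by (rule continuous_on_subset[OF \<phi>_cont]) auto
  have \<phi>_int: "integrable surface_measure \<phi>" by (rule surface_integrable[OF \<phi>_cont'])
  let ?S = "measure (surface_measure :: 'a measure) (sphere 0 1)"
  define I where "I = (\<integral>y. \<bar>\<phi> y\<bar> \<partial>surface_measure)"
  let ?t = "\<lambda>k. \<Sum>j=1..d k. sphere_coeff \<phi> k j * solid k j x"
  have g0: "0 \<le> growth k" for k using growth_ge_1[of k] by linarith
  have term_bound: "\<bar>\<Sum>j=1..d k. sphere_coeff \<psi> k j * solid k j x\<bar> \<le>
      \<bar>(growth k * B) * (growth k * growth k)\<bar> * norm x ^ k"
    if "integrable surface_measure \<psi>" "(\<integral>y. \<bar>\<psi> y\<bar> \<partial>surface_measure) \<le> B" for \<psi> :: "'a \<Rightarrow> real" and B k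
  proof (rule real_expansion_term_bound)
    fix j assume "j \<in> {1..d k}"
    then have "\<bar>sphere_coeff \<psi> k j\<bar> \<le> growth k * (\<integral>y. \<bar>\<psi> y\<bar> \<partial>surface_measure)"
      using sphere_coeff_bound[OF _ that(1)] by simp
    also have "\<dots> \<le> growth k * B" using g0 that(2) by (intro mult_left_mono)
    also have "\<dots> \<le> \<bar>growth k * B\<bar>" by simp
    finally show "\<bar>sphere_coeff \<psi> k j\<bar> \<le> \<bar>growth k * B\<bar>" .
  qed
  have gs: "summable (\<lambda>k. \<bar>(growth k * B) * (growth k * growth k)\<bar> * norm x ^ k)" for B
    by (intro expansion_bound_summable subexp_mult subexp_growth subexp_const x)
  have sum_t: "summable ?t"
    by (rule summable_comparison_test'[OF gs[of I], of 0]) (use term_bound[OF \<phi>_int, of I] in \<open>simp add: I_def\<close>)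
  define Q where "Q = (\<Sum>k. \<bar>(growth k * ?S) * (growth k * growth k)\<bar> * norm x ^ k)"
  have Q0: "0 \<le> Q" unfolding Q_def by (intro suminf_nonneg gs) auto
  have close: "\<bar>(\<Sum>k. ?t k) - \<phi> x\<bar> \<le> e * (Q + 1)" if e: "0 < e" for e
  proof -
    obtain w where w: "harmonic_span w" "\<And>y. y \<in> sphere 0 1 \<Longrightarrow> \<bar>\<phi> y - w y\<bar> < e"
      by (rule harmonic_span_dense[OF dim \<phi>_cont' e]) blast
    have wc: "continuous_on UNIV w" and wh: "harmonic_on UNIV w"
      and ws: "(\<lambda>k. \<Sum>j=1..d k. sphere_coeff w k j * solid k j x) sums w x"
      using harmonic_span_expansion[OF w(1)] by auto
    have w_int: "integrable surface_measure w"
      by (intro surface_integrable continuous_on_subset[OF wc]) auto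
    have "harmonic_on (ball 0 1) (\<lambda>y. \<phi> y - w y)"
      by (intro harmonic_on_diff harmonic_on_subset[OF \<phi>_harm] harmonic_on_subset[OF wh])
         (use sub ball_subset_cball in blast)+
    moreover have "continuous_on (cball 0 1) (\<lambda>y. \<phi> y - w y)"
      using continuous_on_subset[OF wc subset_UNIV] by (intro continuous_on_diff \<phi>_cont)
    ultimately have inside: "\<bar>\<phi> x - w x\<bar> \<le> e"
      by (rule maximum_principle[where u = "\<lambda>y. \<phi> y - w y"]) (use x less_imp_le[OF w(2)] in auto)
    have "(\<integral>y. \<bar>\<phi> y - w y\<bar> \<partial>surface_measure) \<le> (\<integral>y. e \<partial>(surface_measure :: 'a measure))"
      using \<phi>_int w_int w(2) by (intro integral_mono) (auto intro: less_imp_le)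
    then have L1: "(\<integral>y. \<bar>\<phi> y - w y\<bar> \<partial>surface_measure) \<le> ?S * e" by simp
    have diff_int: "integrable surface_measure (\<lambda>y. \<phi> y - w y)" using \<phi>_int w_int by simp
    have "(\<lambda>k. ?t k - (\<Sum>j=1..d k. sphere_coeff w k j * solid k j x)) sums ((\<Sum>k. ?t k) - w x)"
      by (intro sums_diff summable_sums[OF sum_t] ws)
    moreover have "?t k - (\<Sum>j=1..d k. sphere_coeff w k j * solid k j x) =
        (\<Sum>j=1..d k. sphere_coeff (\<lambda>y. \<phi> y - w y) k j * solid k j x)" for k
      unfolding sum_subtractf[symmetric]
      by (intro sum.cong refl) (simp add: sphere_coeff_diff[OF _ \<phi>_int w_int] left_diff_distrib)
    ultimately have ds: "(\<lambda>k. \<Sum>j=1..d k. sphere_coeff (\<lambda>y. \<phi> y - w y) k j * solid k j x) sums ((\<Sum>k. ?t k) - w x)"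
      by simp
    have "\<bar>(\<Sum>k. ?t k) - w x\<bar> \<le> (\<Sum>k. \<bar>(growth k * (?S * e)) * (growth k * growth k)\<bar> * norm x ^ k)"
      unfolding sums_unique[OF ds]
      by (rule norm_suminf_le[where 'a = real, simplified real_norm_def, OF term_bound[OF diff_int L1] gs])
    also have "\<dots> = (\<Sum>k. e * (\<bar>(growth k * ?S) * (growth k * growth k)\<bar> * norm x ^ k))"
      using e by (simp add: abs_mult mult_ac)
    also have "\<dots> = e * Q" unfolding Q_def by (rule suminf_mult[OF gs])
    finally show ?thesis using inside by (simp add: distrib_left)
  qed
  have "(\<Sum>k. ?t k) = \<phi> x"
  proof (rule ccontr)
    assume "(\<Sum>k. ?t k) \<noteq> \<phi> x"
    then have pos: "0 < \<bar>(\<Sum>k. ?t k) - \<phi> x\<bar>" by simp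
    define e where "e = \<bar>(\<Sum>k. ?t k) - \<phi> x\<bar> / 2 / (Q + 1)"
    have "0 < e" using pos Q0 by (simp add: e_def)
    moreover have "e * (Q + 1) = \<bar>(\<Sum>k. ?t k) - \<phi> x\<bar> / 2"
      using Q0 by (intro nonzero_eq_divide_eq[THEN iffD1, OF _ e_def]) simp
    ultimately have "\<bar>(\<Sum>k. ?t k) - \<phi> x\<bar> \<le> \<bar>(\<Sum>k. ?t k) - \<phi> x\<bar> / 2" using close[of e] by simp
    then show False using pos by simp
  qed
  then show ?thesis using summable_sums[OF sum_t] by (simp add: \<phi>_def[abs_def])
qed

lemma power_series_zero:
  fixes a :: "nat \<Rightarrow> real"
  assumes s: "0 < s" and z: "\<And>t. \<bar>t\<bar> < s \<Longrightarrow> (\<lambda>k. a k * t ^ k) sums 0"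
  shows "a n = 0"
proof (induction n rule: less_induct)
  case (less n)
  have sums: "(\<lambda>k. a (k + n) * t ^ k) sums 0" if t: "t \<noteq> 0" "norm t < s" for t
  proof -
    have "(\<Sum>i<n. a i * t ^ i) = 0" using less.IH by simp
    moreover have "(\<lambda>k. a k * t ^ k) sums 0" using z t(2) by simp
    ultimately have "(\<lambda>k. a (k + n) * t ^ (k + n)) sums 0"
      using sums_split_initial_segment[of "\<lambda>k. a k * t ^ k" 0 n] by simp
    from sums_divide[OF this, of "t ^ n"] show ?thesis using t(1) by (simp add: power_add)
  qed
  have "((\<lambda>t. 0) \<longlongrightarrow> a (0 + n)) (at (0::real))"
    using powser_limit_0_strong[OF s sums] by simp
  then have "a (0 + n) = 0" by (metis LIM_const_eq)
  then show ?case by simp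
qed

text \<open>Along a ray the series is a power series in the radius, whose coefficients all vanish if its sum
  does; then the orthonormality of the basis separates the terms of equal order.\<close>

lemma real_expansion_unique:
  fixes b :: "nat \<Rightarrow> nat \<Rightarrow> real"
  assumes \<rho>: "0 < (\<rho>::real)" and z: "\<And>x. norm x < \<rho> \<Longrightarrow> (\<lambda>k. \<Sum>j=1..d k. b k j * solid k j x) sums 0"
    and j: "j \<in> {1..d k}"
  shows "b k j = 0"
proof -
  have zero: "(\<Sum>j=1..d k. b k j * Y k j x) = 0" if x: "norm x = 1" for x k
  proof (rule power_series_zero[OF \<rho>, where a = "\<lambda>k. \<Sum>j=1..d k. b k j * Y k j x"])
    fix t :: real assume "\<bar>t\<bar> < \<rho>"
    then have "(\<lambda>k. \<Sum>j=1..d k. b k j * solid k j (t *\<^sub>R x)) sums 0" using x by (intro z) simp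
    moreover have "(\<Sum>j=1..d k. b k j * solid k j (t *\<^sub>R x)) = (\<Sum>j=1..d k. b k j * Y k j x) * t ^ k" for k
      unfolding sum_distrib_right
      by (intro sum.cong refl) (simp add: solid_harmonicD(2)[OF solid_harmonic_solid] solid_sphere[OF _ x])
    ultimately show "(\<lambda>k. (\<Sum>j=1..d k. b k j * Y k j x) * t ^ k) sums 0" by simp
  qed
  have "0 = (\<integral>x. Y k j x * (\<Sum>i=1..d k. b k i * Y k i x) \<partial>surface_measure)"
    using surface_integral_cong[of "\<lambda>x. Y k j x * (\<Sum>i=1..d k. b k i * Y k i x)" "\<lambda>_. 0"] zero by simp
  also have "\<dots> = (\<integral>x. (\<Sum>i=1..d k. b k i * (Y k j x * Y k i x)) \<partial>surface_measure)"
    by (simp add: sum_distrib_left mult_ac)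
  also have "\<dots> = (\<Sum>i=1..d k. \<integral>x. b k i * (Y k j x * Y k i x) \<partial>surface_measure)"
    by (intro Bochner_Integration.integral_sum surface_integrable continuous_intros Y_continuous j) auto
  also have "\<dots> = (\<Sum>i=1..d k. b k i * (if j = i then 1 else 0))"
    by (intro sum.cong refl) (simp add: orthonormal[OF j])
  also have "\<dots> = b k j" using j by (simp add: if_distrib sum.delta' cong: if_cong)
  finally show ?thesis by simp
qed

lemma expansion_unique:
  fixes b c :: "nat \<Rightarrow> nat \<Rightarrow> complex"
  assumes \<rho>: "0 < \<rho>"
    and b: "\<And>x. norm x < \<rho> \<Longrightarrow> (\<lambda>k. \<Sum>j=1..d k. b k j * of_real (solid k j x)) sums f x"
    and c: "\<And>x. norm x < \<rho> \<Longrightarrow> (\<lambda>k. \<Sum>j=1..d k. c k j * of_real (solid k j x)) sums f x"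
    and j: "j \<in> {1..d k}"
  shows "b k j = c k j"
proof -
  have z: "(\<lambda>k. \<Sum>j=1..d k. (b k j - c k j) * of_real (solid k j x)) sums 0" if "norm x < \<rho>" for x
    using sums_diff[OF b[OF that] c[OF that]] by (simp add: left_diff_distrib sum_subtractf)
  have "Re (b k j - c k j) = 0"
    using sums_Re[OF z] by (intro real_expansion_unique[OF \<rho> _ j]) simp
  moreover have "Im (b k j - c k j) = 0"
    using sums_Im[OF z] by (intro real_expansion_unique[OF \<rho> _ j]) simp
  ultimately show ?thesis by (simp add: complex_eq_iff)
qed

lemma sphere_coeff_Re_Im:
  assumes "j \<in> {1..d k}" "integrable surface_measure \<phi>"
  shows "Re (sphere_coeff \<phi> k j) = sphere_coeff (\<lambda>x. Re (\<phi> x)) k j"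
    and "Im (sphere_coeff \<phi> k j) = sphere_coeff (\<lambda>x. Im (\<phi> x)) k j"
  using surface_integrable_mult[OF Y_continuous[OF assms(1)] assms(2)]
  by (simp_all add: sphere_coeff_def flip: integral_Re integral_Im)

lemma expansion:
  fixes f :: "'a \<Rightarrow> complex"
  assumes f: "harmonic_on (ball 0 1) f" and r: "0 < r" "r < 1" and x: "norm x < 1"
  shows "(\<lambda>k. \<Sum>j=1..d k. sphere_coeff (\<lambda>y. f (r *\<^sub>R y)) k j * of_real (solid k j x)) sums f (r *\<^sub>R x)"
proof -
  have "integrable surface_measure (\<lambda>y. f (r *\<^sub>R y))"
    using r by (intro surface_integrable continuous_on_compose2[OF harmonic_on_continuous[OF f]] continuous_intros) auto
  note ReIm = sphere_coeff_Re_Im[OF _ this]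
  show ?thesis unfolding sums_complex_iff
    using real_valued_expansion[OF harmonic_on_bounded_linear[OF bounded_linear_Re f] r x]
      real_valued_expansion[OF harmonic_on_bounded_linear[OF bounded_linear_Im f] r x]
    by (simp add: ReIm)
qed

section \<open>Coefficients of harmonic functions\<close>

lemma harmonic_term_eq: "harmonic_term d Y b x k = (\<Sum>j=1..d k. b k j * of_real (solid k j x))"
  unfolding harmonic_term_def sum_distrib_left
proof (intro sum.cong refl)
  fix j assume j: "j \<in> {1..d k}"
  show "complex_of_real (norm x ^ k) * (b k j * complex_of_real (Y k j (direction x))) =
      b k j * complex_of_real (solid k j x)"
    using solid_harmonic_direction[OF solid_harmonic_solid[OF j], of x]
    by (simp add: solid_sphere[OF j direction_sphere])
qed

lemma harmonic_coeff_eqI: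
  assumes "\<And>k j. j \<notin> {1..d k} \<Longrightarrow> b k j = 0" "\<And>x. norm x < 1 \<Longrightarrow> harmonic_term d Y b x sums f x"
  shows "harmonic_coeff d Y f = b"
  unfolding harmonic_coeff_def
proof (rule the_equality)
  show "(\<forall>k j. j \<notin> {1..d k} \<longrightarrow> b k j = 0) \<and> (\<forall>x\<in>ball 0 1. harmonic_term d Y b x sums f x)"
    using assms by auto
  fix c assume c: "(\<forall>k j. j \<notin> {1..d k} \<longrightarrow> c k j = 0) \<and> (\<forall>x\<in>ball 0 1. harmonic_term d Y c x sums f x)"
  have "c k j = b k j" for k j
  proof (cases "j \<in> {1..d k}")
    case True
    then show ?thesis
      using c assms(2)
      by (intro expansion_unique[of 1 c f b]) (simp_all add: harmonic_term_eq[abs_def])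
  next
    case False
    then show ?thesis using c assms(1) by simp
  qed
  then show "c = b" by (intro ext)
qed

text \<open>The expansions obtained from the spheres of different radii \<open>r\<close> agree near the origin, and by
  uniqueness they have the same coefficients. The sphere of radius \<open>1/2\<close> serves to define them.\<close>

lemma harmonic_function_expansion:
  assumes f: "f \<in> harmonic_ball"
  shows "norm x < 1 \<Longrightarrow> harmonic_term d Y (harmonic_coeff d Y f) x sums f x"
    and "j \<notin> {1..d k} \<Longrightarrow> harmonic_coeff d Y f k j = 0"
    and "\<lbrakk>0 < r; r < 1; j \<in> {1..d k}\<rbrakk> \<Longrightarrow>
      sphere_coeff (\<lambda>y. f (r *\<^sub>R y)) k j = of_real (r ^ k) * harmonic_coeff d Y f k j"
proof -
  have h: "harmonic_on (ball 0 1) f" using f by (simp add: harmonic_ball_def)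
  define a where "a r k j = sphere_coeff (\<lambda>y. f (r *\<^sub>R y)) k j / of_real (r ^ k)" for r k j
  have a_sums: "(\<lambda>k. \<Sum>j=1..d k. a r k j * of_real (solid k j x)) sums f x" if r: "0 < r" "r < 1" and x: "norm x < r" for r x
  proof -
    have "norm ((1 / r) *\<^sub>R x) < 1" using r x by (simp add: field_simps)
    from expansion[OF h r this]
    have "(\<lambda>k. \<Sum>j=1..d k. sphere_coeff (\<lambda>y. f (r *\<^sub>R y)) k j * of_real (solid k j ((1 / r) *\<^sub>R x))) sums f x"
      using r by simp
    moreover have "(\<Sum>j=1..d k. sphere_coeff (\<lambda>y. f (r *\<^sub>R y)) k j * of_real (solid k j ((1 / r) *\<^sub>R x))) =
        (\<Sum>j=1..d k. a r k j * of_real (solid k j x))" for k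
      by (intro sum.cong refl)
         (simp add: a_def solid_harmonicD(2)[OF solid_harmonic_solid] power_divide)
    ultimately show ?thesis by simp
  qed
  have a_eq: "a r k j = a (1/2) k j" if r: "0 < r" "r < 1" and j: "j \<in> {1..d k}" for r k j
    using r by (intro expansion_unique[where \<rho> = "min r (1/2)" and f = f, OF _ _ _ j] a_sums) auto
  define b where "b k j = (if j \<in> {1..d k} then a (1/2) k j else 0)" for k j
  have b_sums: "harmonic_term d Y b x sums f x" if x: "norm x < 1" for x
  proof -
    obtain r where r: "norm x < r" "r < 1" using dense[OF x] by blast
    then have r0: "0 < r" using norm_ge_zero[of x] by linarith
    have "(\<Sum>j=1..d k. b k j * of_real (solid k j x)) = (\<Sum>j=1..d k. a r k j * of_real (solid k j x))" for k
      by (intro sum.cong refl) (simp add: b_def a_eq[OF r0 r(2)])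
    then show ?thesis using a_sums[OF r0 r(2,1)] by (simp add: harmonic_term_eq[abs_def])
  qed
  have eq: "harmonic_coeff d Y f = b"
    by (rule harmonic_coeff_eqI[OF _ b_sums]) (simp only: b_def if_False)
  show "norm x < 1 \<Longrightarrow> harmonic_term d Y (harmonic_coeff d Y f) x sums f x" using b_sums eq by simp
  show "j \<notin> {1..d k} \<Longrightarrow> harmonic_coeff d Y f k j = 0" by (simp only: eq b_def if_False)
  show "\<lbrakk>0 < r; r < 1; j \<in> {1..d k}\<rbrakk> \<Longrightarrow>
      sphere_coeff (\<lambda>y. f (r *\<^sub>R y)) k j = of_real (r ^ k) * harmonic_coeff d Y f k j"
    using a_eq[of r j k] by (simp add: eq b_def a_def[of r] field_simps)
qed

definition subexp_coeff :: "(nat \<Rightarrow> nat \<Rightarrow> complex) \<Rightarrow> bool" where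
  "subexp_coeff b \<longleftrightarrow> (\<exists>\<beta>. subexp \<beta> \<and> (\<forall>k. \<forall>j\<in>{1..d k}. cmod (b k j) \<le> \<beta> k))"

lemma subexp_coeffE:
  assumes "subexp_coeff b"
  obtains \<beta> where "subexp \<beta>" "\<And>k j. j \<in> {1..d k} \<Longrightarrow> cmod (b k j) \<le> \<bar>\<beta> k\<bar>"
proof -
  obtain \<beta> where \<beta>: "subexp \<beta>" "\<forall>k. \<forall>j\<in>{1..d k}. cmod (b k j) \<le> \<beta> k"
    using assms unfolding subexp_coeff_def by blast
  have "cmod (b k j) \<le> \<bar>\<beta> k\<bar>" if "j \<in> {1..d k}" for k j
    using \<beta>(2) that by (intro order_trans[OF _ abs_ge_self]) simp
  then show ?thesis using that \<beta>(1) by blast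
qed

lemma subexp_coeffI: "subexp \<beta> \<Longrightarrow> (\<And>k j. j \<in> {1..d k} \<Longrightarrow> cmod (b k j) \<le> \<beta> k) \<Longrightarrow> subexp_coeff b"
  unfolding subexp_coeff_def by blast

lemma subexp_coeff_mult:
  assumes "subexp_coeff b" "subexp_coeff c"
  shows "subexp_coeff (\<lambda>k j. b k j * c k j)"
proof -
  obtain \<beta> where \<beta>: "subexp \<beta>" "\<And>k j. j \<in> {1..d k} \<Longrightarrow> cmod (b k j) \<le> \<bar>\<beta> k\<bar>"
    using assms(1) by (rule subexp_coeffE) blast
  obtain \<gamma> where \<gamma>: "subexp \<gamma>" "\<And>k j. j \<in> {1..d k} \<Longrightarrow> cmod (c k j) \<le> \<bar>\<gamma> k\<bar>"
    using assms(2) by (rule subexp_coeffE) blast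
  show ?thesis
  proof (rule subexp_coeffI)
    show "subexp (\<lambda>k. \<bar>\<beta> k * \<gamma> k\<bar>)" by (rule subexp_mono[OF subexp_mult[OF \<beta>(1) \<gamma>(1)]]) simp
    show "cmod (b k j * c k j) \<le> \<bar>\<beta> k * \<gamma> k\<bar>" if "j \<in> {1..d k}" for k j
      using \<beta>(2)[OF that] \<gamma>(2)[OF that] by (simp add: norm_mult abs_mult mult_mono)
  qed
qed

lemma subexp_coeff_summable:
  assumes "subexp_coeff b" "norm x < 1"
  shows "summable (\<lambda>k. cmod (harmonic_term d Y b x k))"
proof -
  obtain \<beta> where \<beta>: "subexp \<beta>" "\<And>k j. j \<in> {1..d k} \<Longrightarrow> cmod (b k j) \<le> \<bar>\<beta> k\<bar>"
    using assms(1) by (rule subexp_coeffE) blast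
  show ?thesis
    by (rule summable_comparison_test'[OF expansion_bound_summable[OF \<beta>(1) assms(2)], of 0])
       (simp only: harmonic_term_eq expansion_term_bound[OF \<beta>(2)] real_norm_def abs_norm_cancel)
qed

lemma subexp_coeff_sums:
  "subexp_coeff b \<Longrightarrow> norm x < 1 \<Longrightarrow> harmonic_term d Y b x sums series_function d Y b x"
  unfolding series_function_def
  by (rule summable_sums[OF summable_norm_cancel[OF subexp_coeff_summable]])

lemma subexp_coeff_converges: "subexp_coeff b \<Longrightarrow> series_converges d Y b"
  unfolding series_converges_def by (auto intro!: sums_summable[OF subexp_coeff_sums])

lemma real_series_harmonic:
  fixes b :: "nat \<Rightarrow> nat \<Rightarrow> real"
  assumes \<beta>: "subexp \<beta>" "\<And>k j. j \<in> {1..d k} \<Longrightarrow> \<bar>b k j\<bar> \<le> \<bar>\<beta> k\<bar>"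
  shows "harmonic_on (ball 0 1) (\<lambda>x. \<Sum>k. \<Sum>j=1..d k. b k j * solid k j x)"
proof (rule harmonic_series[OF harmonic_sequence_solid])
  show "solid_harmonic k (\<lambda>x. \<Sum>j=1..d k. b k j * solid k j x)" for k
    by (rule solid_harmonic_sum) (rule solid_harmonic_solid)
  show "subexp (\<lambda>k. \<bar>\<beta> k * (growth k * growth k)\<bar>)"
    by (rule subexp_mono[of "\<lambda>k. \<beta> k * (growth k * growth k)"])
       (auto intro!: subexp_mult \<beta>(1) subexp_growth)
  show "\<bar>\<Sum>j=1..d k. b k j * solid k j x\<bar> \<le> \<bar>\<beta> k * (growth k * growth k)\<bar>" if "norm x = 1" for k x
    using real_expansion_term_bound[of k "b k" "\<beta> k" x] \<beta>(2) that by simp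
qed

lemma subexp_coeff_harmonic:
  assumes b: "subexp_coeff b"
  shows "series_function d Y b \<in> harmonic_ball"
proof -
  obtain \<beta> where \<beta>: "subexp \<beta>" "\<And>k j. j \<in> {1..d k} \<Longrightarrow> cmod (b k j) \<le> \<bar>\<beta> k\<bar>"
    using b by (rule subexp_coeffE) blast
  define u where "u x = (\<Sum>k. \<Sum>j=1..d k. Re (b k j) * solid k j x)" for x
  define v where "v x = (\<Sum>k. \<Sum>j=1..d k. Im (b k j) * solid k j x)" for x
  have "harmonic_on (ball 0 1) u"
    unfolding u_def using \<beta>(2) abs_Re_le_cmod order_trans by (intro real_series_harmonic[OF \<beta>(1)]) blast
  moreover have "harmonic_on (ball 0 1) v"
    unfolding v_def using \<beta>(2) abs_Im_le_cmod order_trans by (intro real_series_harmonic[OF \<beta>(1)]) blast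
  ultimately have "harmonic_on (ball 0 1) (\<lambda>x. complex_of_real (u x) + \<i> * complex_of_real (v x))"
    by (intro harmonic_on_add harmonic_on_bounded_linear[where T = complex_of_real]
        harmonic_on_bounded_linear[where T = "\<lambda>v. \<i> * complex_of_real v"] bounded_linear_of_real
        bounded_linear_compose[OF bounded_linear_mult_right bounded_linear_of_real])
  moreover have "complex_of_real (u x) + \<i> * complex_of_real (v x) = series_function d Y b x"
    if "x \<in> ball 0 1" for x
  proof -
    have "harmonic_term d Y b x sums series_function d Y b x"
      using subexp_coeff_sums[OF b] that by simp
    from sums_unique[OF sums_Re[OF this]] sums_unique[OF sums_Im[OF this]] show ?thesis
      by (simp add: complex_eq_iff u_def v_def harmonic_term_eq)
  qed
  ultimately have "harmonic_on (ball 0 1) (series_function d Y b)"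
    by (rule harmonic_on_cong[OF open_ball, rotated])
  then show ?thesis by (simp add: harmonic_ball_def)
qed

lemma harmonic_coeff_series:
  assumes "\<And>x. norm x < 1 \<Longrightarrow> harmonic_term d Y b x sums f x" "j \<in> {1..d k}"
  shows "harmonic_coeff d Y f k j = b k j"
proof -
  define b' where "b' k j = (if j \<in> {1..d k} then b k j else 0)" for k j
  have eq: "harmonic_term d Y b' x = harmonic_term d Y b x" for x
    unfolding fun_eq_iff harmonic_term_eq b'_def by (intro allI sum.cong refl) simp
  have "harmonic_coeff d Y f = b'"
  proof (rule harmonic_coeff_eqI)
    show "b' k j = 0" if "j \<notin> {1..d k}" for k j by (simp only: b'_def that if_False)
    show "harmonic_term d Y b' x sums f x" if "norm x < 1" for x
      unfolding eq by (rule assms(1)[OF that])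
  qed
  then show ?thesis using assms(2) by (simp add: b'_def)
qed

lemma harmonic_ball_sphere_continuous:
  assumes "f \<in> harmonic_ball" "0 \<le> r" "r < 1"
  shows "continuous_on (sphere 0 1) (\<lambda>y. f (r *\<^sub>R y))"
proof -
  have "harmonic_on (ball 0 1) f" using assms(1) by (simp add: harmonic_ball_def)
  then show ?thesis
    by (rule continuous_on_compose2[OF harmonic_on_continuous])
       (use assms in \<open>auto intro!: continuous_intros\<close>)
qed

text \<open>The coefficients of degree \<open>k\<close> are \<open>r\<^sup>-\<^sup>k\<close> times integrals over the sphere of radius \<open>r\<close>, for every
  \<open>r < 1\<close>.\<close>

lemma harmonic_coeff_subexp:
  assumes f: "f \<in> harmonic_ball"
  shows "subexp_coeff (harmonic_coeff d Y f)"
proof (rule subexp_coeffI)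
  let ?b = "harmonic_coeff d Y f"
  show "cmod (?b k j) \<le> (\<Sum>j=1..d k. cmod (?b k j))" if "j \<in> {1..d k}" for k j
    using that by (intro member_le_sum) auto
  show "subexp (\<lambda>k. \<Sum>j=1..d k. cmod (?b k j))"
    unfolding subexp_def
  proof (intro allI impI)
    fix \<rho> :: real assume \<rho>: "0 < \<rho>" "\<rho> < 1"
    define r where "r = sqrt \<rho>"
    have r: "0 < r" "r < 1" "\<rho> = r * r" using \<rho> by (auto simp: r_def)
    define I where "I = (\<integral>y. cmod (f (r *\<^sub>R y)) \<partial>surface_measure)"
    have I0: "0 \<le> I" unfolding I_def by (intro Bochner_Integration.integral_nonneg) auto
    have int: "integrable surface_measure (\<lambda>y. f (r *\<^sub>R y))"
      using r by (intro surface_integrable harmonic_ball_sphere_continuous f) auto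
    obtain C where C: "\<And>k. \<bar>growth k * growth k\<bar> * r ^ k \<le> C"
      using subexpD[OF subexp_mult[OF subexp_growth subexp_growth] r(1,2)] by blast
    have "\<bar>\<Sum>j=1..d k. cmod (?b k j)\<bar> * \<rho> ^ k \<le> C * I" for k
    proof -
      have g0: "0 \<le> growth k" using growth_ge_1[of k] by linarith
      have bk: "r ^ k * cmod (?b k j) \<le> growth k * I" if j: "j \<in> {1..d k}" for j
      proof -
        have "r ^ k * cmod (?b k j) = cmod (sphere_coeff (\<lambda>y. f (r *\<^sub>R y)) k j)"
          using harmonic_function_expansion(3)[OF f r(1,2) j] r by (simp add: norm_mult norm_power)
        then show ?thesis using sphere_coeff_bound[OF j int] by (simp add: I_def)
      qed
      have "\<bar>\<Sum>j=1..d k. cmod (?b k j)\<bar> * \<rho> ^ k = r ^ k * (\<Sum>j=1..d k. r ^ k * cmod (?b k j))"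
        by (simp add: r(3) power_mult_distrib sum_nonneg sum_distrib_left mult_ac)
      also have "\<dots> \<le> r ^ k * (\<Sum>j=1..d k. growth k * I)"
        using r by (intro mult_left_mono sum_mono bk) auto
      also have "\<dots> = r ^ k * (real (d k) * (growth k * I))" by simp
      also have "\<dots> \<le> r ^ k * (growth k * (growth k * I))"
        using r g0 I0 by (intro mult_left_mono mult_right_mono degree_le_growth) auto
      also have "\<dots> = (\<bar>growth k * growth k\<bar> * r ^ k) * I" using g0 by simp
      also have "\<dots> \<le> C * I" by (rule mult_right_mono[OF C I0])
      finally show ?thesis .
    qed
    then show "\<exists>C. \<forall>k. \<bar>\<Sum>j=1..d k. cmod (?b k j)\<bar> * \<rho> ^ k \<le> C" by blast
  qed
qed

end

section \<open>The Poisson kernel\<close>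

text \<open>With \<open>q = \<bar>x - y\<bar>\<^sup>2\<close> the kernel is \<open>(1 - \<bar>x\<bar>\<^sup>2) q\<^sup>a\<close> for \<open>a = - n / 2\<close>; the common factor \<open>q\<^sup>a\<^sup>-\<^sup>1\<close> of
  the Laplacian is multiplied by \<open>2 n (1 + \<bar>x\<bar>\<^sup>2 - q - 2 x \<bullet> y)\<close>, which vanishes for \<open>\<bar>y\<bar> = 1\<close>.\<close>

lemma poisson_kernel_harmonic_real:
  fixes y :: "'a::euclidean_space"
  assumes y: "norm y = 1"
  shows "harmonic_on (ball 0 1) (\<lambda>x. (1 - (norm x)\<^sup>2) / norm (x - y) ^ DIM('a))"
proof -
  define N where "N = real DIM('a)"
  define q where "q x = (x - y) \<bullet> (x - y)" for x
  have q: "0 < q x" if "norm x < 1" for x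
    using that y unfolding q_def by auto
  have dq: "(q has_derivative (\<lambda>w. 2 * ((x - y) \<bullet> w))) (at x)" for x
    unfolding q_def by (auto intro!: derivative_eq_intros simp: inner_commute)
  have dE: "((\<lambda>x. q x powr a) has_derivative (\<lambda>w. 2 * a * ((x - y) \<bullet> w) * q x powr (a - 1))) (at x)"
    if "norm x < 1" for x a
    by (rule has_derivative_eq_rhs[OF DERIV_compose_FDERIV[OF has_real_derivative_powr[OF q[OF that]] dq]])
       (simp add: fun_eq_iff)
  define a where "a = - N / 2"
  define D where "D x v = - 2 * (x \<bullet> v) * q x powr a + (1 - x \<bullet> x) * (2 * a * ((x - y) \<bullet> v) * q x powr (a - 1))" for x v
  define H where "H x v w = - 2 * (w \<bullet> v) * q x powr a - 2 * (x \<bullet> v) * (2 * a * ((x - y) \<bullet> w) * q x powr (a - 1))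
    - 2 * (x \<bullet> w) * (2 * a * ((x - y) \<bullet> v) * q x powr (a - 1))
    + (1 - x \<bullet> x) * (2 * a * ((w \<bullet> v) * q x powr (a - 1) +
        ((x - y) \<bullet> v) * (2 * (a - 1) * ((x - y) \<bullet> w) * q x powr (a - 1 - 1))))" for x v w
  have "harmonic_on (ball 0 1) (\<lambda>x. (1 - x \<bullet> x) * q x powr a)"
  proof (rule harmonic_onI[where D = D and H = H])
    fix x :: 'a assume "x \<in> ball 0 1"
    then have x: "norm x < 1" by simp
    show "((\<lambda>x. (1 - x \<bullet> x) * q x powr a) has_derivative D x) (at x)"
      unfolding D_def
      by (rule has_derivative_eq_rhs, (rule derivative_intros dE[OF x])+)
         (simp add: fun_eq_iff inner_commute algebra_simps)
    show "((\<lambda>x. D x v) has_derivative H x v) (at x)" for v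
      unfolding D_def H_def
      by (rule has_derivative_eq_rhs, (rule derivative_intros dE[OF x])+)
         (simp add: fun_eq_iff inner_commute algebra_simps)
    have "q x powr (e + 1) = q x * q x powr e" for e
      using q[OF x] by (simp add: powr_add)
    from this[of "a - 1"] this[of "a - 1 - 1"]
    have xq: "q x powr a = q x * q x powr (a - 1)" "q x powr (a - 1) = q x * q x powr (a - 1 - 1)"
      by simp_all
    have s1: "(\<Sum>i\<in>Basis. (x \<bullet> i) * ((x - y) \<bullet> i)) = x \<bullet> (x - y)"
      by (rule euclidean_inner[symmetric])
    have s2: "(\<Sum>i\<in>Basis. ((x - y) \<bullet> i) * ((x - y) \<bullet> i)) = q x"
      unfolding q_def by (rule euclidean_inner[symmetric])
    have "(\<Sum>i\<in>Basis. H x i i) = (\<Sum>i\<in>(Basis::'a set). - 2 * q x powr a - 8 * a * q x powr (a - 1) * ((x \<bullet> i) * ((x - y) \<bullet> i))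
        + (1 - x \<bullet> x) * 2 * a * (q x powr (a - 1) + 2 * (a - 1) * q x powr (a - 1 - 1) * (((x - y) \<bullet> i) * ((x - y) \<bullet> i))))"
      unfolding H_def by (intro sum.cong refl) (simp add: algebra_simps)
    also have "\<dots> = - 2 * N * q x powr a - 8 * a * q x powr (a - 1) * (x \<bullet> (x - y))
        + (1 - x \<bullet> x) * 2 * a * (N * q x powr (a - 1) + 2 * (a - 1) * q x powr (a - 1 - 1) * q x)"
      by (simp add: sum.distrib sum_subtractf N_def s1 s2 flip: sum_distrib_left)
    also have "\<dots> = q x powr (a - 1) * (- 2 * N * q x - 8 * a * (x \<bullet> (x - y)) + (1 - x \<bullet> x) * 2 * a * (N + 2 * (a - 1)))"
      unfolding xq(1) using xq(2) by (simp add: algebra_simps)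
    also have "- 2 * N * q x - 8 * a * (x \<bullet> (x - y)) + (1 - x \<bullet> x) * 2 * a * (N + 2 * (a - 1)) = 0"
    proof -
      have "y \<bullet> y = 1" using y by (simp add: dot_square_norm)
      then have "1 + x \<bullet> x - q x - 2 * (x \<bullet> y) = 0"
        by (simp add: q_def inner_diff_left inner_diff_right inner_commute)
      moreover have "- 2 * N * q x - 8 * a * (x \<bullet> (x - y)) + (1 - x \<bullet> x) * 2 * a * (N + 2 * (a - 1)) =
          2 * N * (1 + x \<bullet> x - q x - 2 * (x \<bullet> y))"
        by (simp add: a_def inner_diff_right algebra_simps)
      ultimately show ?thesis by (simp only: mult_zero_right)
    qed
    finally show "(\<Sum>i\<in>Basis. H x i i) = 0" by simp
  next
    have cq: "continuous_on (ball 0 1) q" unfolding q_def by (intro continuous_intros)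
    have pw: "continuous_on (ball 0 1) (\<lambda>x. q x powr e)" for e
    proof (rule continuous_on_powr[OF cq continuous_on_const])
      show "\<forall>x\<in>ball 0 1. q x \<noteq> 0" using q by force
    qed
    show "continuous_on (ball 0 1) (\<lambda>x. H x v w)" for v w
      unfolding H_def
      by (intro continuous_on_add continuous_on_diff continuous_on_mult continuous_on_inner
          continuous_on_const continuous_on_id pw)
  qed
  moreover have "(1 - x \<bullet> x) * q x powr a = (1 - (norm x)\<^sup>2) / norm (x - y) ^ DIM('a)" if "x \<in> ball 0 1" for x
  proof -
    have pos: "0 < norm (x - y)" using that y by auto
    have "q x powr a = norm (x - y) powr (2 * a)"
      using pos by (simp add: q_def dot_square_norm powr_powr flip: powr_numeral)
    also have "\<dots> = 1 / norm (x - y) ^ DIM('a)"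
      using pos by (simp add: a_def N_def powr_minus_divide powr_realpow)
    finally show ?thesis by (simp add: dot_square_norm)
  qed
  ultimately show ?thesis by (rule harmonic_on_cong[OF open_ball, rotated])
qed

definition poisson :: "'a::euclidean_space \<Rightarrow> 'a \<Rightarrow> real" where
  "poisson y x = (1 / measure (surface_measure :: 'a measure) (sphere 0 1)) * ((1 - (norm x)\<^sup>2) / norm (x - y) ^ DIM('a))"

lemma poisson_kernel_eq: "poisson_kernel y x = complex_of_real (poisson y x)"
  by (simp add: poisson_kernel_def poisson_def)

lemma poisson_harmonic: "norm y = 1 \<Longrightarrow> harmonic_on (ball 0 1) (poisson y)"
  unfolding poisson_def[abs_def]
  by (rule harmonic_on_bounded_linear[OF bounded_linear_mult_right poisson_kernel_harmonic_real])

lemma poisson_kernel_harmonic: "norm y = 1 \<Longrightarrow> poisson_kernel y \<in> harmonic_ball"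
  unfolding harmonic_ball_def poisson_kernel_eq[abs_def]
  using harmonic_on_bounded_linear[OF bounded_linear_of_real poisson_harmonic] by blast

lemma poisson_symmetric:
  assumes "norm x = 1" "norm z = 1"
  shows "poisson z (r *\<^sub>R x) = poisson x (r *\<^sub>R z)"
proof -
  have "(norm (r *\<^sub>R x - z))\<^sup>2 = (norm (r *\<^sub>R z - x))\<^sup>2"
    using assms by (simp add: power2_norm_eq_inner inner_diff_left inner_diff_right inner_commute norm_eq_1)
  then have "norm (r *\<^sub>R x - z) = norm (r *\<^sub>R z - x)"
    by (simp add: power2_eq_iff_nonneg)
  then show ?thesis using assms by (simp add: poisson_def)
qed

lemma poisson_nonneg: "norm x < 1 \<Longrightarrow> 0 \<le> poisson y x"
  unfolding poisson_def by (simp add: abs_square_le_1)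

lemma poisson_sphere_continuous:
  assumes "norm w < 1"
  shows "continuous_on (sphere 0 1) (\<lambda>x. poisson x w)"
  unfolding poisson_def using assms by (intro continuous_intros) auto

context harmonic_basis
begin

text \<open>At the origin only the constant term of the expansion survives, and constants are spanned by the
  spherical harmonics of order \<open>0\<close>.\<close>

lemma mean_value_sphere:
  fixes f :: "'a \<Rightarrow> real"
  assumes f: "harmonic_on (ball 0 1) f" and r: "0 < r" "r < 1"
  shows "(\<integral>x. f (r *\<^sub>R x) \<partial>surface_measure) = measure (surface_measure :: 'a measure) (sphere 0 1) * f 0"
proof -
  let ?S = "measure (surface_measure :: 'a measure) (sphere 0 1)"
  define \<phi> where "\<phi> x = f (r *\<^sub>R x)" for x
  have cont: "continuous_on (sphere 0 1) \<phi>"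
    unfolding \<phi>_def by (rule continuous_on_compose2[OF harmonic_on_continuous[OF f]])
      (use r in \<open>auto intro!: continuous_intros\<close>)
  have const: "solid 0 j x = solid 0 j 0" if "j \<in> {1..d 0}" for j x
    using solid_harmonicD(2)[OF solid_harmonic_solid[OF that], of 0 x] by simp
  have zero: "(\<Sum>j=1..d k. sphere_coeff \<phi> k j * solid k j 0) = 0" if "k \<noteq> 0" for k
  proof (rule sum.neutral, rule ballI)
    fix j assume "j \<in> {1..d k}"
    then have "solid k j (0 *\<^sub>R 0) = 0 ^ k * solid k j 0"
      by (rule solid_harmonicD(2)[OF solid_harmonic_solid])
    then show "sphere_coeff \<phi> k j * solid k j 0 = 0"
      using that by (simp add: zero_power)
  qed
  have "(\<lambda>k. \<Sum>j=1..d k. sphere_coeff \<phi> k j * solid k j 0) sums f 0"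
    using real_valued_expansion[OF f r, of 0] by (simp add: \<phi>_def[abs_def])
  moreover have "(\<lambda>k. \<Sum>j=1..d k. sphere_coeff \<phi> k j * solid k j 0) sums (\<Sum>j=1..d 0. sphere_coeff \<phi> 0 j * solid 0 j 0)"
    using sums_finite[of "{0::nat}" "\<lambda>k. \<Sum>j=1..d k. sphere_coeff \<phi> k j * solid k j 0"] zero by simp
  ultimately have f0: "f 0 = (\<Sum>j=1..d 0. sphere_coeff \<phi> 0 j * solid 0 j 0)"
    by (rule sums_unique2)
  define s where "s j = solid 0 j 0" for j
  have Ys: "Y 0 j x = s j" if "j \<in> {1..d 0}" "norm x = 1" for j x
    using solid_sphere[OF that] const[OF that(1), of x] by (simp add: s_def)
  have cj: "sphere_coeff (\<lambda>_. 1) 0 j = s j * ?S" if "j \<in> {1..d 0}" for j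
  proof -
    have "sphere_coeff (\<lambda>_. 1::real) 0 j = (\<integral>x. s j \<partial>(surface_measure :: 'a measure))"
      unfolding sphere_coeff_def by (intro surface_integral_cong) (simp add: Ys[OF that])
    then show ?thesis by simp
  qed
  have one: "1 = (\<Sum>j=1..d 0. s j * ?S * Y 0 j x)" if "norm x = 1" for x
  proof -
    have "1 = (\<Sum>j=1..d 0. sphere_coeff (\<lambda>_. 1) 0 j * solid 0 j x)"
      by (rule solid_harmonic_expand[OF solid_harmonic_const])
    also have "\<dots> = (\<Sum>j=1..d 0. s j * ?S * Y 0 j x)"
      by (intro sum.cong refl) (simp add: cj solid_sphere[OF _ that])
    finally show ?thesis .
  qed
  have "(\<integral>x. \<phi> x \<partial>surface_measure) = (\<integral>x. (\<Sum>j=1..d 0. (s j * ?S) * (Y 0 j x * \<phi> x)) \<partial>surface_measure)"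
  proof (rule surface_integral_cong)
    fix x :: 'a assume x: "norm x = 1"
    have "\<phi> x = (\<Sum>j=1..d 0. s j * ?S * Y 0 j x) * \<phi> x" using one[OF x] by simp
    then show "\<phi> x = (\<Sum>j=1..d 0. (s j * ?S) * (Y 0 j x * \<phi> x))"
      by (simp add: sum_distrib_right mult.assoc)
  qed
  also have "\<dots> = (\<Sum>j=1..d 0. \<integral>x. (s j * ?S) * (Y 0 j x * \<phi> x) \<partial>surface_measure)"
    by (intro Bochner_Integration.integral_sum surface_integrable continuous_intros Y_continuous cont) auto
  also have "\<dots> = (\<Sum>j=1..d 0. (s j * ?S) * sphere_coeff \<phi> 0 j)"
    by (simp add: sphere_coeff_def)
  also have "\<dots> = ?S * f 0"
    unfolding f0 s_def sum_distrib_left by (intro sum.cong refl) (simp add: mult_ac)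
  finally show ?thesis by (simp add: \<phi>_def)
qed

lemma poisson_integral_1:
  fixes z :: 'a
  assumes z: "norm z = 1" and r: "0 < r" "r < 1"
  shows "(\<integral>x. poisson z (r *\<^sub>R x) \<partial>surface_measure) = 1"
    and "(\<integral>x. poisson x (r *\<^sub>R z) \<partial>surface_measure) = 1"
proof -
  show *: "(\<integral>x. poisson z (r *\<^sub>R x) \<partial>surface_measure) = 1"
    using mean_value_sphere[OF poisson_harmonic[OF z] r] surface_measure_pos[where 'a = 'a] z
    by (simp add: poisson_def)
  have "(\<integral>x. poisson x (r *\<^sub>R z) \<partial>surface_measure) = (\<integral>x. poisson z (r *\<^sub>R x) \<partial>surface_measure)"
    by (intro surface_integral_cong) (simp add: poisson_symmetric[OF _ z])
  then show "(\<integral>x. poisson x (r *\<^sub>R z) \<partial>surface_measure) = 1" using * by simp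
qed

text \<open>The kernel has integral \<open>1\<close>, and at points of the sphere with a fixed distance from \<open>z\<close> it is at
  most a constant times \<open>1 - r\<^sup>2\<close>.\<close>

lemma poisson_approximate_identity:
  fixes u :: "'a \<Rightarrow> real" and z :: 'a
  assumes u: "continuous_on (sphere 0 1) u" and z: "norm z = 1"
  shows "((\<lambda>r. \<integral>x. poisson x (r *\<^sub>R z) * u x \<partial>surface_measure) \<longlongrightarrow> u z) (at_left 1)"
proof (rule tendstoI)
  fix e :: real assume e: "0 < e"
  let ?S = "measure (surface_measure :: 'a measure) (sphere 0 1)"
  have S: "0 < ?S" by (rule surface_measure_pos)
  have "bounded (u ` sphere 0 1)" by (intro compact_imp_bounded compact_continuous_image u) auto
  then obtain B where "\<forall>x\<in>u ` sphere 0 1. norm x \<le> B" unfolding bounded_iff by blast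
  then have B: "\<bar>u x\<bar> \<le> B" if "norm x = 1" for x using that by auto
  obtain \<delta> where \<delta>: "0 < \<delta>" "\<And>x. norm x = 1 \<Longrightarrow> dist x z < \<delta> \<Longrightarrow> dist (u x) (u z) < e / 2"
    using u[unfolded continuous_on_iff, rule_format, of z "e / 2"] e z by auto
  define C where "C = (2 / \<delta>) ^ DIM('a) * (2 * B)"
  have B0: "0 \<le> B" using B[OF z] by linarith
  have C0: "0 \<le> C" unfolding C_def using \<delta>(1) B0 by simp
  have "((\<lambda>r. (1 - r\<^sup>2) * C) \<longlongrightarrow> (1 - 1\<^sup>2) * C) (at_left (1::real))"
    by (intro tendsto_intros)
  then have "((\<lambda>r. (1 - r\<^sup>2) * C) \<longlongrightarrow> 0) (at_left (1::real))" by simp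
  then have "\<forall>\<^sub>F r in at_left (1::real). (1 - r\<^sup>2) * C < e / 2"
    using e by (intro order_tendstoD(2)) auto
  moreover have "\<forall>\<^sub>F r in at_left (1::real). r \<in> {max 0 (1 - \<delta> / 2)<..<1}"
    by (rule eventually_at_leftI[of "max 0 (1 - \<delta> / 2)"]) (use \<delta> in auto)
  ultimately show "\<forall>\<^sub>F r in at_left 1. dist (\<integral>x. poisson x (r *\<^sub>R z) * u x \<partial>surface_measure) (u z) < e"
  proof eventually_elim
    case (elim r)
    then have r: "0 < r" "r < 1" "1 - \<delta> / 2 < r" by auto
    have rz: "norm (r *\<^sub>R z) < 1" using r z by simp
    note pc = poisson_sphere_continuous[OF rz]
    have pointwise: "\<bar>poisson x (r *\<^sub>R z) * (u x - u z)\<bar> \<le> poisson x (r *\<^sub>R z) * (e / 2) + (1 - r\<^sup>2) * C / ?S"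
      if x: "norm x = 1" for x
    proof (cases "dist x z < \<delta>")
      case True
      have "\<bar>poisson x (r *\<^sub>R z) * (u x - u z)\<bar> = poisson x (r *\<^sub>R z) * \<bar>u x - u z\<bar>"
        using poisson_nonneg[OF rz] by (simp add: abs_mult)
      also have "\<dots> \<le> poisson x (r *\<^sub>R z) * (e / 2)"
        using \<delta>(2)[OF x True] poisson_nonneg[OF rz, of x] by (intro mult_left_mono) (auto simp: dist_real_def)
      also have "\<dots> \<le> poisson x (r *\<^sub>R z) * (e / 2) + (1 - r\<^sup>2) * C / ?S"
        using r C0 S by (simp add: abs_square_le_1)
      finally show ?thesis .
    next
      case False
      have "norm (x - z) \<le> norm (r *\<^sub>R z - x) + norm (z - r *\<^sub>R z)"
        using norm_triangle_ineq4[of "- (r *\<^sub>R z - x)" "z - r *\<^sub>R z"] by (simp add: norm_minus_commute)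
      moreover have "norm (z - r *\<^sub>R z) = 1 - r"
      proof -
        have "z - r *\<^sub>R z = (1 - r) *\<^sub>R z" by (simp add: algebra_simps)
        then show ?thesis using r z by simp
      qed
      ultimately have far: "\<delta> / 2 \<le> norm (r *\<^sub>R z - x)"
        using False r(3) by (simp add: dist_norm)
      have "poisson x (r *\<^sub>R z) = (1 - r\<^sup>2) / ?S * (1 / norm (r *\<^sub>R z - x)) ^ DIM('a)"
        using z r by (simp add: poisson_def power_divide)
      also have "\<dots> \<le> (1 - r\<^sup>2) / ?S * (2 / \<delta>) ^ DIM('a)"
      proof (intro mult_left_mono power_mono)
        have "1 / norm (r *\<^sub>R z - x) \<le> 1 / (\<delta> / 2)"
          by (rule divide_left_mono[OF far]) (use far \<delta>(1) in \<open>auto intro!: mult_pos_pos\<close>)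
        then show "1 / norm (r *\<^sub>R z - x) \<le> 2 / \<delta>" by simp
      qed (use r S in \<open>auto simp: abs_square_le_1\<close>)
      finally have P: "poisson x (r *\<^sub>R z) \<le> (1 - r\<^sup>2) / ?S * (2 / \<delta>) ^ DIM('a)" .
      have "\<bar>poisson x (r *\<^sub>R z) * (u x - u z)\<bar> = poisson x (r *\<^sub>R z) * \<bar>u x - u z\<bar>"
        using poisson_nonneg[OF rz] by (simp add: abs_mult)
      also have "\<dots> \<le> ((1 - r\<^sup>2) / ?S * (2 / \<delta>) ^ DIM('a)) * (2 * B)"
        using P B[OF x] B[OF z] poisson_nonneg[OF rz, of x] by (intro mult_mono) auto
      also have "\<dots> = (1 - r\<^sup>2) * C / ?S" by (simp add: C_def)
      also have "\<dots> \<le> poisson x (r *\<^sub>R z) * (e / 2) + (1 - r\<^sup>2) * C / ?S"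
        using poisson_nonneg[OF rz, of x] e by simp
      finally show ?thesis .
    qed
    have i1: "integrable surface_measure (\<lambda>x. poisson x (r *\<^sub>R z) * u x)"
      and i2: "integrable surface_measure (\<lambda>x. poisson x (r *\<^sub>R z) * u z)"
      and i3: "integrable surface_measure (\<lambda>x. \<bar>poisson x (r *\<^sub>R z) * (u x - u z)\<bar>)"
      and i4: "integrable surface_measure (\<lambda>x. poisson x (r *\<^sub>R z) * (e / 2))"
      by (intro surface_integrable continuous_intros pc u)+
    have "(\<integral>x. poisson x (r *\<^sub>R z) * u x \<partial>surface_measure) - u z =
        (\<integral>x. poisson x (r *\<^sub>R z) * (u x - u z) \<partial>surface_measure)"
      using Bochner_Integration.integral_diff[OF i1 i2] poisson_integral_1(2)[OF z r(1,2)]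
      by (simp add: right_diff_distrib)
    then have "dist (\<integral>x. poisson x (r *\<^sub>R z) * u x \<partial>surface_measure) (u z) \<le>
        (\<integral>x. \<bar>poisson x (r *\<^sub>R z) * (u x - u z)\<bar> \<partial>surface_measure)"
      unfolding dist_real_def by (simp only: integral_abs_bound)
    also have "\<dots> \<le> (\<integral>x. poisson x (r *\<^sub>R z) * (e / 2) + (1 - r\<^sup>2) * C / ?S \<partial>surface_measure)"
      using i3 i4 pointwise by (intro integral_mono) auto
    also have "\<dots> = e / 2 + (1 - r\<^sup>2) * C"
      using Bochner_Integration.integral_add[OF i4, of "\<lambda>_. (1 - r\<^sup>2) * C / ?S"] poisson_integral_1(2)[OF z r(1,2)] S
      by simp
    also have "\<dots> < e" using elim by simp
    finally show ?case .
  qed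
qed

text \<open>By symmetry the integral of \<open>P\<^sub>z(r x) Y\<^sub>k\<^sub>j(x)\<close> is the Poisson average of \<open>Y\<^sub>k\<^sub>j\<close> at \<open>r z\<close>, which tends to
  \<open>Y\<^sub>k\<^sub>j(z)\<close> as \<open>r\<close> tends to \<open>1\<close>. It is also \<open>r\<^sup>k\<close> times the coefficient.\<close>

lemma poisson_coeff:
  assumes z: "norm z = 1" and j: "j \<in> {1..d k}"
  shows "harmonic_coeff d Y (poisson_kernel z) k j = of_real (Y k j z)"
proof -
  let ?a = "harmonic_coeff d Y (poisson_kernel z) k j"
  have eq: "of_real (\<integral>x. poisson x (r *\<^sub>R z) * Y k j x \<partial>surface_measure) = of_real (r ^ k) * ?a" if r: "0 < r" "r < 1" for r
  proof -
    have "of_real (\<integral>x. poisson x (r *\<^sub>R z) * Y k j x \<partial>surface_measure) =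
        (\<integral>x. complex_of_real (poisson x (r *\<^sub>R z) * Y k j x) \<partial>surface_measure)"
      by (rule integral_complex_of_real[symmetric])
    also have "\<dots> = sphere_coeff (\<lambda>x. poisson_kernel z (r *\<^sub>R x)) k j"
      unfolding sphere_coeff_def poisson_kernel_eq
      by (intro surface_integral_cong) (simp add: poisson_symmetric[OF _ z] scaleR_conv_of_real mult.commute)
    also have "\<dots> = of_real (r ^ k) * ?a"
      by (rule harmonic_function_expansion(3)[OF poisson_kernel_harmonic[OF z] r j])
    finally show ?thesis .
  qed
  have "((\<lambda>r. complex_of_real (\<integral>x. poisson x (r *\<^sub>R z) * Y k j x \<partial>surface_measure)) \<longlongrightarrow> of_real (Y k j z)) (at_left 1)"
    by (intro tendsto_of_real poisson_approximate_identity Y_continuous j z)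
  moreover have "\<forall>\<^sub>F r in at_left 1. complex_of_real (\<integral>x. poisson x (r *\<^sub>R z) * Y k j x \<partial>surface_measure) = of_real (r ^ k) * ?a"
    by (rule eventually_at_leftI[of 0]) (auto simp only: eq greaterThanLessThan_iff zero_less_one)
  ultimately have "((\<lambda>r. complex_of_real (r ^ k) * ?a) \<longlongrightarrow> of_real (Y k j z)) (at_left 1)"
    by (rule Lim_transform_eventually)
  moreover have "((\<lambda>r. complex_of_real (r ^ k) * ?a) \<longlongrightarrow> of_real (1 ^ k) * ?a) (at_left 1)"
    by (intro tendsto_intros)
  ultimately have "of_real (Y k j z) = of_real (1 ^ k) * ?a"
    by (intro tendsto_unique[of "at_left (1::real)"]) auto
  then show ?thesis by simp
qed

section \<open>Convolution kernels\<close>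

text \<open>The kernel \<open>\<Sum>\<^sub>k\<^sub>j c\<^sub>k\<^sub>j Y\<^sub>k\<^sub>j(x) Y\<^sub>k\<^sub>j\<close> on the sphere, extended harmonically to points \<open>w\<close> of the
  ball in the variable other than \<open>x\<close>. Convolution with \<open>c\<close> integrates against it, and for \<open>c = 1\<close> it is
  the Poisson kernel.\<close>

definition conv_kernel :: "(nat \<Rightarrow> nat \<Rightarrow> complex) \<Rightarrow> 'a \<Rightarrow> 'a \<Rightarrow> complex" where
  "conv_kernel c w x = series_function d Y (\<lambda>k j. c k j * of_real (Y k j x)) w"

lemma subexp_coeff_const: "subexp_coeff (\<lambda>k j. a)"
  by (rule subexp_coeffI[OF subexp_const[of "cmod a"]]) simp

lemma series_function_cong:
  "(\<And>k j. j \<in> {1..d k} \<Longrightarrow> b k j = c k j) \<Longrightarrow> series_function d Y b w = series_function d Y c w"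
  unfolding series_function_def harmonic_term_eq by (intro suminf_cong sum.cong refl) simp

lemma conv_kernel_1:
  assumes x: "norm x = 1" and w: "norm w < 1"
  shows "conv_kernel (\<lambda>k j. 1) w x = poisson_kernel x w"
proof -
  have "poisson_kernel x w = series_function d Y (harmonic_coeff d Y (poisson_kernel x)) w"
    unfolding series_function_def
    by (rule sums_unique[OF harmonic_function_expansion(1)[OF poisson_kernel_harmonic[OF x] w]])
  also have "\<dots> = conv_kernel (\<lambda>k j. 1) w x"
    unfolding conv_kernel_def by (rule series_function_cong) (simp add: poisson_coeff[OF x])
  finally show ?thesis by simp
qed

lemma conv_kernel_term_bound:
  assumes c: "subexp_coeff c" and w: "norm w < 1"
  obtains M where "summable M"
    "\<And>k x. norm x = 1 \<Longrightarrow> cmod (harmonic_term d Y (\<lambda>k j. c k j * of_real (Y k j x)) w k) \<le> M k"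
proof -
  obtain \<beta> where \<beta>: "subexp \<beta>" "\<And>k j. j \<in> {1..d k} \<Longrightarrow> cmod (c k j) \<le> \<bar>\<beta> k\<bar>"
    using c by (rule subexp_coeffE) blast
  define \<gamma> where "\<gamma> k = \<beta> k * growth k" for k
  have \<gamma>: "subexp \<gamma>" unfolding \<gamma>_def by (intro subexp_mult \<beta>(1) subexp_growth)
  have bound: "cmod (harmonic_term d Y (\<lambda>k j. c k j * of_real (Y k j x)) w k) \<le> \<bar>\<gamma> k * (growth k * growth k)\<bar> * norm w ^ k"
    if x: "norm x = 1" for k x
    unfolding harmonic_term_eq
  proof (rule expansion_term_bound)
    fix j assume j: "j \<in> {1..d k}"
    have "cmod (c k j * of_real (Y k j x)) \<le> \<bar>\<beta> k\<bar> * growth k"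
      unfolding norm_mult norm_of_real by (intro mult_mono \<beta>(2) Y_le_growth j x) auto
    also have "\<dots> = \<bar>\<gamma> k\<bar>" using growth_ge_1[of k] by (simp add: \<gamma>_def abs_mult)
    finally show "cmod (c k j * of_real (Y k j x)) \<le> \<bar>\<gamma> k\<bar>" .
  qed
  show ?thesis by (rule that[OF expansion_bound_summable[OF \<gamma> w] bound])
qed

lemma conv_kernel_term_continuous:
  "continuous_on (sphere 0 1) (\<lambda>x. harmonic_term d Y (\<lambda>k j. c k j * of_real (Y k j x)) w k)"
  unfolding harmonic_term_eq by (intro continuous_intros Y_continuous)

lemma conv_kernel_continuous:
  assumes c: "subexp_coeff c" and w: "norm w < 1"
  shows "continuous_on (sphere 0 1) (conv_kernel c w)"
proof -
  obtain M where M: "summable M"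
    "\<And>k x. norm x = 1 \<Longrightarrow> cmod (harmonic_term d Y (\<lambda>k j. c k j * of_real (Y k j x)) w k) \<le> M k"
    by (rule conv_kernel_term_bound[OF c w]) blast
  have "uniform_limit (sphere 0 1) (\<lambda>n x. \<Sum>k<n. harmonic_term d Y (\<lambda>k j. c k j * of_real (Y k j x)) w k)
      (conv_kernel c w) sequentially"
    unfolding conv_kernel_def[abs_def] series_function_def
    by (rule Weierstrass_m_test[OF _ M(1)]) (simp add: M(2))
  then show ?thesis
    by (rule uniform_limit_theorem[rotated])
       (auto intro!: always_eventually continuous_on_sum conv_kernel_term_continuous)
qed

lemma conv_kernel_integral:
  assumes c: "subexp_coeff c" and w: "norm w < 1" and \<phi>: "integrable surface_measure \<phi>"
  shows "(\<integral>x. \<phi> x * conv_kernel c w x \<partial>surface_measure) =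
    series_function d Y (\<lambda>k j. c k j * sphere_coeff \<phi> k j) w"
proof -
  obtain M where M: "summable M"
    "\<And>k x. norm x = 1 \<Longrightarrow> cmod (harmonic_term d Y (\<lambda>k j. c k j * of_real (Y k j x)) w k) \<le> M k"
    by (rule conv_kernel_term_bound[OF c w]) blast
  let ?t = "\<lambda>k x. harmonic_term d Y (\<lambda>k j. c k j * of_real (Y k j x)) w k"
  have YI: "integrable surface_measure (\<lambda>x. of_real (Y k j x) * \<phi> x)" if "j \<in> {1..d k}" for k j
    using surface_integrable_mult[OF Y_continuous[OF that] \<phi>] by (simp add: scaleR_conv_of_real)
  have split: "\<phi> x * ?t k x = (\<Sum>j=1..d k. (c k j * of_real (solid k j w)) * (of_real (Y k j x) * \<phi> x))" for k x
    unfolding harmonic_term_eq sum_distrib_left by (intro sum.cong refl) simp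
  have int: "integrable surface_measure (\<lambda>x. \<phi> x * ?t k x)" for k
    unfolding split using YI by (intro Bochner_Integration.integrable_sum integrable_mult_right) auto
  have M0: "0 \<le> M k" for k using order_trans[OF norm_ge_zero M(2)[OF direction_sphere]] .
  have bd: "cmod (\<phi> x * ?t k x) \<le> cmod (\<phi> x) * M k" if "norm x = 1" for k x
    unfolding norm_mult by (intro mult_left_mono M(2) that) auto
  have s1: "summable (\<lambda>k. \<integral>x. cmod (\<phi> x * ?t k x) \<partial>surface_measure)"
  proof (rule summable_comparison_test'[where N = 0])
    show "summable (\<lambda>k. (\<integral>x. cmod (\<phi> x) \<partial>surface_measure) * M k)" by (rule summable_mult[OF M(1)])
    fix k
    have "(\<integral>x. cmod (\<phi> x * ?t k x) \<partial>surface_measure) \<le> (\<integral>x. cmod (\<phi> x) * M k \<partial>surface_measure)"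
      using int \<phi> bd by (intro integral_mono) auto
    then show "norm (\<integral>x. cmod (\<phi> x * ?t k x) \<partial>surface_measure) \<le> (\<integral>x. cmod (\<phi> x) \<partial>surface_measure) * M k"
      by simp
  qed
  have s2: "AE x in surface_measure. summable (\<lambda>k. norm (\<phi> x * ?t k x))"
  proof (rule AE_I2)
    fix x :: 'a assume "x \<in> space surface_measure"
    then show "summable (\<lambda>k. norm (\<phi> x * ?t k x))"
      using bd[of x] by (intro summable_comparison_test'[OF summable_mult[OF M(1), of "cmod (\<phi> x)"], of 0]) auto
  qed
  have "(\<integral>x. \<phi> x * conv_kernel c w x \<partial>surface_measure) = (\<integral>x. (\<Sum>k. \<phi> x * ?t k x) \<partial>surface_measure)"
  proof (rule surface_integral_cong)
    fix x :: 'a assume x: "norm x = 1"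
    have "summable (\<lambda>k. ?t k x)"
      by (rule summable_comparison_test'[OF M(1), of 0]) (rule M(2)[OF x])
    then show "\<phi> x * conv_kernel c w x = (\<Sum>k. \<phi> x * ?t k x)"
      unfolding conv_kernel_def series_function_def by (rule suminf_mult[symmetric])
  qed
  also have "\<dots> = (\<Sum>k. \<integral>x. \<phi> x * ?t k x \<partial>surface_measure)"
    by (rule integral_suminf[OF int s2 s1])
  also have "\<dots> = series_function d Y (\<lambda>k j. c k j * sphere_coeff \<phi> k j) w"
    unfolding series_function_def
  proof (rule suminf_cong)
    fix k
    have "(\<integral>x. \<phi> x * ?t k x \<partial>surface_measure) =
        (\<Sum>j=1..d k. \<integral>x. (c k j * of_real (solid k j w)) * (of_real (Y k j x) * \<phi> x) \<partial>surface_measure)"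
      unfolding split by (intro Bochner_Integration.integral_sum integrable_mult_right YI)
    also have "\<dots> = harmonic_term d Y (\<lambda>k j. c k j * sphere_coeff \<phi> k j) w k"
      unfolding harmonic_term_eq sphere_coeff_def scaleR_conv_of_real integral_mult_right_zero
      by (intro sum.cong refl) (simp only: mult_ac)
    finally show "(\<integral>x. \<phi> x * ?t k x \<partial>surface_measure) = harmonic_term d Y (\<lambda>k j. c k j * sphere_coeff \<phi> k j) w k" .
  qed
  finally show ?thesis .
qed

lemma sphere_coeff_subexp:
  assumes "integrable surface_measure \<phi>"
  shows "subexp_coeff (sphere_coeff \<phi>)"
  by (rule subexp_coeffI[OF subexp_mult[OF subexp_growth subexp_const]]) (rule sphere_coeff_bound[OF _ assms])

lemma poisson_integral:
  assumes "integrable surface_measure \<phi>" "norm w < 1"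
  shows "series_function d Y (sphere_coeff \<phi>) w = (\<integral>x. \<phi> x * of_real (poisson x w) \<partial>surface_measure)"
proof -
  have "series_function d Y (sphere_coeff \<phi>) w = (\<integral>x. \<phi> x * conv_kernel (\<lambda>k j. 1) w x \<partial>surface_measure)"
    by (simp add: conv_kernel_integral[OF subexp_coeff_const assms(2,1)])
  also have "\<dots> = (\<integral>x. \<phi> x * of_real (poisson x w) \<partial>surface_measure)"
    by (intro surface_integral_cong) (simp add: conv_kernel_1[OF _ assms(2)] poisson_kernel_eq)
  finally show ?thesis .
qed

end

section \<open>Integral inequalities\<close>

lemma Hoelder_inequality:
  fixes f g :: "'b \<Rightarrow> real"
  assumes pq: "1 < p" "1 < q" "1 / p + 1 / q = 1"
    and f [measurable]: "f \<in> borel_measurable M" and g [measurable]: "g \<in> borel_measurable M"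
    and nn: "\<And>x. 0 \<le> f x" "\<And>x. 0 \<le> g x"
    and int: "integrable M (\<lambda>x. f x powr p)" "integrable M (\<lambda>x. g x powr q)"
  shows "integrable M (\<lambda>x. f x * g x)"
    and "(\<integral>x. f x * g x \<partial>M) \<le> (\<integral>x. f x powr p \<partial>M) powr (1 / p) * (\<integral>x. g x powr q \<partial>M) powr (1 / q)"
proof -
  define A where "A = (\<integral>x. f x powr p \<partial>M)"
  define B where "B = (\<integral>x. g x powr q \<partial>M)"
  have A0: "0 \<le> A" and B0: "0 \<le> B"
    unfolding A_def B_def by (intro Bochner_Integration.integral_nonneg; simp)+
  show fg: "integrable M (\<lambda>x. f x * g x)"
  proof (rule Bochner_Integration.integrable_bound)
    show "integrable M (\<lambda>x. f x powr p / p + g x powr q / q)" using int by simp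
    show "AE x in M. norm (f x * g x) \<le> norm (f x powr p / p + g x powr q / q)"
    proof (rule AE_I2)
      fix x
      have "f x * g x \<le> f x powr p / p + g x powr q / q" by (rule Youngs_inequality[OF pq nn])
      then show "norm (f x * g x) \<le> norm (f x powr p / p + g x powr q / q)" using nn by simp
    qed
  qed measurable
  have "(\<integral>x. f x * g x \<partial>M) \<le> A powr (1 / p) * B powr (1 / q)"
  proof (cases "A = 0 \<or> B = 0")
    case True
    have "AE x in M. f x * g x = 0"
    proof (cases "A = 0")
      case True
      then have "AE x in M. f x powr p = 0"
        using integral_nonneg_eq_0_iff_AE[OF int(1)] by (simp add: A_def)
      then show ?thesis by eventually_elim simp
    next
      case False
      with \<open>A = 0 \<or> B = 0\<close> have "AE x in M. g x powr q = 0"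
        using integral_nonneg_eq_0_iff_AE[OF int(2)] by (simp add: B_def)
      then show ?thesis by eventually_elim simp
    qed
    then have "(\<integral>x. f x * g x \<partial>M) = 0" by (rule integral_eq_zero_AE)
    then show ?thesis by simp
  next
    case False
    then have AB: "0 < A" "0 < B" using A0 B0 by auto
    define a where "a = A powr (1 / p)"
    define b where "b = B powr (1 / q)"
    have ab: "0 < a" "0 < b" "a powr p = A" "b powr q = B"
      using AB pq by (auto simp: a_def b_def powr_powr)
    have pointwise: "f x * g x \<le> a * b * (f x powr p / (p * A) + g x powr q / (q * B))" for x
    proof -
      have "(f x / a) * (g x / b) \<le> (f x / a) powr p / p + (g x / b) powr q / q"
        using nn ab by (intro Youngs_inequality pq) auto
      also have "\<dots> = f x powr p / (p * A) + g x powr q / (q * B)"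
        using nn ab by (simp add: powr_divide mult.commute)
      finally show ?thesis using ab by (simp add: field_simps)
    qed
    have "(\<integral>x. f x * g x \<partial>M) \<le> (\<integral>x. a * b * (f x powr p / (p * A) + g x powr q / (q * B)) \<partial>M)"
      using int by (intro integral_mono fg pointwise) auto
    also have "\<dots> = a * b * (A / (p * A) + B / (q * B))"
      using int by (simp add: A_def B_def)
    also have "\<dots> = a * b * (1 / p + 1 / q)" using AB by simp
    also have "\<dots> = a * b" by (simp only: pq mult_1_right)
    finally show ?thesis by (simp add: a_def b_def)
  qed
  then show "(\<integral>x. f x * g x \<partial>M) \<le> (\<integral>x. f x powr p \<partial>M) powr (1 / p) * (\<integral>x. g x powr q \<partial>M) powr (1 / q)"
    by (simp add: A_def B_def)
qed

lemma ereal_SUP_finite_iff: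
  "(SUP i\<in>I. ereal (F i)) < \<infinity> \<longleftrightarrow> (\<exists>M. \<forall>i\<in>I. F i \<le> M)"
proof
  assume "(SUP i\<in>I. ereal (F i)) < \<infinity>"
  then obtain n :: nat where n: "(SUP i\<in>I. ereal (F i)) < ereal (real n)"
    using less_PInf_Ex_of_nat by auto
  have "F i \<le> real n" if "i \<in> I" for i
  proof -
    have "ereal (F i) \<le> (SUP i\<in>I. ereal (F i))" by (rule SUP_upper[OF that])
    also have "\<dots> < ereal (real n)" using n by simp
    finally show ?thesis by simp
  qed
  then show "\<exists>M. \<forall>i\<in>I. F i \<le> M" by blast
next
  assume "\<exists>M. \<forall>i\<in>I. F i \<le> M"
  then obtain M where "\<forall>i\<in>I. F i \<le> M" by blast
  then have "(SUP i\<in>I. ereal (F i)) \<le> ereal M" by (intro SUP_least) simp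
  then show "(SUP i\<in>I. ereal (F i)) < \<infinity>" by (rule le_less_trans) simp
qed

lemma ereal_SUP_SUP_finite_iff:
  "(SUP i\<in>I. SUP j\<in>J. ereal (F i j)) < \<infinity> \<longleftrightarrow> (\<exists>M. \<forall>i\<in>I. \<forall>j\<in>J. F i j \<le> M)"
proof
  assume "(SUP i\<in>I. SUP j\<in>J. ereal (F i j)) < \<infinity>"
  then obtain n :: nat where n: "(SUP i\<in>I. SUP j\<in>J. ereal (F i j)) < ereal (real n)"
    using less_PInf_Ex_of_nat by auto
  have "F i j \<le> real n" if "i \<in> I" "j \<in> J" for i j
  proof -
    have "ereal (F i j) \<le> (SUP j\<in>J. ereal (F i j))" by (rule SUP_upper[OF that(2)])
    also have "\<dots> \<le> (SUP i\<in>I. SUP j\<in>J. ereal (F i j))" by (rule SUP_upper[OF that(1)])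
    also have "\<dots> < ereal (real n)" using n by simp
    finally show ?thesis by simp
  qed
  then show "\<exists>M. \<forall>i\<in>I. \<forall>j\<in>J. F i j \<le> M" by blast
next
  assume "\<exists>M. \<forall>i\<in>I. \<forall>j\<in>J. F i j \<le> M"
  then obtain M where "\<forall>i\<in>I. \<forall>j\<in>J. F i j \<le> M" by blast
  then have "(SUP i\<in>I. SUP j\<in>J. ereal (F i j)) \<le> ereal M" by (intro SUP_least) simp
  then show "(SUP i\<in>I. SUP j\<in>J. ereal (F i j)) < \<infinity>" by (rule le_less_trans) simp
qed

lemma le_one_plus_powr:
  fixes t :: real assumes "1 < p" "0 \<le> t" shows "t \<le> 1 + t powr p"
proof (cases "t \<le> 1")
  case False
  then have "t powr 1 \<le> t powr p" using assms by (intro powr_mono) auto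
  then show ?thesis using False by simp
qed (simp add: add_increasing2)

lemma integrable_of_powr:
  fixes \<phi> :: "'a::euclidean_space \<Rightarrow> complex"
  assumes p: "1 < p" and [measurable]: "\<phi> \<in> borel_measurable surface_measure"
    and int: "integrable surface_measure (\<lambda>x. cmod (\<phi> x) powr p)"
  shows "integrable surface_measure \<phi>"
proof (rule Bochner_Integration.integrable_bound)
  show "integrable surface_measure (\<lambda>x. 1 + cmod (\<phi> x) powr p)" using int by simp
  show "AE x in surface_measure. norm (\<phi> x) \<le> norm (1 + cmod (\<phi> x) powr p)"
  proof (rule AE_I2)
    fix x
    have "cmod (\<phi> x) \<le> 1 + cmod (\<phi> x) powr p" by (rule le_one_plus_powr[OF p norm_ge_zero])
    then show "norm (\<phi> x) \<le> norm (1 + cmod (\<phi> x) powr p)" by simp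
  qed
qed measurable

definition surface_norm :: "real \<Rightarrow> ('a::euclidean_space \<Rightarrow> complex) \<Rightarrow> real" where
  "surface_norm p \<phi> = (\<integral>x. cmod (\<phi> x) powr p \<partial>surface_measure) powr (1 / p)"

lemma surface_Hoelder:
  fixes \<phi> G :: "'a::euclidean_space \<Rightarrow> complex"
  assumes pq: "1 < p" "1 < q" "1 / p + 1 / q = 1"
    and [measurable]: "\<phi> \<in> borel_measurable surface_measure" "G \<in> borel_measurable surface_measure"
    and int: "integrable surface_measure (\<lambda>x. cmod (\<phi> x) powr p)" "integrable surface_measure (\<lambda>x. cmod (G x) powr q)"
  shows "cmod (\<integral>x. \<phi> x * G x \<partial>surface_measure) \<le> surface_norm p \<phi> * surface_norm q G"
proof -
  have "cmod (\<integral>x. \<phi> x * G x \<partial>surface_measure) \<le> (\<integral>x. cmod (\<phi> x * G x) \<partial>surface_measure)"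
    by (rule integral_norm_bound)
  also have "\<dots> = (\<integral>x. cmod (\<phi> x) * cmod (G x) \<partial>surface_measure)" by (simp add: norm_mult)
  also have "\<dots> \<le> surface_norm p \<phi> * surface_norm q G"
    unfolding surface_norm_def by (rule Hoelder_inequality(2)[OF pq]) (use int in auto)
  finally show ?thesis .
qed

text \<open>Hoelder's inequality is sharp: \<open>\<phi>\<close> is a multiple of the conjugate phase of \<open>G\<close> times
  \<open>\<bar>G\<bar>\<^sup>q\<^sup>-\<^sup>1\<close>, and \<open>(q - 1) p = q\<close>.\<close>

lemma dual_extremal:
  fixes G :: "'a::euclidean_space \<Rightarrow> complex"
  assumes pq: "1 < p" "1 < q" "1 / p + 1 / q = 1"
    and G [measurable]: "G \<in> borel_measurable surface_measure"
    and int: "integrable surface_measure (\<lambda>x. cmod (G x) powr q)" and L: "0 < surface_norm q G"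
  obtains \<phi> where "\<phi> \<in> borel_measurable surface_measure"
    "integrable surface_measure (\<lambda>x. cmod (\<phi> x) powr p)"
    "(\<integral>x. cmod (\<phi> x) powr p \<partial>surface_measure) = 1"
    "(\<integral>x. \<phi> x * G x \<partial>surface_measure) = of_real (surface_norm q G)"
proof -
  define L where "L = surface_norm q G"
  have L0: "0 < L" using L by (simp add: L_def)
  have I0: "0 \<le> (\<integral>x. cmod (G x) powr q \<partial>surface_measure)"
    by (intro Bochner_Integration.integral_nonneg) auto
  then have Lq: "(\<integral>x. cmod (G x) powr q \<partial>surface_measure) = L powr q"
    using pq by (simp add: L_def surface_norm_def powr_powr)
  have qp: "(q - 1) * p = q" using pq by (simp add: field_simps)
  define \<phi> where "\<phi> x = cnj (sgn (G x)) * of_real ((cmod (G x) / L) powr (q - 1))" for x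
  have norm_\<phi>: "cmod (\<phi> x) = (cmod (G x) / L) powr (q - 1)" for x
    by (cases "G x = 0") (simp_all add: \<phi>_def norm_mult norm_sgn)
  have pow: "cmod (\<phi> x) powr p = cmod (G x) powr q / L powr q" for x
    unfolding norm_\<phi> powr_powr qp using L0 by (simp add: powr_divide)
  have prod: "\<phi> x * G x = of_real (cmod (G x) powr q / L powr (q - 1))" for x
  proof (cases "G x = 0")
    case False
    have "cnj (sgn (G x)) * G x = of_real (cmod (G x))"
    proof -
      have "cnj (sgn (G x)) * G x = (G x * cnj (G x)) / of_real (cmod (G x))"
        by (simp add: sgn_eq)
      also have "\<dots> = of_real (cmod (G x))"
        using False by (simp add: complex_norm_square[symmetric] power2_eq_square)
      finally show ?thesis .
    qed
    then have "\<phi> x * G x = of_real (cmod (G x) * (cmod (G x) / L) powr (q - 1))"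
      by (simp add: \<phi>_def mult_ac)
    also have "cmod (G x) * (cmod (G x) / L) powr (q - 1) = (cmod (G x) * cmod (G x) powr (q - 1)) / L powr (q - 1)"
      using L0 by (simp add: powr_divide)
    also have "cmod (G x) * cmod (G x) powr (q - 1) = cmod (G x) powr q"
      using False by (simp add: powr_mult_base)
    finally show ?thesis .
  qed (simp add: \<phi>_def)
  show ?thesis
  proof
    have [measurable]: "cnj \<in> borel_measurable borel"
      by (intro borel_measurable_continuous_onI continuous_intros)
    have "(\<lambda>z. cnj (sgn z) * of_real ((cmod z / L) powr (q - 1))) \<in> borel_measurable borel" by measurable
    from measurable_compose[OF G this] show "\<phi> \<in> borel_measurable surface_measure"
      by (simp add: \<phi>_def[abs_def])
    show "integrable surface_measure (\<lambda>x. cmod (\<phi> x) powr p)" unfolding pow using int by simp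
    show "(\<integral>x. cmod (\<phi> x) powr p \<partial>surface_measure) = 1"
      unfolding pow using L0 by (simp add: Lq)
    have "(\<integral>x. \<phi> x * G x \<partial>surface_measure) = of_real (L powr q / L powr (q - 1))"
      unfolding prod integral_complex_of_real by (simp add: Lq)
    also have "L powr q / L powr (q - 1) = L" using L0 by (simp flip: powr_diff)
    finally show "(\<integral>x. \<phi> x * G x \<partial>surface_measure) = of_real (surface_norm q G)" by (simp add: L_def)
  qed
qed

text \<open>The signs for the gliding hump: given the earlier ones, one of the two signs of the \<open>n\<close>-th
  term does not decrease the modulus of the \<open>n\<close>-th functional below that of this term.\<close>

lemma gliding_hump_signs:
  fixes m :: "nat \<Rightarrow> nat \<Rightarrow> complex"
  shows "\<exists>\<epsilon> :: nat \<Rightarrow> real. \<forall>n. \<bar>\<epsilon> n\<bar> = 1 \<and> cmod (m n n) \<le> cmod ((\<Sum>i<n. of_real (\<epsilon> i) * m n i) + of_real (\<epsilon> n) * m n n)"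
proof -
  let ?P = "\<lambda>(f :: nat \<Rightarrow> real) n r. \<bar>r\<bar> = 1 \<and> cmod (m n n) \<le> cmod ((\<Sum>i<n. of_real (f i) * m n i) + of_real r * m n n)"
  have "\<exists>f. \<forall>n. ?P f n (f n)"
  proof (rule dependent_wf_choice[OF wf_less_than])
    fix f g :: "nat \<Rightarrow> real" and n r
    assume eq: "\<And>z. (z, n) \<in> less_than \<Longrightarrow> f z = g z"
    have "(\<Sum>i<n. of_real (f i) * m n i) = (\<Sum>i<n. of_real (g i) * m n i)"
      by (intro sum.cong refl) (simp add: eq)
    then show "?P f n r = ?P g n r" by simp
  next
    fix n :: nat and f :: "nat \<Rightarrow> real"
    let ?a = "\<Sum>i<n. of_real (f i) * m n i"
    have "2 * cmod (m n n) = cmod ((?a + m n n) - (?a - m n n))" by (simp add: norm_mult)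
    also have "\<dots> \<le> cmod (?a + m n n) + cmod (?a - m n n)" by (rule norm_triangle_ineq4)
    finally have "cmod (m n n) \<le> cmod (?a + m n n) \<or> cmod (m n n) \<le> cmod (?a - m n n)" by linarith
    then show "\<exists>r. ?P f n r"
    proof
      assume "cmod (m n n) \<le> cmod (?a + m n n)" then show ?thesis by (intro exI[of _ 1]) simp
    next
      assume "cmod (m n n) \<le> cmod (?a - m n n)" then show ?thesis by (intro exI[of _ "-1"]) simp
    qed
  qed
  then show ?thesis .
qed

text \<open>Superposition of normalised functions with weights \<open>3\<^sup>-\<^sup>i\<close>. The \<open>p\<close>-th power of the sum is
  dominated by \<open>3\<^sup>p\<close> times the integrable function \<open>T = \<Sum>\<^sub>i 2\<^sup>-\<^sup>i \<bar>\<phi>\<^sub>i\<bar>\<^sup>p\<close>, since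
  \<open>\<bar>\<phi>\<^sub>i\<bar> \<le> 2\<^sup>i T\<^sup>1\<^sup>/\<^sup>p\<close>.\<close>

lemma weighted_superposition:
  fixes \<phi> :: "nat \<Rightarrow> 'a::euclidean_space \<Rightarrow> complex" and \<epsilon> :: "nat \<Rightarrow> real"
  assumes p: "1 < p" and meas: "\<And>i. \<phi> i \<in> borel_measurable surface_measure"
    and int: "\<And>i. integrable surface_measure (\<lambda>x. cmod (\<phi> i x) powr p)"
    and one: "\<And>i. (\<integral>x. cmod (\<phi> i x) powr p \<partial>surface_measure) = 1"
    and \<epsilon>: "\<And>i. \<bar>\<epsilon> i\<bar> = 1"
  obtains \<Phi> where "\<Phi> \<in> borel_measurable surface_measure"
    "integrable surface_measure (\<lambda>x. cmod (\<Phi> x) powr p)"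
    "\<And>G. continuous_on (sphere 0 1) G \<Longrightarrow>
      (\<lambda>i. of_real (\<epsilon> i) * (of_real ((1 / 3) ^ i) * (\<integral>x. \<phi> i x * G x \<partial>surface_measure))) sums
      (\<integral>x. \<Phi> x * G x \<partial>surface_measure)"
proof -
  note [measurable] = meas
  let ?t = "\<lambda>i x. (1 / 2) ^ i * cmod (\<phi> i x) powr p"
  let ?u = "\<lambda>i x. of_real (\<epsilon> i * (1 / 3) ^ i) * \<phi> i x"
  define \<Phi> where "\<Phi> x = (\<Sum>i. ?u i x)" for x
  have int_t: "integrable surface_measure (?t i)" for i using int by simp
  have "(\<integral>\<^sup>+x. (\<Sum>i. ennreal (?t i x)) \<partial>surface_measure) = (\<Sum>i. \<integral>\<^sup>+x. ennreal (?t i x) \<partial>surface_measure)"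
    by (intro nn_integral_suminf) measurable
  also have "\<dots> = (\<Sum>i. ennreal ((1 / 2) ^ i))"
    using int_t one by (intro suminf_cong) (simp add: nn_integral_eq_integral)
  also have "\<dots> = ennreal (\<Sum>i. (1 / 2) ^ i)"
    by (intro suminf_ennreal2 summable_geometric) auto
  finally have "(\<integral>\<^sup>+x. (\<Sum>i. ennreal (?t i x)) \<partial>surface_measure) \<noteq> \<infinity>" by simp
  then have "AE x in surface_measure. (\<Sum>i. ennreal (?t i x)) \<noteq> \<infinity>"
    by (rule nn_integral_PInf_AE[rotated]) measurable
  then have sum_t: "AE x in surface_measure. summable (\<lambda>i. ?t i x)"
    by eventually_elim (rule summable_suminf_not_top, auto)
  have int_T: "integrable surface_measure (\<lambda>x. \<Sum>i. ?t i x)"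
  proof (rule integrable_suminf[OF int_t])
    show "AE x in surface_measure. summable (\<lambda>i. norm (?t i x))" using sum_t by simp
    show "summable (\<lambda>i. \<integral>x. norm (?t i x) \<partial>surface_measure)" using one by (simp add: summable_geometric)
  qed
  have bound: "summable (\<lambda>i. norm (?u i x)) \<and> cmod (\<Phi> x) powr p \<le> 3 powr p * (\<Sum>i. ?t i x)"
    if s: "summable (\<lambda>i. ?t i x)" for x
  proof -
    define T where "T = (\<Sum>i. ?t i x)"
    have T0: "0 \<le> T" unfolding T_def by (intro suminf_nonneg s) auto
    have le: "cmod (\<phi> i x) \<le> 2 ^ i * T powr (1 / p)" for i
    proof -
      have "(1 / 2) ^ i * cmod (\<phi> i x) powr p \<le> T"
        unfolding T_def using sum_le_suminf[OF s, of "{i}"] by simp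
      then have "cmod (\<phi> i x) powr p \<le> 2 ^ i * T" by (simp add: field_simps power_divide)
      also have "\<dots> \<le> (2 ^ i) powr p * T"
        using p T0 powr_mono[of 1 p "2 ^ i"] by (intro mult_right_mono) auto
      finally have "(cmod (\<phi> i x) powr p) powr (1 / p) \<le> ((2 ^ i) powr p * T) powr (1 / p)"
        using p by (intro powr_mono2) auto
      then show ?thesis using p T0 by (simp add: powr_powr powr_mult)
    qed
    have ub: "norm (?u i x) \<le> (2 / 3) ^ i * T powr (1 / p)" for i
    proof -
      have "norm (?u i x) = (1 / 3) ^ i * cmod (\<phi> i x)" using \<epsilon>[of i] by (simp add: norm_mult norm_power norm_divide)
      also have "\<dots> \<le> (1 / 3) ^ i * (2 ^ i * T powr (1 / p))" by (intro mult_left_mono le) auto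
      finally show ?thesis by (simp add: power_divide)
    qed
    have g: "(\<lambda>i. (2 / 3) ^ i * T powr (1 / p)) sums (3 * T powr (1 / p))"
      using sums_mult2[OF geometric_sums[of "2/3 :: real"], of "T powr (1 / p)"] by simp
    have su: "summable (\<lambda>i. norm (?u i x))"
      by (rule summable_comparison_test'[OF sums_summable[OF g], of 0]) (use ub in simp)
    have "cmod (\<Phi> x) \<le> (\<Sum>i. (2 / 3) ^ i * T powr (1 / p))"
      unfolding \<Phi>_def by (rule norm_suminf_le[OF ub sums_summable[OF g]])
    also have "\<dots> = 3 * T powr (1 / p)" using sums_unique[OF g] by simp
    finally have "cmod (\<Phi> x) powr p \<le> (3 * T powr (1 / p)) powr p" using p by (intro powr_mono2) auto
    also have "\<dots> = 3 powr p * T" using p T0 by (simp add: powr_mult powr_powr)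
    finally show ?thesis using su by (simp add: T_def)
  qed
  have \<Phi>_meas [measurable]: "\<Phi> \<in> borel_measurable surface_measure"
    unfolding \<Phi>_def by measurable
  have \<Phi>_int: "integrable surface_measure (\<lambda>x. cmod (\<Phi> x) powr p)"
  proof (rule Bochner_Integration.integrable_bound)
    show "integrable surface_measure (\<lambda>x. 3 powr p * (\<Sum>i. ?t i x))" using int_T by simp
    show "AE x in surface_measure. norm (cmod (\<Phi> x) powr p) \<le> norm (3 powr p * (\<Sum>i. ?t i x))"
      using sum_t
    proof eventually_elim
      case (elim x)
      from bound[OF this] show ?case by (simp add: order_trans[OF _ abs_ge_self])
    qed
  qed measurable
  have "(\<lambda>i. of_real (\<epsilon> i) * (of_real ((1 / 3) ^ i) * (\<integral>x. \<phi> i x * G x \<partial>surface_measure))) sums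
      (\<integral>x. \<Phi> x * G x \<partial>surface_measure)" if G: "continuous_on (sphere 0 1) G" for G
  proof -
    have "bounded (G ` sphere 0 1)" by (intro compact_imp_bounded compact_continuous_image G) auto
    then obtain B where B: "\<forall>y\<in>G ` sphere 0 1. norm y \<le> B" unfolding bounded_iff by blast
    then have B: "cmod (G x) \<le> B" if "norm x = 1" for x using that by auto
    have B0: "0 \<le> B" using order_trans[OF norm_ge_zero B[OF direction_sphere]] .
    note [measurable] = surface_measurable[OF G]
    have \<phi>_int: "integrable surface_measure (\<phi> i)" for i by (rule integrable_of_powr[OF p meas int])
    have \<phi>G: "integrable surface_measure (\<lambda>x. \<phi> i x * G x)" for i
    proof (rule Bochner_Integration.integrable_bound)
      show "integrable surface_measure (\<lambda>x. B * cmod (\<phi> i x))" using \<phi>_int by simp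
      show "AE x in surface_measure. norm (\<phi> i x * G x) \<le> norm (B * cmod (\<phi> i x))"
        using B B0 by (intro AE_I2) (auto simp: norm_mult abs_mult mult.commute[of B] intro!: mult_left_mono)
    qed measurable
    have \<phi>L1: "(\<integral>x. cmod (\<phi> i x) \<partial>surface_measure) \<le> measure (surface_measure :: 'a measure) (sphere 0 1) + 1" for i
    proof -
      have "(\<integral>x. cmod (\<phi> i x) \<partial>surface_measure) \<le> (\<integral>x. 1 + cmod (\<phi> i x) powr p \<partial>surface_measure)"
        using int \<phi>_int by (intro integral_mono le_one_plus_powr p) auto
      also have "\<dots> = measure (surface_measure :: 'a measure) (sphere 0 1) + 1"
        using int one by simp
      finally show ?thesis .
    qed
    have i1: "integrable surface_measure (\<lambda>x. ?u i x * G x)" for i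
      using integrable_mult_right[OF \<phi>G[of i], of "of_real (\<epsilon> i * (1 / 3) ^ i)"] by (simp add: mult.assoc)
    have i2: "AE x in surface_measure. summable (\<lambda>i. norm (?u i x * G x))"
      using sum_t
    proof eventually_elim
      case (elim x)
      then show ?case unfolding norm_mult[of _ "G x"] using bound by (intro summable_mult2) blast
    qed
    have i3: "summable (\<lambda>i. \<integral>x. norm (?u i x * G x) \<partial>surface_measure)"
    proof (rule summable_comparison_test'[where N = 0])
      show "summable (\<lambda>i. (1 / 3) ^ i * (B * (measure (surface_measure :: 'a measure) (sphere 0 1) + 1)))"
        by (intro summable_mult2 summable_geometric) auto
      fix i
      have "(\<integral>x. norm (?u i x * G x) \<partial>surface_measure) \<le> (\<integral>x. (1 / 3) ^ i * (B * cmod (\<phi> i x)) \<partial>surface_measure)"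
      proof (rule integral_mono)
        show "integrable surface_measure (\<lambda>x. norm (?u i x * G x))" using i1 by (rule integrable_norm)
        show "integrable surface_measure (\<lambda>x. (1 / 3) ^ i * (B * cmod (\<phi> i x)))" using \<phi>_int by simp
        show "norm (?u i x * G x) \<le> (1 / 3) ^ i * (B * cmod (\<phi> i x))" if "x \<in> space surface_measure" for x
          using B[of x] that \<epsilon>[of i] by (simp add: norm_mult norm_power norm_divide mult.commute[of B] mult.assoc mult_left_mono)
      qed
      also have "\<dots> = (1 / 3) ^ i * (B * (\<integral>x. cmod (\<phi> i x) \<partial>surface_measure))" by simp
      also have "\<dots> \<le> (1 / 3) ^ i * (B * (measure (surface_measure :: 'a measure) (sphere 0 1) + 1))"
        using B0 by (intro mult_left_mono \<phi>L1) auto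
      finally show "norm (\<integral>x. norm (?u i x * G x) \<partial>surface_measure) \<le>
          (1 / 3) ^ i * (B * (measure (surface_measure :: 'a measure) (sphere 0 1) + 1))" by simp
    qed
    have "(\<lambda>i. \<integral>x. ?u i x * G x \<partial>surface_measure) sums (\<integral>x. (\<Sum>i. ?u i x * G x) \<partial>surface_measure)"
      by (rule sums_integral[OF i1 i2 i3])
    also have "(\<integral>x. (\<Sum>i. ?u i x * G x) \<partial>surface_measure) = (\<integral>x. \<Phi> x * G x \<partial>surface_measure)"
    proof (rule integral_cong_AE)
      show "AE x in surface_measure. (\<Sum>i. ?u i x * G x) = \<Phi> x * G x"
        using sum_t
      proof eventually_elim
        case (elim x)
        have "summable (\<lambda>i. ?u i x)" by (rule summable_norm_cancel[OF conjunct1[OF bound[OF elim]]])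
        then show ?case unfolding \<Phi>_def by (rule suminf_mult2[symmetric])
      qed
    qed measurable
    finally have "(\<lambda>i. \<integral>x. ?u i x * G x \<partial>surface_measure) sums (\<integral>x. \<Phi> x * G x \<partial>surface_measure)" .
    moreover have "(\<integral>x. ?u i x * G x \<partial>surface_measure) =
        of_real (\<epsilon> i) * (of_real ((1 / 3) ^ i) * (\<integral>x. \<phi> i x * G x \<partial>surface_measure))" for i
      unfolding mult.assoc integral_mult_right_zero by (simp add: mult.assoc)
    ultimately show ?thesis by simp
  qed
  then show ?thesis using that[OF \<Phi>_meas \<Phi>_int] by blast
qed

section \<open>The multiplier theorem\<close>

context harmonic_basis
begin

lemma weighted_sup_iff:
  "f \<in> weighted_sup_space \<beta> \<longleftrightarrow>
    f \<in> harmonic_ball \<and> (\<exists>M. \<forall>x\<in>ball 0 1. (1 - (norm x)\<^sup>2) powr \<beta> * cmod (f x) \<le> M)"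
  unfolding weighted_sup_space_def by (simp only: mem_Collect_eq ereal_SUP_finite_iff)

lemma hardy_iff:
  "f \<in> harmonic_hardy s \<longleftrightarrow> f \<in> harmonic_ball \<and> (\<exists>M. \<forall>r\<in>{0..<1}. sphere_mean s f r \<le> M)"
  unfolding harmonic_hardy_def by (simp only: mem_Collect_eq ereal_SUP_finite_iff)

lemma sphere_mean_eq: "sphere_mean s f r = surface_norm s (\<lambda>x. f (r *\<^sub>R x))"
  by (simp add: sphere_mean_def surface_norm_def)

lemma surface_integrable_powr:
  fixes G :: "'a \<Rightarrow> complex"
  assumes "continuous_on (sphere 0 1) G" "0 < p"
  shows "integrable surface_measure (\<lambda>x. cmod (G x) powr p)"
  by (intro surface_integrable continuous_on_powr' continuous_intros assms) (use assms in auto)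

text \<open>Mere pointwise convergence identifies the coefficients of the sum, by uniqueness; if the sum is
  harmonic, they are integrals over spheres and therefore grow subexponentially.\<close>

lemma series_harmonic_iff:
  "series_converges d Y c \<and> series_function d Y c \<in> harmonic_ball \<longleftrightarrow> subexp_coeff c"
proof
  assume c: "series_converges d Y c \<and> series_function d Y c \<in> harmonic_ball"
  have "harmonic_term d Y c x sums series_function d Y c x" if "norm x < 1" for x
    using c that unfolding series_converges_def series_function_def by (simp add: summable_sums)
  then have eq: "harmonic_coeff d Y (series_function d Y c) k j = c k j" if "j \<in> {1..d k}" for k j
    using that by (rule harmonic_coeff_series)
  obtain \<beta> where "subexp \<beta>" "\<And>k j. j \<in> {1..d k} \<Longrightarrow> cmod (harmonic_coeff d Y (series_function d Y c) k j) \<le> \<bar>\<beta> k\<bar>"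
    using harmonic_coeff_subexp[of "series_function d Y c"] c by (auto elim: subexp_coeffE)
  then show "subexp_coeff c"
    using eq by (intro subexp_coeffI[OF subexp_mono[of \<beta> "\<lambda>k. \<bar>\<beta> k\<bar>"]]) auto
next
  assume "subexp_coeff c"
  then show "series_converges d Y c \<and> series_function d Y c \<in> harmonic_ball"
    using subexp_coeff_converges subexp_coeff_harmonic by blast
qed

lemma harmonic_coeff_series_function:
  assumes "subexp_coeff c" "j \<in> {1..d k}"
  shows "harmonic_coeff d Y (series_function d Y c) k j = c k j"
  by (rule harmonic_coeff_series[OF subexp_coeff_sums[OF assms(1)] assms(2)])

lemma harmonic_conv_poisson:
  assumes "subexp_coeff c" "norm x = 1"
  shows "harmonic_conv d Y (series_function d Y c) (poisson_kernel x) w = conv_kernel c w x"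
  unfolding harmonic_conv_def conv_kernel_def
  by (rule series_function_cong) (simp add: harmonic_coeff_series_function[OF assms(1)] poisson_coeff[OF assms(2)])

lemma series_function_scale:
  "series_function d Y (\<lambda>k j. of_real (r ^ k) * b k j) w = series_function d Y b (r *\<^sub>R w)"
proof -
  have "harmonic_term d Y (\<lambda>k j. of_real (r ^ k) * b k j) w k = harmonic_term d Y b (r *\<^sub>R w) k" for k
    unfolding harmonic_term_eq
    by (intro sum.cong refl) (simp add: solid_harmonicD(2)[OF solid_harmonic_solid])
  then show ?thesis unfolding series_function_def by (rule suminf_cong)
qed

text \<open>On the sphere of radius \<open>r\<close> the convolution is an integral of \<open>f\<close> against the kernel, to which
  Hoelder's inequality applies; the radius then tends to \<open>1\<close>.\<close>

lemma convolution_bound: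
  assumes pq: "1 < p" "1 < q" "1 / p + 1 / q = 1"
    and c: "subexp_coeff c" and f: "f \<in> harmonic_ball"
    and M: "\<And>r. r \<in> {0..<1} \<Longrightarrow> sphere_mean p f r \<le> M" and w: "norm w < 1"
  shows "cmod (series_function d Y (\<lambda>k j. c k j * harmonic_coeff d Y f k j) w) \<le>
    M * surface_norm q (conv_kernel c w)"
proof -
  define u where "u = series_function d Y (\<lambda>k j. c k j * harmonic_coeff d Y f k j)"
  note Gc = conv_kernel_continuous[OF c w]
  have bound: "cmod (u (r *\<^sub>R w)) \<le> M * surface_norm q (conv_kernel c w)" if r: "0 < r" "r < 1" for r
  proof -
    have fc: "continuous_on (sphere 0 1) (\<lambda>x. f (r *\<^sub>R x))"
      by (rule harmonic_ball_sphere_continuous[OF f]) (use r in auto)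
    have "u (r *\<^sub>R w) = series_function d Y (\<lambda>k j. of_real (r ^ k) * (c k j * harmonic_coeff d Y f k j)) w"
      unfolding u_def by (rule series_function_scale[symmetric])
    also have "\<dots> = series_function d Y (\<lambda>k j. c k j * sphere_coeff (\<lambda>x. f (r *\<^sub>R x)) k j) w"
      by (rule series_function_cong) (simp add: harmonic_function_expansion(3)[OF f r])
    also have "\<dots> = (\<integral>x. f (r *\<^sub>R x) * conv_kernel c w x \<partial>surface_measure)"
      by (rule conv_kernel_integral[OF c w surface_integrable[OF fc], symmetric])
    finally have "cmod (u (r *\<^sub>R w)) \<le> surface_norm p (\<lambda>x. f (r *\<^sub>R x)) * surface_norm q (conv_kernel c w)"
      using pq surface_Hoelder[OF pq surface_measurable[OF fc] surface_measurable[OF Gc]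
          surface_integrable_powr[OF fc] surface_integrable_powr[OF Gc]] by simp
    also have "\<dots> \<le> M * surface_norm q (conv_kernel c w)"
      using M[of r] r by (intro mult_right_mono) (auto simp: sphere_mean_eq surface_norm_def)
    finally show ?thesis .
  qed
  have "u \<in> harmonic_ball"
    unfolding u_def by (intro subexp_coeff_harmonic subexp_coeff_mult c harmonic_coeff_subexp f)
  then have "continuous_on (ball 0 1) u"
    unfolding harmonic_ball_def by (simp add: harmonic_on_continuous)
  then have "isCont u w" using w by (simp add: continuous_on_eq_continuous_at)
  moreover have "((\<lambda>r. r *\<^sub>R w) \<longlongrightarrow> 1 *\<^sub>R w) (at_left (1::real))" by (intro tendsto_intros)
  ultimately have "((\<lambda>r. u (r *\<^sub>R w)) \<longlongrightarrow> u w) (at_left (1::real))"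
    using isCont_tendsto_compose[of w u "\<lambda>r. r *\<^sub>R w" "at_left (1::real)"] by simp
  then have "((\<lambda>r. cmod (u (r *\<^sub>R w))) \<longlongrightarrow> cmod (u w)) (at_left (1::real))" by (rule tendsto_norm)
  moreover have "\<forall>\<^sub>F r in at_left (1::real). cmod (u (r *\<^sub>R w)) \<le> M * surface_norm q (conv_kernel c w)"
    by (rule eventually_at_leftI[of 0]) (use bound in auto)
  ultimately have "cmod (u w) \<le> M * surface_norm q (conv_kernel c w)"
    by (rule tendsto_upperbound) simp
  then show ?thesis by (simp add: u_def)
qed

text \<open>Poisson integrals of \<open>L\<^sup>p\<close> functions lie in the Hardy space: for fixed \<open>r\<close> the Poisson kernel is
  a probability density in either of its spherical variables, so that averaging with it does not
  increase the norm.\<close>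

lemma poisson_pointwise_powr:
  assumes p: "1 < p" and \<phi> [measurable]: "\<phi> \<in> borel_measurable surface_measure"
    and int: "integrable surface_measure (\<lambda>x. cmod (\<phi> x) powr p)"
    and z: "norm z = 1" and r: "0 < r" "r < 1"
  shows "integrable surface_measure (\<lambda>x. cmod (\<phi> x) powr p * poisson x (r *\<^sub>R z))"
    and "cmod (series_function d Y (sphere_coeff \<phi>) (r *\<^sub>R z)) powr p \<le>
      (\<integral>x. cmod (\<phi> x) powr p * poisson x (r *\<^sub>R z) \<partial>surface_measure)"
proof -
  define q where "q = p / (p - 1)"
  have pq: "1 < p" "1 < q" "1 / p + 1 / q = 1" using p by (auto simp: q_def field_simps)
  have w: "norm (r *\<^sub>R z) < 1" using r z by simp
  have P0: "0 \<le> poisson x (r *\<^sub>R z)" for x by (rule poisson_nonneg[OF w])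
  note Pc = poisson_sphere_continuous[OF w]
  note [measurable] = surface_measurable[OF Pc]
  show I: "integrable surface_measure (\<lambda>x. cmod (\<phi> x) powr p * poisson x (r *\<^sub>R z))"
    using surface_integrable_mult[OF Pc int] by (simp add: mult.commute)
  have P1: "(\<integral>x. poisson x (r *\<^sub>R z) \<partial>surface_measure) = 1" by (rule poisson_integral_1(2)[OF z r])
  have powers: "(cmod (\<phi> x) * poisson x (r *\<^sub>R z) powr (1 / p)) powr p = cmod (\<phi> x) powr p * poisson x (r *\<^sub>R z)"
    "(poisson x (r *\<^sub>R z) powr (1 / q)) powr q = poisson x (r *\<^sub>R z)"
    "(cmod (\<phi> x) * poisson x (r *\<^sub>R z) powr (1 / p)) * poisson x (r *\<^sub>R z) powr (1 / q) = cmod (\<phi> x) * poisson x (r *\<^sub>R z)" for x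
  proof -
    show "(cmod (\<phi> x) * poisson x (r *\<^sub>R z) powr (1 / p)) powr p = cmod (\<phi> x) powr p * poisson x (r *\<^sub>R z)"
      using pq P0[of x] by (simp add: powr_mult powr_powr)
    show "(poisson x (r *\<^sub>R z) powr (1 / q)) powr q = poisson x (r *\<^sub>R z)"
      using pq P0[of x] by (simp add: powr_powr)
    have "poisson x (r *\<^sub>R z) powr (1 / p) * poisson x (r *\<^sub>R z) powr (1 / q) = poisson x (r *\<^sub>R z)"
      using P0[of x] by (simp only: powr_add[symmetric] pq powr_one)
    then show "(cmod (\<phi> x) * poisson x (r *\<^sub>R z) powr (1 / p)) * poisson x (r *\<^sub>R z) powr (1 / q) = cmod (\<phi> x) * poisson x (r *\<^sub>R z)"
      by (simp only: mult.assoc)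
  qed
  have "cmod (series_function d Y (sphere_coeff \<phi>) (r *\<^sub>R z)) =
      cmod (\<integral>x. \<phi> x * of_real (poisson x (r *\<^sub>R z)) \<partial>surface_measure)"
    by (simp only: poisson_integral[OF integrable_of_powr[OF p \<phi> int] w])
  also have "\<dots> \<le> (\<integral>x. cmod (\<phi> x * of_real (poisson x (r *\<^sub>R z))) \<partial>surface_measure)"
    by (rule integral_norm_bound)
  also have "\<dots> = (\<integral>x. (cmod (\<phi> x) * poisson x (r *\<^sub>R z) powr (1 / p)) * poisson x (r *\<^sub>R z) powr (1 / q) \<partial>surface_measure)"
    unfolding powers(3) using P0 by (simp add: norm_mult)
  also have "\<dots> \<le> (\<integral>x. (cmod (\<phi> x) * poisson x (r *\<^sub>R z) powr (1 / p)) powr p \<partial>surface_measure) powr (1 / p) *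
      (\<integral>x. (poisson x (r *\<^sub>R z) powr (1 / q)) powr q \<partial>surface_measure) powr (1 / q)"
  proof (rule Hoelder_inequality(2)[OF pq])
    show "integrable surface_measure (\<lambda>x. (cmod (\<phi> x) * poisson x (r *\<^sub>R z) powr (1 / p)) powr p)"
      unfolding powers(1) by (rule I)
    show "integrable surface_measure (\<lambda>x. (poisson x (r *\<^sub>R z) powr (1 / q)) powr q)"
      unfolding powers(2) by (rule surface_integrable[OF Pc])
  qed auto
  also have "\<dots> = (\<integral>x. cmod (\<phi> x) powr p * poisson x (r *\<^sub>R z) \<partial>surface_measure) powr (1 / p)"
    unfolding powers P1 by simp
  finally have "cmod (series_function d Y (sphere_coeff \<phi>) (r *\<^sub>R z)) powr p \<le>
      ((\<integral>x. cmod (\<phi> x) powr p * poisson x (r *\<^sub>R z) \<partial>surface_measure) powr (1 / p)) powr p"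
    using p by (intro powr_mono2) auto
  also have "\<dots> = (\<integral>x. cmod (\<phi> x) powr p * poisson x (r *\<^sub>R z) \<partial>surface_measure)"
    using p P0 by (simp add: powr_powr Bochner_Integration.integral_nonneg)
  finally show "cmod (series_function d Y (sphere_coeff \<phi>) (r *\<^sub>R z)) powr p \<le>
      (\<integral>x. cmod (\<phi> x) powr p * poisson x (r *\<^sub>R z) \<partial>surface_measure)" .
qed

lemma poisson_integral_hardy:
  assumes p: "1 < p" and \<phi> [measurable]: "\<phi> \<in> borel_measurable surface_measure"
    and int: "integrable surface_measure (\<lambda>x. cmod (\<phi> x) powr p)"
  shows "series_function d Y (sphere_coeff \<phi>) \<in> harmonic_hardy p"
proof -
  define f where "f = series_function d Y (sphere_coeff \<phi>)"
  let ?\<sigma> = "surface_measure :: 'a measure"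
  define A where "A = (\<integral>x. cmod (\<phi> x) powr p \<partial>?\<sigma>)"
  have f: "f \<in> harmonic_ball"
    unfolding f_def by (intro subexp_coeff_harmonic sphere_coeff_subexp integrable_of_powr[OF p \<phi> int])
  interpret pair_sigma_finite ?\<sigma> ?\<sigma>
    by (intro pair_sigma_finite.intro surface.sigma_finite_measure_axioms)
  have bound: "sphere_mean p f r \<le> A powr (1 / p)" if r: "0 < r" "r < 1" for r
  proof -
    have fc: "continuous_on (sphere 0 1) (\<lambda>x. f (r *\<^sub>R x))"
      by (rule harmonic_ball_sphere_continuous[OF f]) (use r in auto)
    have [measurable]: "(\<lambda>x. x) \<in> borel_measurable ?\<sigma>"
      by (intro surface_measurable continuous_intros)
    have m: "(\<lambda>(x, z). ennreal (cmod (\<phi> x) powr p * poisson x (r *\<^sub>R z))) \<in> borel_measurable (?\<sigma> \<Otimes>\<^sub>M ?\<sigma>)"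
      unfolding poisson_def by measurable
    have fi: "integrable ?\<sigma> (\<lambda>z. cmod (f (r *\<^sub>R z)) powr p)"
      using p by (intro surface_integrable_powr fc) simp
    have "ennreal (\<integral>z. cmod (f (r *\<^sub>R z)) powr p \<partial>?\<sigma>) = (\<integral>\<^sup>+z. ennreal (cmod (f (r *\<^sub>R z)) powr p) \<partial>?\<sigma>)"
      by (rule nn_integral_eq_integral[symmetric, OF fi]) simp
    also have "\<dots> \<le> (\<integral>\<^sup>+z. (\<integral>\<^sup>+x. ennreal (cmod (\<phi> x) powr p * poisson x (r *\<^sub>R z)) \<partial>?\<sigma>) \<partial>?\<sigma>)"
    proof (rule nn_integral_mono)
      fix z :: 'a assume "z \<in> space ?\<sigma>"
      then have z: "norm z = 1" by simp
      have w: "norm (r *\<^sub>R z) < 1" using r z by simp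
      have "(\<integral>\<^sup>+x. ennreal (cmod (\<phi> x) powr p * poisson x (r *\<^sub>R z)) \<partial>?\<sigma>) =
          ennreal (\<integral>x. cmod (\<phi> x) powr p * poisson x (r *\<^sub>R z) \<partial>?\<sigma>)"
        using poisson_nonneg[OF w]
        by (intro nn_integral_eq_integral poisson_pointwise_powr(1)[OF p \<phi> int z r]) auto
      then show "ennreal (cmod (f (r *\<^sub>R z)) powr p) \<le> (\<integral>\<^sup>+x. ennreal (cmod (\<phi> x) powr p * poisson x (r *\<^sub>R z)) \<partial>?\<sigma>)"
        using poisson_pointwise_powr(2)[OF p \<phi> int z r] by (simp add: f_def ennreal_leI)
    qed
    also have "\<dots> = (\<integral>\<^sup>+x. (\<integral>\<^sup>+z. ennreal (cmod (\<phi> x) powr p * poisson x (r *\<^sub>R z)) \<partial>?\<sigma>) \<partial>?\<sigma>)"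
      using Fubini'[OF m] by simp
    also have "\<dots> = (\<integral>\<^sup>+x. ennreal (cmod (\<phi> x) powr p) \<partial>?\<sigma>)"
    proof (rule nn_integral_cong)
      fix x :: 'a assume "x \<in> space ?\<sigma>"
      then have x: "norm x = 1" by simp
      have Pc: "continuous_on (sphere 0 1) (\<lambda>z. poisson x (r *\<^sub>R z))"
        by (rule continuous_on_compose2[OF harmonic_on_continuous[OF poisson_harmonic[OF x]]])
           (use r in \<open>auto intro!: continuous_intros\<close>)
      have "(\<integral>\<^sup>+z. ennreal (cmod (\<phi> x) powr p * poisson x (r *\<^sub>R z)) \<partial>?\<sigma>) =
          ennreal (\<integral>z. cmod (\<phi> x) powr p * poisson x (r *\<^sub>R z) \<partial>?\<sigma>)"
      proof (rule nn_integral_eq_integral)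
        show "integrable ?\<sigma> (\<lambda>z. cmod (\<phi> x) powr p * poisson x (r *\<^sub>R z))"
          by (intro integrable_mult_right surface_integrable Pc)
        show "AE z in ?\<sigma>. 0 \<le> cmod (\<phi> x) powr p * poisson x (r *\<^sub>R z)"
          using r by (intro AE_I2 mult_nonneg_nonneg poisson_nonneg) auto
      qed
      also have "(\<integral>z. cmod (\<phi> x) powr p * poisson x (r *\<^sub>R z) \<partial>?\<sigma>) = cmod (\<phi> x) powr p"
        using poisson_integral_1(1)[OF x r] by simp
      finally show "(\<integral>\<^sup>+z. ennreal (cmod (\<phi> x) powr p * poisson x (r *\<^sub>R z)) \<partial>?\<sigma>) = ennreal (cmod (\<phi> x) powr p)" .
    qed
    also have "\<dots> = ennreal A" unfolding A_def by (rule nn_integral_eq_integral[OF int]) simp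
    finally have "(\<integral>z. cmod (f (r *\<^sub>R z)) powr p \<partial>?\<sigma>) \<le> A"
      by (subst (asm) ennreal_le_iff) (auto simp: A_def intro!: Bochner_Integration.integral_nonneg)
    then show ?thesis
      unfolding sphere_mean_def using p by (intro powr_mono2 Bochner_Integration.integral_nonneg) auto
  qed
  have "sphere_mean p f r \<le> max (sphere_mean p f 0) (A powr (1 / p))" if "r \<in> {0..<1}" for r
    using bound[of r] that by (cases "r = 0") (auto intro: max.coboundedI1 max.coboundedI2)
  then show ?thesis unfolding hardy_iff using f f_def by blast
qed

text \<open>A multiplier has subexponential coefficients, because it maps a bounded harmonic function whose
  coefficients decay only subexponentially to a harmonic function.\<close>

lemma multiplier_subexp:
  assumes p: "1 < p" and c: "c \<in> multipliers d Y (harmonic_hardy p) (weighted_sup_space \<beta>)"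
  shows "subexp_coeff c"
proof -
  \<comment> \<open>The weights \<open>1 / \<gamma>\<^sub>k\<close> make the \<open>k\<close>-th term at most \<open>1 / (k + 1)\<^sup>2\<close>.\<close>
  define \<gamma> where "\<gamma> k = (growth k * growth k) * (real (Suc k) * real (Suc k))" for k
  have g1: "1 \<le> growth k * growth k" for k
    using mult_mono[of 1 "growth k" 1 "growth k"] growth_ge_1[of k] by simp
  have \<gamma>1: "1 \<le> \<gamma> k" for k
    using mult_mono[of 1 "growth k * growth k" 1 "real (Suc k) * real (Suc k)"] g1[of k] mult_mono[of 1 "real (Suc k)" 1 "real (Suc k)"]
    by (simp add: \<gamma>_def)
  have \<gamma>_subexp: "subexp \<gamma>"
    unfolding \<gamma>_def by (intro subexp_mult subexp_growth subexp_linear)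
  define b :: "nat \<Rightarrow> nat \<Rightarrow> complex" where "b k j = of_real (1 / \<gamma> k)" for k j
  have bn: "cmod (b k j) = 1 / \<gamma> k" for k j
    using \<gamma>1[of k] by (simp add: b_def norm_divide)
  have b: "subexp_coeff b"
  proof (rule subexp_coeffI[OF subexp_const])
    show "cmod (b k j) \<le> 1" for k j
      unfolding bn using \<gamma>1[of k] by (intro divide_le_eq_1_pos[THEN iffD2]) linarith+
  qed
  define f where "f = series_function d Y b"
  have f_harm: "f \<in> harmonic_ball" unfolding f_def by (rule subexp_coeff_harmonic[OF b])
  have sq: "summable (\<lambda>k. 1 / (real (Suc k) * real (Suc k)))"
    using summable_ignore_initial_segment[OF inverse_power_summable[of 2, where 'a = real], of 1]
    by (simp add: power2_eq_square inverse_eq_divide)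
  define Q where "Q = (\<Sum>k. 1 / (real (Suc k) * real (Suc k)))"
  have f_bd: "cmod (f x) \<le> Q" if x: "norm x < 1" for x
    unfolding f_def series_function_def Q_def
  proof (rule norm_suminf_le[OF _ sq])
    fix k
    have "cmod (harmonic_term d Y b x k) \<le> \<bar>1 / \<gamma> k * (growth k * growth k)\<bar> * norm x ^ k"
      unfolding harmonic_term_eq by (rule expansion_term_bound) (simp only: bn abs_ge_self)
    also have "\<dots> \<le> \<bar>1 / \<gamma> k * (growth k * growth k)\<bar> * 1"
      using x by (intro mult_left_mono power_le_one) auto
    also have "\<dots> = 1 / (real (Suc k) * real (Suc k))"
    proof -
      have "growth k \<noteq> 0" using growth_ge_1[of k] by linarith
      then show ?thesis by (simp add: \<gamma>_def abs_mult abs_divide)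
    qed
    finally show "norm (harmonic_term d Y b x k) \<le> 1 / (real (Suc k) * real (Suc k))" .
  qed
  have Q0: "0 \<le> Q" unfolding Q_def by (intro suminf_nonneg sq) simp
  have "sphere_mean p f r \<le> (Q powr p * measure (surface_measure :: 'a measure) (sphere 0 1)) powr (1 / p)" if r: "r \<in> {0..<1}" for r
  proof -
    have fc: "continuous_on (sphere 0 1) (\<lambda>x. f (r *\<^sub>R x))"
      by (rule harmonic_ball_sphere_continuous[OF f_harm]) (use r in auto)
    have "(\<integral>x. cmod (f (r *\<^sub>R x)) powr p \<partial>surface_measure) \<le> (\<integral>x. Q powr p \<partial>(surface_measure :: 'a measure))"
    proof (rule integral_mono)
      show "integrable surface_measure (\<lambda>x. cmod (f (r *\<^sub>R x)) powr p)"
        using p by (intro surface_integrable_powr fc) simp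
      show "cmod (f (r *\<^sub>R x)) powr p \<le> Q powr p" if "x \<in> space surface_measure" for x
        using that r p by (intro powr_mono2 f_bd) auto
    qed simp
    then show ?thesis
      unfolding sphere_mean_def using p by (intro powr_mono2 Bochner_Integration.integral_nonneg) (auto simp: mult.commute)
  qed
  then have "f \<in> harmonic_hardy p" unfolding hardy_iff using f_harm by blast
  then have "series_converges d Y (\<lambda>k j. c k j * harmonic_coeff d Y f k j) \<and>
      series_function d Y (\<lambda>k j. c k j * harmonic_coeff d Y f k j) \<in> harmonic_ball"
    using c unfolding multipliers_def weighted_sup_iff by blast
  then have "subexp_coeff (\<lambda>k j. c k j * harmonic_coeff d Y f k j)" unfolding series_harmonic_iff .
  then obtain \<eta> where \<eta>: "subexp \<eta>" "\<And>k j. j \<in> {1..d k} \<Longrightarrow> cmod (c k j * harmonic_coeff d Y f k j) \<le> \<bar>\<eta> k\<bar>"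
    by (rule subexp_coeffE) blast
  show ?thesis
  proof (rule subexp_coeffI)
    show "subexp (\<lambda>k. \<bar>\<eta> k * \<gamma> k\<bar>)" by (rule subexp_mono[OF subexp_mult[OF \<eta>(1) \<gamma>_subexp]]) simp
    fix k j assume j: "j \<in> {1..d k}"
    have "cmod (c k j) / \<gamma> k \<le> \<bar>\<eta> k\<bar>"
      using \<eta>(2)[OF j] unfolding f_def harmonic_coeff_series_function[OF b j] norm_mult bn by simp
    then show "cmod (c k j) \<le> \<bar>\<eta> k * \<gamma> k\<bar>"
      using \<gamma>1[of k] by (simp add: abs_mult pos_divide_le_eq)
  qed
qed

text \<open>The gliding hump. Choose kernels \<open>G\<^sub>n\<close> whose weighted norms \<open>L\<^sub>n\<close> exceed \<open>4\<^sup>n\<close>, and extremal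
  functions \<open>\<phi>\<^sub>n\<close> for them. In the sum of the \<open>\<plusminus> 3\<^sup>-\<^sup>i \<phi>\<^sub>i\<close>, tested against \<open>G\<^sub>n\<close>, the terms up to \<open>n\<close> give at
  least \<open>3\<^sup>-\<^sup>n L\<^sub>n\<close> by the choice of the signs, while the later ones contribute at most half of this. What
  remains is at least \<open>(4/3)\<^sup>n / 2\<close>, but the multiplier property bounds it uniformly in \<open>n\<close>.\<close>

lemma multiplier_kernel_bounded:
  assumes pq: "1 < p" "1 < q" "1 / p + 1 / q = 1" and \<beta>: "0 < \<beta>"
    and c: "c \<in> multipliers d Y (harmonic_hardy p) (weighted_sup_space \<beta>)"
  shows "\<exists>M. \<forall>\<rho>\<in>{0..<1}. \<forall>y\<in>sphere 0 1. (1 - \<rho>) powr \<beta> * surface_norm q (conv_kernel c (\<rho> *\<^sub>R y)) \<le> M"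
proof (rule ccontr)
  assume "\<not> ?thesis"
  then have "\<forall>n::nat. \<exists>\<rho> y. \<rho> \<in> {0..<1} \<and> y \<in> sphere 0 1 \<and>
      4 ^ n < (1 - \<rho>) powr \<beta> * surface_norm q (conv_kernel c (\<rho> *\<^sub>R y))"
    by (meson not_le)
  then obtain \<rho> y where \<rho>y: "\<And>n::nat. \<rho> n \<in> {0..<1}" "\<And>n. y n \<in> sphere 0 1"
    "\<And>n. 4 ^ n < (1 - \<rho> n) powr \<beta> * surface_norm q (conv_kernel c (\<rho> n *\<^sub>R y n))"
    by metis
  note cs = multiplier_subexp[OF pq(1) c]
  define G where "G n = conv_kernel c (\<rho> n *\<^sub>R y n)" for n
  define L where "L n = (1 - \<rho> n) powr \<beta> * surface_norm q (G n)" for n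
  have L4: "4 ^ n < L n" for n using \<rho>y(3) by (simp add: L_def G_def)
  have L0: "0 < L n" for n by (rule less_trans[OF _ L4]) simp
  have w1: "norm (\<rho> n *\<^sub>R y n) < 1" for n using \<rho>y(1,2)[of n] by simp
  have Gc: "continuous_on (sphere 0 1) (G n)" for n
    unfolding G_def by (rule conv_kernel_continuous[OF cs w1])
  have Gm: "G n \<in> borel_measurable surface_measure" for n by (rule surface_measurable[OF Gc])
  have Gi: "integrable surface_measure (\<lambda>x. cmod (G n x) powr q)" for n
    using pq by (intro surface_integrable_powr Gc) simp
  have GL: "0 < surface_norm q (G n)" for n
    using L0[of n] by (simp add: L_def zero_less_mult_iff)
  have ex: "\<exists>\<phi>. \<phi> \<in> borel_measurable surface_measure \<and>
      integrable surface_measure (\<lambda>x. cmod (\<phi> x) powr p) \<and>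
      (\<integral>x. cmod (\<phi> x) powr p \<partial>surface_measure) = 1 \<and>
      (\<integral>x. \<phi> x * G n x \<partial>surface_measure) = of_real (surface_norm q (G n))" for n
    by (rule dual_extremal[OF pq Gm Gi GL]) blast
  from choice[OF allI[OF ex]] obtain \<phi> where "\<forall>n. \<phi> n \<in> borel_measurable surface_measure \<and>
      integrable surface_measure (\<lambda>x. cmod (\<phi> n x) powr p) \<and>
      (\<integral>x. cmod (\<phi> n x) powr p \<partial>surface_measure) = 1 \<and>
      (\<integral>x. \<phi> n x * G n x \<partial>surface_measure) = of_real (surface_norm q (G n))"
    by (rule exE)
  then have \<phi>: "\<And>n. \<phi> n \<in> borel_measurable surface_measure"
    "\<And>n. integrable surface_measure (\<lambda>x. cmod (\<phi> n x) powr p)"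
    "\<And>n. (\<integral>x. cmod (\<phi> n x) powr p \<partial>surface_measure) = 1"
    "\<And>n. (\<integral>x. \<phi> n x * G n x \<partial>surface_measure) = of_real (surface_norm q (G n))"
    by simp_all
  define m where "m n i = of_real ((1 - \<rho> n) powr \<beta>) * (of_real ((1 / 3) ^ i) * (\<integral>x. \<phi> i x * G n x \<partial>surface_measure))" for n i
  have m_diag: "cmod (m n n) = (1 / 3) ^ n * L n" for n
    using L0[of n] GL[of n] by (simp add: m_def \<phi>(4) L_def norm_mult norm_power norm_divide abs_mult)
  have m_le: "cmod (m n i) \<le> (1 / 3) ^ i * L n" for n i
  proof -
    have "cmod (\<integral>x. \<phi> i x * G n x \<partial>surface_measure) \<le> surface_norm p (\<phi> i) * surface_norm q (G n)"
      by (rule surface_Hoelder[OF pq \<phi>(1) Gm \<phi>(2) Gi])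
    also have "surface_norm p (\<phi> i) = 1" by (simp add: surface_norm_def \<phi>(3))
    finally have "(1 - \<rho> n) powr \<beta> * ((1 / 3) ^ i * cmod (\<integral>x. \<phi> i x * G n x \<partial>surface_measure)) \<le>
        (1 - \<rho> n) powr \<beta> * ((1 / 3) ^ i * surface_norm q (G n))"
      by (intro mult_left_mono) auto
    then show ?thesis by (simp add: m_def L_def norm_mult norm_power norm_divide mult_ac)
  qed
  obtain \<epsilon> :: "nat \<Rightarrow> real" where \<epsilon>: "\<And>n. \<bar>\<epsilon> n\<bar> = 1"
    "\<And>n. cmod (m n n) \<le> cmod ((\<Sum>i<n. of_real (\<epsilon> i) * m n i) + of_real (\<epsilon> n) * m n n)"
    using gliding_hump_signs[of m] by blast
  obtain \<Phi> where \<Phi>: "\<Phi> \<in> borel_measurable surface_measure"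
    "integrable surface_measure (\<lambda>x. cmod (\<Phi> x) powr p)"
    "\<And>G. continuous_on (sphere 0 1) G \<Longrightarrow>
      (\<lambda>i. of_real (\<epsilon> i) * (of_real ((1 / 3) ^ i) * (\<integral>x. \<phi> i x * G x \<partial>surface_measure))) sums
      (\<integral>x. \<Phi> x * G x \<partial>surface_measure)"
    by (rule weighted_superposition[where \<phi> = \<phi> and \<epsilon> = \<epsilon>, OF pq(1) \<phi>(1-3) \<epsilon>(1)]) blast
  define f where "f = series_function d Y (sphere_coeff \<Phi>)"
  have \<Phi>_int: "integrable surface_measure \<Phi>" by (rule integrable_of_powr[OF pq(1) \<Phi>(1,2)])
  have "f \<in> harmonic_hardy p" unfolding f_def by (rule poisson_integral_hardy[OF pq(1) \<Phi>(1,2)])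
  then have "series_function d Y (\<lambda>k j. c k j * harmonic_coeff d Y f k j) \<in> weighted_sup_space \<beta>"
    using c unfolding multipliers_def by blast
  then obtain M where M: "\<And>x. x \<in> ball 0 1 \<Longrightarrow>
      (1 - (norm x)\<^sup>2) powr \<beta> * cmod (series_function d Y (\<lambda>k j. c k j * harmonic_coeff d Y f k j) x) \<le> M"
    unfolding weighted_sup_iff by blast
  have upper: "(1 - \<rho> n) powr \<beta> * cmod (\<integral>x. \<Phi> x * G n x \<partial>surface_measure) \<le> M" for n
  proof -
    have "series_function d Y (\<lambda>k j. c k j * harmonic_coeff d Y f k j) (\<rho> n *\<^sub>R y n) =
        series_function d Y (\<lambda>k j. c k j * sphere_coeff \<Phi> k j) (\<rho> n *\<^sub>R y n)"
      by (rule series_function_cong)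
         (simp add: f_def harmonic_coeff_series_function[OF sphere_coeff_subexp[OF \<Phi>_int]])
    also have "\<dots> = (\<integral>x. \<Phi> x * G n x \<partial>surface_measure)"
      unfolding G_def by (rule conv_kernel_integral[OF cs w1 \<Phi>_int, symmetric])
    finally have eq: "series_function d Y (\<lambda>k j. c k j * harmonic_coeff d Y f k j) (\<rho> n *\<^sub>R y n) =
        (\<integral>x. \<Phi> x * G n x \<partial>surface_measure)" .
    have "\<rho> n * \<rho> n \<le> \<rho> n" using \<rho>y(1)[of n] by (intro mult_left_le) auto
    then have "(1 - \<rho> n) powr \<beta> \<le> (1 - (norm (\<rho> n *\<^sub>R y n))\<^sup>2) powr \<beta>"
      using \<rho>y(1,2)[of n] \<beta> by (intro powr_mono2) (auto simp: power2_eq_square)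
    then have "(1 - \<rho> n) powr \<beta> * cmod (\<integral>x. \<Phi> x * G n x \<partial>surface_measure) \<le>
        (1 - (norm (\<rho> n *\<^sub>R y n))\<^sup>2) powr \<beta> * cmod (\<integral>x. \<Phi> x * G n x \<partial>surface_measure)"
      by (intro mult_right_mono) auto
    also have "\<dots> \<le> M" using M[of "\<rho> n *\<^sub>R y n"] w1[of n] by (simp add: eq)
    finally show ?thesis .
  qed
  have lower: "(4 / 3) ^ n / 2 \<le> (1 - \<rho> n) powr \<beta> * cmod (\<integral>x. \<Phi> x * G n x \<partial>surface_measure)" for n
  proof -
    let ?I = "of_real ((1 - \<rho> n) powr \<beta>) * (\<integral>x. \<Phi> x * G n x \<partial>surface_measure)"
    have "(\<lambda>i. of_real ((1 - \<rho> n) powr \<beta>) * (of_real (\<epsilon> i) * (of_real ((1 / 3) ^ i) * (\<integral>x. \<phi> i x * G n x \<partial>surface_measure)))) sums ?I"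
      by (rule sums_mult[OF \<Phi>(3)[OF Gc]])
    then have sums: "(\<lambda>i. of_real (\<epsilon> i) * m n i) sums ?I"
      by (simp add: m_def mult_ac)
    let ?head = "(\<Sum>i<n. of_real (\<epsilon> i) * m n i) + of_real (\<epsilon> n) * m n n"
    have tail: "(\<lambda>i. of_real (\<epsilon> (i + Suc n)) * m n (i + Suc n)) sums (?I - ?head)"
      using sums_split_initial_segment[OF sums, of "Suc n"] by simp
    have geo: "(\<lambda>i. (1 / 3) ^ (i + Suc n) * L n) sums ((1 / 3) ^ n * L n / 2)"
      using sums_mult2[OF geometric_sums[of "1/3 :: real"], of "(1 / 3) ^ Suc n * L n"]
      by (simp add: power_add mult_ac)
    have "cmod (?I - ?head) \<le> (\<Sum>i. (1 / 3) ^ (i + Suc n) * L n)"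
      unfolding sums_unique[OF tail]
    proof (rule norm_suminf_le[OF _ sums_summable[OF geo]])
      show "norm (of_real (\<epsilon> (i + Suc n)) * m n (i + Suc n)) \<le> (1 / 3) ^ (i + Suc n) * L n" for i
        using m_le[of n "i + Suc n"] \<epsilon>(1)[of "i + Suc n"] by (simp only: norm_mult norm_of_real mult_1)
    qed
    also have "\<dots> = (1 / 3) ^ n * L n / 2" using sums_unique[OF geo] by simp
    finally have "cmod (?I - ?head) \<le> (1 / 3) ^ n * L n / 2" .
    moreover have "(1 / 3) ^ n * L n \<le> cmod ?head" using \<epsilon>(2)[of n] by (simp only: m_diag)
    moreover have "cmod ?head \<le> cmod ?I + cmod (?I - ?head)"
      using norm_triangle_ineq4[of ?I "?I - ?head"] by simp
    ultimately have "(1 / 3) ^ n * L n / 2 \<le> cmod ?I" by linarith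
    moreover have "(4 / 3) ^ n \<le> (1 / 3) ^ n * L n"
      using mult_left_mono[OF less_imp_le[OF L4[of n]], of "(1 / 3) ^ n"] by (simp add: power_divide)
    ultimately show ?thesis by (simp add: norm_mult)
  qed
  obtain n where "2 * M < (4 / 3 :: real) ^ n" using real_arch_pow[of "4 / 3" "2 * M"] by auto
  then show False using lower[of n] upper[of n] by linarith
qed

lemma kernel_bounded_multiplier:
  assumes pq: "1 < p" "1 < q" "1 / p + 1 / q = 1" and \<beta>: "0 < \<beta>" and c: "subexp_coeff c"
    and K: "\<And>\<rho> y. \<lbrakk>\<rho> \<in> {0..<1}; y \<in> sphere 0 1\<rbrakk> \<Longrightarrow> (1 - \<rho>) powr \<beta> * surface_norm q (conv_kernel c (\<rho> *\<^sub>R y)) \<le> K"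
  shows "c \<in> multipliers d Y (harmonic_hardy p) (weighted_sup_space \<beta>)"
  unfolding multipliers_def weighted_sup_iff
proof (intro CollectI ballI conjI)
  fix f :: "'a \<Rightarrow> complex" assume "f \<in> harmonic_hardy p"
  then obtain M where f: "f \<in> harmonic_ball" and M: "\<And>r. r \<in> {0..<1} \<Longrightarrow> sphere_mean p f r \<le> M"
    unfolding hardy_iff by blast
  have cb: "subexp_coeff (\<lambda>k j. c k j * harmonic_coeff d Y f k j)"
    by (intro subexp_coeff_mult c harmonic_coeff_subexp f)
  show "series_converges d Y (\<lambda>k j. c k j * harmonic_coeff d Y f k j)" by (rule subexp_coeff_converges[OF cb])
  show "series_function d Y (\<lambda>k j. c k j * harmonic_coeff d Y f k j) \<in> harmonic_ball" by (rule subexp_coeff_harmonic[OF cb])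
  have M0: "0 \<le> M" using order_trans[OF _ M[of 0]] by (simp add: sphere_mean_def)
  show "\<exists>B. \<forall>x\<in>ball 0 1. (1 - (norm x)\<^sup>2) powr \<beta> * cmod (series_function d Y (\<lambda>k j. c k j * harmonic_coeff d Y f k j) x) \<le> B"
  proof (intro exI ballI)
    fix x :: 'a assume "x \<in> ball 0 1"
    then have x: "norm x < 1" by simp
    let ?G = "surface_norm q (conv_kernel c x)"
    have K': "(1 - norm x) powr \<beta> * ?G \<le> K"
      using K[of "norm x" "direction x"] x by (simp add: direction_sphere direction_scale)
    have G0: "0 \<le> ?G" by (simp add: surface_norm_def)
    have "1 - (norm x)\<^sup>2 = (1 + norm x) * (1 - norm x)" by (simp add: power2_eq_square algebra_simps)
    then have "(1 - (norm x)\<^sup>2) powr \<beta> = (1 + norm x) powr \<beta> * (1 - norm x) powr \<beta>"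
      using x by (simp add: powr_mult)
    also have "\<dots> \<le> 2 powr \<beta> * (1 - norm x) powr \<beta>"
      using x \<beta> by (intro mult_right_mono powr_mono2) auto
    finally have "(1 - (norm x)\<^sup>2) powr \<beta> * cmod (series_function d Y (\<lambda>k j. c k j * harmonic_coeff d Y f k j) x) \<le>
        (2 powr \<beta> * (1 - norm x) powr \<beta>) * (M * ?G)"
      by (rule mult_mono[OF _ convolution_bound[OF pq c f M x]]) auto
    also have "\<dots> = 2 powr \<beta> * M * ((1 - norm x) powr \<beta> * ?G)" by (simp add: mult_ac)
    also have "\<dots> \<le> 2 powr \<beta> * M * K" using M0 by (intro mult_left_mono K') auto
    finally show "(1 - (norm x)\<^sup>2) powr \<beta> * cmod (series_function d Y (\<lambda>k j. c k j * harmonic_coeff d Y f k j) x) \<le> 2 powr \<beta> * M * K" .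
  qed
qed

end

theorem theorem8:
  fixes d :: "nat \<Rightarrow> nat"
    and Y :: "nat \<Rightarrow> nat \<Rightarrow> 'a::euclidean_space \<Rightarrow> real"
    and s s' \<beta> :: real
    and c :: "nat \<Rightarrow> nat \<Rightarrow> complex"
    and g :: "'a \<Rightarrow> complex"
  assumes "DIM('a) \<ge> 2"
    and "spherical_harmonic_basis d Y"
    and "1 < s" and "1 / s + 1 / s' = 1" and "\<beta> > 0"
    and "g = series_function d Y c"
  shows "c \<in> multipliers d Y (harmonic_hardy s) (weighted_sup_space \<beta>) \<longleftrightarrow>
    (series_converges d Y c \<and> g \<in> harmonic_ball) \<and>
    (SUP \<rho>\<in>{0..<1}. SUP y\<in>sphere 0 1.
       ereal ((1 - \<rho>) powr \<beta> *
         (\<integral>x. cmod (harmonic_conv d Y g (poisson_kernel x) (\<rho> *\<^sub>R y)) powr s' \<partial>surface_measure)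
           powr (1 / s'))) < \<infinity>"
proof -
  interpret harmonic_basis d Y by unfold_locales (rule assms)+
  have "1 / s' = 1 - 1 / s" using assms(4) by linarith
  moreover have "0 < 1 / s" "1 / s < 1" using assms(3) by auto
  ultimately have "0 < 1 / s'" "1 / s' < 1" by linarith+
  then have s': "1 < s'" by (simp add: divide_less_eq_1 split: if_splits)
  note pq = assms(3) s' assms(4)
  have norm_eq: "(\<integral>x. cmod (harmonic_conv d Y g (poisson_kernel x) w) powr s' \<partial>surface_measure) powr (1 / s') =
      surface_norm s' (conv_kernel c w)" if "subexp_coeff c" for w
    unfolding surface_norm_def assms(6)
    by (intro arg_cong[where f = "\<lambda>t. t powr (1 / s')"] surface_integral_cong)
       (simp only: harmonic_conv_poisson[OF that])
  show ?thesis
    unfolding ereal_SUP_SUP_finite_iff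
  proof (intro iffI conjI)
    assume c: "c \<in> multipliers d Y (harmonic_hardy s) (weighted_sup_space \<beta>)"
    note cs = multiplier_subexp[OF assms(3) c]
    show "series_converges d Y c" "g \<in> harmonic_ball"
      unfolding assms(6) using cs series_harmonic_iff by blast+
    show "\<exists>M. \<forall>\<rho>\<in>{0..<1}. \<forall>y\<in>sphere 0 1. (1 - \<rho>) powr \<beta> *
         (\<integral>x. cmod (harmonic_conv d Y g (poisson_kernel x) (\<rho> *\<^sub>R y)) powr s' \<partial>surface_measure) powr (1 / s') \<le> M"
      unfolding norm_eq[OF cs] by (rule multiplier_kernel_bounded[OF pq assms(5) c])
  next
    assume *: "(series_converges d Y c \<and> g \<in> harmonic_ball) \<and>
      (\<exists>M. \<forall>\<rho>\<in>{0..<1}. \<forall>y\<in>sphere 0 1. (1 - \<rho>) powr \<beta> *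
         (\<integral>x. cmod (harmonic_conv d Y g (poisson_kernel x) (\<rho> *\<^sub>R y)) powr s' \<partial>surface_measure) powr (1 / s') \<le> M)"
    then have cs: "subexp_coeff c" unfolding assms(6) using series_harmonic_iff by blast
    from * show "c \<in> multipliers d Y (harmonic_hardy s) (weighted_sup_space \<beta>)"
      unfolding norm_eq[OF cs] using kernel_bounded_multiplier[OF pq assms(5) cs] by blast
  qed
qed

end
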